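(* Let $n\ge 3$, let $\Omega\subset\mathbb R^n$ be a bounded Lipschitz domain with $x_0\in\partial\Omega$ and, for some integer $1\le k\le n$, let $\partial\Omega$ in a neighborhood of $x_0$ consist of $k$ $C^{1,1}$-hypersurfaces $S_1,\dots,S_k$ intersecting at $x_0$ with the property that the normal vectors of $S_1,\dots,S_k$ at $x_0$ are linearly independent. Suppose $u\in C^\infty(\Omega)$ is a solution of the Loewner--Nirenberg problem in $\Omega$, and $u_{V_{x_0}}$ is the solution of the Loewner--Nirenberg problem in the tangent cone $V_{x_0}$ of $\Omega$ at $x_0$. Then there exist a constant $r>0$ and a $C^{1,1}$-diffeomorphism $T:B_r(x_0)\to T(B_r(x_0))\subseteq\mathbb R^n$, with $T(\Omega\cap B_r(x_0))=V_{x_0}\cap T(B_r(x_0))$ and $T(\partial\Omega\cap B_r(x_0))=\partial V_{x_0}\cap T(B_r(x_0))$, such that, for any $x\in\Omega\cap B_{r/2}(x_0)$, $$\left|\frac{u(x)}{u_{V_{x_0}}(Tx)}-1\right|\le C|x-x_0|,$$ where $C$ is a positive constant depending only on $n$ and the geometry of $\partial\Omega$.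
   Context: Loewner--Nirenberg problem: for a domain $G\subset\mathbb R^n$ with nonempty boundary, a solution of the Loewner--Nirenberg problem in $G$ is a nonnegative $w\in C^\infty(G)$ with $\Delta w=\frac14 n(n-2)w^{\frac{n+2}{n-2}}$ in $G$ and $w(x)\to\infty$ as $x\in G$ tends to any point of $\partial G$ (written $w=\infty$ on $\partial G$). In bounded Lipschitz domains, and in the Lipschitz infinite cones occurring here, such a solution exists and is unique. Domains bounded by hypersurfaces: "$\partial\Omega$ consists of $S_1,\dots,S_k$ near $x_0$" means that $S_1,\dots,S_k$ are $C^{1,1}$-hypersurfaces having $x_0$ as an interior point and that for some $R>0$, $\partial\Omega\cap B_R(x_0)\subseteq\bigcup_{i=1}^k S_i$; moreover no $S_i$ is redundant: for each $\rho\le R$ and each $i$, $(\partial\Omega\cap B_\rho(x_0))\setminus S_i$ is not dense in $\partial\Omega\cap B_\rho(x_0)$. Coordinates $x=(x',x_n)$ are chosen (with $R$ small) so that $S_i\cap B_R(x_0)=\{x\in B_R(x_0):x_n=f_i(x')\}$ with $f_i$ of class $C^{1,1}$, and $\Omega\cap B_R(x_0)=\{x\in B_R(x_0):x_n>g(x')\}$ with $g(x')\in\{f_1(x'),\dots,f_k(x')\}$ for every $x'$. Tangent cone: set $S_i^{1}=\{x\in B_R(x_0):x_n>f_i(x')\}$, $S_i^{-1}=\{x\in B_R(x_0):x_n\le f_i(x')\}$ and, for $l=(l_1,\dots,l_k)\in\{1,-1\}^k$, $\Omega_{l}=\bigcap_{i=1}^kS_i^{l_i}$. Then $\Omega\cap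 B_R(x_0)=\bigcup_{l\in\Lambda}\Omega_l$ for a set $\Lambda\subset\{1,-1\}^k$, namely $\Lambda=\{l:\Omega_l\subseteq\Omega\}$. Let the tangent plane $P_i$ of $S_i$ at $x_0$ be $\{x_n=L_i(x')\}$ with $L_i$ affine, and set $H_i^1=\{x\in\mathbb R^n:x_n>L_i(x')\}$, $H_i^{-1}=\{x\in\mathbb R^n:x_n\le L_i(x')\}$. The tangent cone of $\Omega$ at $x_0$ is $V_{x_0}=\bigcup_{l\in\Lambda}\bigcap_{i=1}^kH_i^{l_i}$, an infinite solid cone with vertex $x_0$ (a half-space if $k=1$). "The geometry of $\partial\Omega$" refers to the quantitative data of $\partial\Omega$ near $x_0$: the Lipschitz character, the $C^{1,1}$-norms of $S_1,\dots,S_k$ near $x_0$, the size of the neighborhood, and the quantitative linear independence of the normals $\nu_1,\dots,\nu_k$ at $x_0$, i.e. the norm of the inverse of $(\nu_1,\dots,\nu_k)^T(\nu_1,\dots,\nu_k)$. *)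

theory Defs
  imports "HOL-Analysis.Analysis"
begin

section \<open>The Loewner--Nirenberg problem\<close>

primrec Ck_on :: "nat \<Rightarrow> 'a::euclidean_space set \<Rightarrow> ('a \<Rightarrow> real) \<Rightarrow> bool" where
  "Ck_on 0 G w \<longleftrightarrow> continuous_on G w"
| "Ck_on (Suc m) G w \<longleftrightarrow>
     (\<forall>x\<in>G. w differentiable (at x)) \<and>
     (\<forall>v. Ck_on m G (\<lambda>x. frechet_derivative w (at x) v))"

definition smooth_on :: "'a::euclidean_space set \<Rightarrow> ('a \<Rightarrow> real) \<Rightarrow> bool" where
  "smooth_on G w \<longleftrightarrow> (\<forall>m. Ck_on m G w)"

definition laplacian :: "('a::euclidean_space \<Rightarrow> real) \<Rightarrow> 'a \<Rightarrow> real" where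
  "laplacian w x =
     (\<Sum>b\<in>Basis. frechet_derivative (\<lambda>y. frechet_derivative w (at y) b) (at x) b)"

definition loewner_nirenberg_solution :: "'a::euclidean_space set \<Rightarrow> ('a \<Rightarrow> real) \<Rightarrow> bool" where
  "loewner_nirenberg_solution G w \<longleftrightarrow>
     smooth_on G w \<and>
     (\<forall>x\<in>G. 0 \<le> w x) \<and>
     (\<forall>x\<in>G. laplacian w x =
        1/4 * real DIM('a) * (real DIM('a) - 2)
          * w x powr ((real DIM('a) + 2) / (real DIM('a) - 2))) \<and>
     (\<forall>p\<in>frontier G. filterlim w at_top (at p within G))"


section \<open>Coordinates \<open>x = (x', x_n)\<close>\<close>

text \<open>
  A choice of coordinates is a unit vector \<open>e\<close>: the last coordinate of \<open>x\<close> is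
  \<open>x \<bullet> e\<close>, and \<open>x'\<close> is the orthogonal projection of \<open>x\<close> to the hyperplane
  orthogonal to \<open>e\<close>, which plays the role of the space of the first \<open>n - 1\<close> coordinates.
  Functions of \<open>x'\<close> are functions on the whole space of which only the values on
  this hyperplane matter.
\<close>

definition hcoord :: "'a::euclidean_space \<Rightarrow> 'a \<Rightarrow> 'a" where
  "hcoord e x = x - (x \<bullet> e) *\<^sub>R e"

definition hdisc :: "'a::euclidean_space \<Rightarrow> 'a \<Rightarrow> real \<Rightarrow> 'a set" where
  "hdisc e x0 R = {y. y \<bullet> e = 0 \<and> dist y (hcoord e x0) < R}"

definition graph_of :: "'a::euclidean_space \<Rightarrow> ('a \<Rightarrow> real) \<Rightarrow> 'a set" where
  "graph_of e \<phi> = {x. x \<bullet> e = \<phi> (hcoord e x)}"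

definition graph_side :: "'a::euclidean_space \<Rightarrow> ('a \<Rightarrow> real) \<Rightarrow> int \<Rightarrow> 'a set" where
  "graph_side e \<phi> s =
     (if s = 1 then {x. x \<bullet> e > \<phi> (hcoord e x)} else {x. x \<bullet> e \<le> \<phi> (hcoord e x)})"

definition bounded_lipschitz_domain :: "'a::euclidean_space set \<Rightarrow> bool" where
  "bounded_lipschitz_domain \<Omega> \<longleftrightarrow>
     bounded \<Omega> \<and> open \<Omega> \<and> connected \<Omega> \<and> \<Omega> \<noteq> {} \<and>
     (\<forall>p\<in>frontier \<Omega>. \<exists>\<rho>>0. \<exists>e L \<phi>. norm e = 1 \<and>
        L-lipschitz_on {y. y \<bullet> e = 0} \<phi> \<and>
        \<Omega> \<inter> ball p \<rho> = ball p \<rho> \<inter> graph_side e \<phi> 1)"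


section \<open>Boundaries consisting of \<open>C\<^sup>1\<^sup>,\<^sup>1\<close>-hypersurfaces\<close>

text \<open>
  \<open>f\<close> is of class \<open>C\<^sup>1\<^sup>,\<^sup>1\<close> on a subset \<open>D\<close> of the hyperplane orthogonal to \<open>e\<close>, with
  gradient \<open>Df\<close> (a vector field tangent to the hyperplane), and its \<open>C\<^sup>1\<^sup>,\<^sup>1\<close>-norm, taken as the
  maximum of the supremum norms of \<open>f\<close> and \<open>Df\<close> and the Lipschitz constant of \<open>Df\<close>,
  is at most \<open>M\<close>.
\<close>

definition C11_norm_le ::
    "'a::euclidean_space \<Rightarrow> 'a set \<Rightarrow> real \<Rightarrow> ('a \<Rightarrow> real) \<Rightarrow> ('a \<Rightarrow> 'a) \<Rightarrow> bool" where
  "C11_norm_le e D M f Df \<longleftrightarrow>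
     (\<forall>y\<in>D. (f has_derivative (\<lambda>h. Df y \<bullet> h)) (at y within D) \<and> Df y \<bullet> e = 0 \<and>
            \<bar>f y\<bar> \<le> M \<and> norm (Df y) \<le> M) \<and>
     M-lipschitz_on D Df"

definition graph_normal :: "'a::euclidean_space \<Rightarrow> 'a \<Rightarrow> ('a \<Rightarrow> 'a) \<Rightarrow> 'a" where
  "graph_normal e x0 Df = sgn (e - Df (hcoord e x0))"

definition tangent_fun ::
    "'a::euclidean_space \<Rightarrow> 'a \<Rightarrow> ('a \<Rightarrow> real) \<Rightarrow> ('a \<Rightarrow> 'a) \<Rightarrow> 'a \<Rightarrow> real" where
  "tangent_fun e x0 f Df y =
     f (hcoord e x0) + Df (hcoord e x0) \<bullet> (y - hcoord e x0)"

definition cell ::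
    "'a::euclidean_space \<Rightarrow> nat \<Rightarrow> (nat \<Rightarrow> 'a \<Rightarrow> real) \<Rightarrow> (nat \<Rightarrow> int) \<Rightarrow> 'a set" where
  "cell e k \<phi> l = (\<Inter>i<k. graph_side e (\<phi> i) (l i))"

definition inner_signs ::
    "'a::euclidean_space set \<Rightarrow> 'a \<Rightarrow> real \<Rightarrow> 'a \<Rightarrow> nat \<Rightarrow> (nat \<Rightarrow> 'a \<Rightarrow> real) \<Rightarrow> (nat \<Rightarrow> int) set" where
  "inner_signs \<Omega> x0 R e k f =
     {l \<in> {..<k} \<rightarrow>\<^sub>E {1, -1}. ball x0 R \<inter> cell e k f l \<subseteq> \<Omega>}"

definition tangent_cone ::
    "'a::euclidean_space set \<Rightarrow> 'a \<Rightarrow> real \<Rightarrow> 'a \<Rightarrow> nat \<Rightarrow> (nat \<Rightarrow> 'a \<Rightarrow> real) \<Rightarrow> (nat \<Rightarrow> 'a \<Rightarrow> 'a) \<Rightarrow> 'a set" where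
  "tangent_cone \<Omega> x0 R e k f Df =
     (\<Union>l\<in>inner_signs \<Omega> x0 R e k f. cell e k (\<lambda>i. tangent_fun e x0 (f i) (Df i)) l)"

text \<open>
  The boundary of \<open>\<Omega>\<close> consists, in the ball of radius \<open>R\<close> about \<open>x0\<close>, of the hypersurfaces
  \<open>S 0, \<dots>, S (k - 1)\<close>, which are the graphs of \<open>f 0, \<dots>, f (k - 1)\<close> in the coordinates given by
  \<open>e\<close>; there \<open>L\<close> is a Lipschitz constant of \<open>\<partial>\<Omega>\<close> and \<open>M\<close> bounds the \<open>C\<^sup>1\<^sup>,\<^sup>1\<close>-norms of the
  hypersurfaces, whose heights are measured from \<open>x0\<close> to make the bound invariant under
  translations. The last conjunct is part of the smallness of \<open>R\<close>: if the normals at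
  \<open>x0\<close> are linearly independent, it follows from the other conjuncts after \<open>R\<close> is decreased.
  For a large \<open>R\<close>, a cell may have several components, and those need not all lie on the same
  side of \<open>\<partial>\<Omega>\<close>.
\<close>

definition boundary_consists_of ::
    "'a::euclidean_space set \<Rightarrow> 'a \<Rightarrow> real \<Rightarrow> 'a \<Rightarrow> nat \<Rightarrow> (nat \<Rightarrow> 'a set) \<Rightarrow>
     (nat \<Rightarrow> 'a \<Rightarrow> real) \<Rightarrow> (nat \<Rightarrow> 'a \<Rightarrow> 'a) \<Rightarrow> ('a \<Rightarrow> real) \<Rightarrow> real \<Rightarrow> real \<Rightarrow> bool" where
  "boundary_consists_of \<Omega> x0 R e k S f Df g L M \<longleftrightarrow>
     R > 0 \<and> norm e = 1 \<and>
     (\<forall>i<k. x0 \<in> S i \<and>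
        S i \<inter> ball x0 R = ball x0 R \<inter> graph_of e (f i) \<and>
        C11_norm_le e (hdisc e x0 R) M (\<lambda>y. f i y - x0 \<bullet> e) (Df i)) \<and>
     frontier \<Omega> \<inter> ball x0 R \<subseteq> (\<Union>i<k. S i) \<and>
     (\<forall>\<rho> i. 0 < \<rho> \<and> \<rho> \<le> R \<and> i < k \<longrightarrow>
        \<not> frontier \<Omega> \<inter> ball x0 \<rho> \<subseteq> closure ((frontier \<Omega> \<inter> ball x0 \<rho>) - S i)) \<and>
     (\<forall>y\<in>hdisc e x0 R. \<exists>i<k. g y = f i y) \<and>
     L-lipschitz_on (hdisc e x0 R) g \<and>
     \<Omega> \<inter> ball x0 R = ball x0 R \<inter> graph_side e g 1 \<and>
     \<Omega> \<inter> ball x0 R = (\<Union>l\<in>inner_signs \<Omega> x0 R e k f. ball x0 R \<inter> cell e k f l)"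

definition linearly_independent_family :: "nat \<Rightarrow> (nat \<Rightarrow> 'a::euclidean_space) \<Rightarrow> bool" where
  "linearly_independent_family k \<nu> \<longleftrightarrow> inj_on \<nu> {..<k} \<and> independent (\<nu> ` {..<k})"

text \<open>
  The Gram matrix of \<open>\<nu> 0, \<dots>, \<nu> (k - 1)\<close> has an inverse \<open>B\<close> of Frobenius norm at most \<open>N\<close>.
\<close>

definition gram_inverse_norm_le :: "nat \<Rightarrow> (nat \<Rightarrow> 'a::euclidean_space) \<Rightarrow> real \<Rightarrow> bool" where
  "gram_inverse_norm_le k \<nu> N \<longleftrightarrow>
     (\<exists>B :: nat \<Rightarrow> nat \<Rightarrow> real.
        (\<forall>i<k. \<forall>j<k. (\<Sum>m<k. B i m * (\<nu> m \<bullet> \<nu> j)) = (if i = j then 1 else 0)) \<and>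
        sqrt (\<Sum>i<k. \<Sum>j<k. (B i j)\<^sup>2) \<le> N)"


section \<open>\<open>C\<^sup>1\<^sup>,\<^sup>1\<close>-diffeomorphisms\<close>

definition C11_map_on :: "'a::euclidean_space set \<Rightarrow> ('a \<Rightarrow> 'a) \<Rightarrow> bool" where
  "C11_map_on U T \<longleftrightarrow>
     (\<exists>(DT :: 'a \<Rightarrow> 'a \<Rightarrow>\<^sub>L 'a) K.
        (\<forall>x\<in>U. (T has_derivative blinfun_apply (DT x)) (at x)) \<and> K-lipschitz_on U DT)"

definition C11_diffeo_on :: "'a::euclidean_space set \<Rightarrow> ('a \<Rightarrow> 'a) \<Rightarrow> bool" where
  "C11_diffeo_on U T \<longleftrightarrow>
     open U \<and> inj_on T U \<and> open (T ` U) \<and> C11_map_on U T \<and> C11_map_on (T ` U) (inv_into U T)"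

end

theory Submission
  imports Defs
begin

text \<open>
  The map \<open>T\<close> is chosen such that the height of \<open>T x\<close> over the \<open>i\<close>-th tangent plane equals the
  vertical height of \<open>x\<close> over the \<open>i\<close>-th surface. To estimate \<open>u\<close> at a point \<open>b\<close> with
  \<open>\<rho> = |b - x0|\<close>, touch every surface vertically below or above \<open>b\<close> by a sphere from inside. All these
  spheres pass through one point, and a single special conformal transformation that fixes \<open>b\<close>
  straightens all of them. A linear map at distance \<open>O(\<rho>)\<close> from the identity then carries the resulting
  planes to the tangent planes and \<open>b\<close> exactly to \<open>T b\<close>. The equation is conformally invariant, and
  a linear change of variables at distance \<open>O(\<rho>)\<close> from the identity perturbs it only by a relative error
  \<open>O(\<rho>)\<close>, because the Hessian of the solution \<open>u\<^sub>V\<close> in the cone is bounded by a multiple of its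
  nonlinearity. Hence \<open>u\<^sub>V\<close> pulls back, up to a factor \<open>1 + O(\<rho>)\<close>, to a supersolution in a
  subdomain of \<open>\<Omega>\<close>, which bounds \<open>u b\<close> by \<open>(1 + O(\<rho>)) u\<^sub>V (T b)\<close>. Spheres touching from outside
  give a subsolution in a domain containing \<open>\<Omega>\<close> and the lower bound. If the radius of the spheres is
  small compared to \<open>R\<close>, the two domains differ from the empty set and from the whole
  space, respectively, only near \<open>b\<close>, so that no boundary values at distance \<open>R\<close> enter.
\<close>

section \<open>Gradient, Hessian and Laplacian\<close>

text \<open>Pulling \<open>u\<^sub>V\<close> back by \<open>T\<close> would not do: the surfaces are
  only of class C^{1,1}, so \<open>T\<close> need not be twice differentiable, and the relative
  error at y would be controlled only by |y - x0|, which on a neighborhood of fixed size is not O(|b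
  - x0|). Hence every \<open>b\<close> gets its own barrier. A conformal map, under which the
  equation is exactly covariant, absorbs the curvature of the surfaces; what is left is one constant
  linear map, whose deviation from the identity is O(|b - x0|) uniformly in space, so one factor
  \<open>exp \<tau>\<close> corrects it everywhere. Independence of the normals provides dual
  vectors, and these prescribe the linear map for all k planes at once. A second obstacle: the
  boundaries of the compared domains may touch, where both functions blow up. One function is
  therefore translated by \<open>t\<close> along \<open>e\<close>, which makes it continuous on the
  closure, and \<open>t\<close> tends to 0. Signs of heights are recorded as sets of indices. Since
  \<Omega> lies above a graph, the admissible sets are closed upwards, and inclusions of domains
  reduce to implications between positive heights.\<close>

definition has_hessian ::
    "('a::euclidean_space \<Rightarrow> real) \<Rightarrow> ('a \<Rightarrow> 'a) \<Rightarrow> ('a \<Rightarrow> 'a) \<Rightarrow> 'a \<Rightarrow> bool" where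
  "has_hessian w g H x \<longleftrightarrow>
     (\<forall>\<^sub>F y in nhds x. (w has_derivative (\<lambda>h. g y \<bullet> h)) (at y)) \<and> (g has_derivative H) (at x)"

definition linear_trace :: "('a::euclidean_space \<Rightarrow> 'a) \<Rightarrow> real" where
  "linear_trace H = (\<Sum>b\<in>Basis. H b \<bullet> b)"

text \<open>A relation instead of the function \<open>laplacian\<close>: it carries twice
  differentiability along, so that sums and compositions have no separate side conditions.\<close>

definition has_laplacian :: "('a::euclidean_space \<Rightarrow> real) \<Rightarrow> 'a \<Rightarrow> real \<Rightarrow> bool" where
  "has_laplacian w x l \<longleftrightarrow> (\<exists>g H. has_hessian w g H x \<and> l = linear_trace H)"

lemma has_hessianI_open:
  assumes "open G" "x \<in> G" "\<And>y. y \<in> G \<Longrightarrow> (w has_derivative (\<lambda>h. g y \<bullet> h)) (at y)"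
    and "(g has_derivative H) (at x)"
  shows "has_hessian w g H x"
  unfolding has_hessian_def
  using eventually_nhds_in_open[OF assms(1,2)] assms(3,4) by (auto elim: eventually_mono)

lemma has_hessian_derivative:
  assumes "has_hessian w g H x"
  shows "(w has_derivative (\<lambda>h. g x \<bullet> h)) (at x)"
  using assms eventually_nhds_x_imp_x unfolding has_hessian_def by blast

lemma has_hessian_isCont: "has_hessian w g H x \<Longrightarrow> isCont w x"
  using has_hessian_derivative has_derivative_continuous by blast

lemma has_laplacian_isCont: "has_laplacian w x l \<Longrightarrow> isCont w x"
  unfolding has_laplacian_def using has_hessian_isCont by blast

lemma has_hessian_linear: "has_hessian w g H x \<Longrightarrow> linear H"
  unfolding has_hessian_def using has_derivative_linear by blast

lemma has_laplacianI: "has_hessian w g H x \<Longrightarrow> has_laplacian w x (linear_trace H)"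
  unfolding has_laplacian_def by blast

lemma has_hessian_add:
  assumes "has_hessian v g H x" "has_hessian w g' H' x"
  shows "has_hessian (\<lambda>y. v y + w y) (\<lambda>y. g y + g' y) (\<lambda>h. H h + H' h) x"
proof -
  have "\<forall>\<^sub>F y in nhds x. ((\<lambda>y. v y + w y) has_derivative (\<lambda>h. (g y + g' y) \<bullet> h)) (at y)"
    using conjunct1[OF assms(1)[unfolded has_hessian_def]]
      conjunct1[OF assms(2)[unfolded has_hessian_def]]
    by eventually_elim (auto simp: inner_add_left intro: has_derivative_add)
  then show ?thesis
    using assms unfolding has_hessian_def by (auto intro!: derivative_intros)
qed

lemma has_hessian_cmult:
  assumes "has_hessian v g H x"
  shows "has_hessian (\<lambda>y. c * v y) (\<lambda>y. c *\<^sub>R g y) (\<lambda>h. c *\<^sub>R H h) x"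
proof -
  have "\<forall>\<^sub>F y in nhds x. ((\<lambda>y. c * v y) has_derivative (\<lambda>h. (c *\<^sub>R g y) \<bullet> h)) (at y)"
    using conjunct1[OF assms[unfolded has_hessian_def]]
    by eventually_elim (auto intro: has_derivative_mult_right)
  moreover have "((\<lambda>y. c *\<^sub>R g y) has_derivative (\<lambda>h. c *\<^sub>R H h)) (at x)"
    using assms unfolding has_hessian_def by (blast intro: has_derivative_scaleR_right)
  ultimately show ?thesis
    unfolding has_hessian_def by blast
qed

lemma linear_trace_add: "linear_trace (\<lambda>h. H h + H' h) = linear_trace H + linear_trace H'"
  by (simp add: linear_trace_def inner_add_left sum.distrib)

lemma linear_trace_cmult: "linear_trace (\<lambda>h. c *\<^sub>R H h) = c * linear_trace H"
  by (simp add: linear_trace_def sum_distrib_left)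

lemma has_laplacian_add:
  "has_laplacian v x l \<Longrightarrow> has_laplacian w x l' \<Longrightarrow> has_laplacian (\<lambda>y. v y + w y) x (l + l')"
  unfolding has_laplacian_def using has_hessian_add linear_trace_add by metis

lemma has_laplacian_cmult: "has_laplacian v x l \<Longrightarrow> has_laplacian (\<lambda>y. c * v y) x (c * l)"
  unfolding has_laplacian_def using has_hessian_cmult linear_trace_cmult by metis

lemma has_laplacian_diff:
  assumes "has_laplacian v x l" "has_laplacian w x l'"
  shows "has_laplacian (\<lambda>y. v y - w y) x (l - l')"
  using has_laplacian_add[OF assms(1) has_laplacian_cmult[OF assms(2), of "-1"]] by simp

text \<open>The adjoint is a parameter, so that translations (identity), reflections (self-adjoint),
  scalings and general linear maps are all instances.\<close>

lemma has_hessian_affine: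
  fixes A A' :: "'a::euclidean_space \<Rightarrow> 'a"
  assumes "has_hessian v g H (A x + c)" "linear A" "linear A'"
    and adj: "\<And>y z. A' y \<bullet> z = y \<bullet> A z"
  shows "has_hessian (\<lambda>y. v (A y + c)) (\<lambda>y. A' (g (A y + c))) (\<lambda>h. A' (H (A h))) x"
proof -
  have A: "(A has_derivative A) F" and A': "(A' has_derivative A') F" for F
    using assms(2,3) by (simp_all add: linear_imp_has_derivative)
  have Ac: "((\<lambda>y. A y + c) has_derivative A) F" for F
    using A by (auto intro!: derivative_eq_intros)
  have cont: "((\<lambda>y. A y + c) \<longlongrightarrow> A x + c) (nhds x)"
    using has_derivative_continuous[OF Ac, of x UNIV]
    by (simp add: continuous_at tendsto_at_iff_tendsto_nhds[of "\<lambda>y. A y + c"])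
  have 1: "\<forall>\<^sub>F y in nhds x. (v has_derivative (\<lambda>h. g (A y + c) \<bullet> h)) (at (A y + c))"
    using assms(1) cont unfolding has_hessian_def filterlim_iff by blast
  have "\<forall>\<^sub>F y in nhds x. ((\<lambda>y. v (A y + c)) has_derivative (\<lambda>h. A' (g (A y + c)) \<bullet> h)) (at y)"
    using 1
  proof eventually_elim
    case (elim y)
    show ?case
      using has_derivative_compose[OF Ac elim] by (simp add: adj)
  qed
  moreover have "((\<lambda>y. A' (g (A y + c))) has_derivative (\<lambda>h. A' (H (A h)))) (at x)"
  proof -
    have "(g has_derivative H) (at (A x + c))"
      using assms(1) by (simp add: has_hessian_def)
    from has_derivative_compose[OF has_derivative_compose[OF Ac this] A'[of "at (g (A x + c))"]]
    show ?thesis by simp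
  qed
  ultimately show ?thesis
    by (simp add: has_hessian_def)
qed

lemma linear_trace_adjoint:
  "(\<And>y z. A' y \<bullet> z = y \<bullet> A z) \<Longrightarrow> linear_trace (\<lambda>h. A' (H (A h))) = (\<Sum>b\<in>Basis. H (A b) \<bullet> A b)"
  by (simp add: linear_trace_def)

lemma has_laplacian_translate:
  assumes "has_laplacian v (x + c) l"
  shows "has_laplacian (\<lambda>y. v (y + c)) x l"
proof -
  obtain g H where "has_hessian v g H (x + c)" "l = linear_trace H"
    using assms has_laplacian_def by blast
  then show ?thesis
    using has_hessian_affine[of v g H id x c id] has_laplacianI by (fastforce simp: linear_id)
qed

section \<open>Second-order conditions at a maximum and comparison principles\<close>

lemma real_derivative_along_line:
  fixes w :: "'a::real_normed_vector \<Rightarrow> real"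
  assumes "(w has_derivative D) (at (x + t *\<^sub>R b))"
  shows "((\<lambda>t. w (x + t *\<^sub>R b)) has_real_derivative D b) (at t)"
proof -
  have "((\<lambda>t. x + t *\<^sub>R b) has_derivative (\<lambda>s. s *\<^sub>R b)) (at t)"
    by (auto intro!: derivative_eq_intros)
  from has_derivative_compose[OF this assms]
  have "((\<lambda>t. w (x + t *\<^sub>R b)) has_derivative (\<lambda>s. D (s *\<^sub>R b))) (at t)" .
  moreover have "D (s *\<^sub>R b) = D b * s" for s
    using has_derivative_linear[OF assms] by (simp add: linear_cmul)
  ultimately show ?thesis
    by (simp add: has_field_derivative_def)
qed

text \<open>If the second derivative in direction \<open>b\<close> were positive, the directional
  derivative, which vanishes at the maximum, would be positive just after it, and the mean value
  theorem would make \<open>f\<close> increase along \<open>b\<close>.\<close>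

lemma has_hessian_local_max:
  fixes f :: "'a::euclidean_space \<Rightarrow> real"
  assumes hess: "has_hessian f g H x" and max: "\<forall>\<^sub>F y in nhds x. f y \<le> f x" and b: "norm b = 1"
  shows "H b \<bullet> b \<le> 0"
proof (rule ccontr)
  assume neg: "\<not> H b \<bullet> b \<le> 0"
  obtain d where "d > 0" and d: "\<And>y. dist y x < d \<Longrightarrow> f y \<le> f x"
      "\<And>y. dist y x < d \<Longrightarrow> (f has_derivative (\<lambda>h. g y \<bullet> h)) (at y)"
    using max hess eventually_conj[of "\<lambda>y. f y \<le> f x" "nhds x"]
    unfolding has_hessian_def eventually_nhds_metric by (smt (verit, best))
  have near: "dist (x + t *\<^sub>R b) x < d" if "\<bar>t\<bar> < d" for t
    using that b by (simp add: dist_norm)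
  have D1: "((\<lambda>t. f (x + t *\<^sub>R b)) has_real_derivative g (x + t *\<^sub>R b) \<bullet> b) (at t)" if "\<bar>t\<bar> < d" for t
    using real_derivative_along_line[OF d(2)[OF near[OF that]]] .
  have g0: "g x \<bullet> b = 0"
  proof -
    have "((\<lambda>t. f (x + t *\<^sub>R b)) has_real_derivative g x \<bullet> b) (at 0)"
      using D1[of 0] \<open>d > 0\<close> by simp
    moreover have "\<forall>t. \<bar>0 - t\<bar> < d \<longrightarrow> f (x + t *\<^sub>R b) \<le> f (x + 0 *\<^sub>R b)"
      using d(1) near by simp
    ultimately show ?thesis
      using DERIV_local_max \<open>d > 0\<close> by blast
  qed
  have "((\<lambda>y. g y \<bullet> b) has_derivative (\<lambda>h. H h \<bullet> b)) (at (x + 0 *\<^sub>R b))"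
    using hess unfolding has_hessian_def by (auto intro!: derivative_eq_intros)
  then have "((\<lambda>t. g (x + t *\<^sub>R b) \<bullet> b) has_real_derivative H b \<bullet> b) (at 0)"
    using real_derivative_along_line[of "\<lambda>y. g y \<bullet> b" "\<lambda>h. H h \<bullet> b"] by blast
  from DERIV_pos_inc_right[OF this] neg g0
  obtain e where "e > 0" and e: "\<And>h. 0 < h \<Longrightarrow> h < e \<Longrightarrow> 0 < g (x + h *\<^sub>R b) \<bullet> b"
    by auto
  define t where "t = min d e / 2"
  have t: "0 < t" "t < d" "t < e"
    using \<open>d > 0\<close> \<open>e > 0\<close> by (auto simp: t_def)
  obtain s where s: "0 < s" "s < t" and
    "f (x + t *\<^sub>R b) - f (x + 0 *\<^sub>R b) = (t - 0) * (g (x + s *\<^sub>R b) \<bullet> b)"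
    using MVT2[of 0 t "\<lambda>t. f (x + t *\<^sub>R b)" "\<lambda>t. g (x + t *\<^sub>R b) \<bullet> b"] t D1 by force
  then have "f (x + t *\<^sub>R b) > f x"
    using t e[of s] by (simp add: zero_less_mult_iff algebra_simps)
  moreover have "f (x + t *\<^sub>R b) \<le> f x"
    using d(1) near[of t] t by simp
  ultimately show False by simp
qed

lemma has_laplacian_local_max:
  assumes "has_laplacian f x l" "\<forall>\<^sub>F y in nhds x. f y \<le> f x"
  shows "l \<le> 0"
  using assms has_hessian_local_max unfolding has_laplacian_def linear_trace_def
  by (force intro: sum_nonpos)

text \<open>The condition \<open>bdry\<close> treats the boundary and infinity at once: the set
  where \<open>f\<close> is at least \<open>\<delta>\<close> lies in a compact subset of
  \<open>G\<close>. A positive maximum is then attained, where the Laplacian would be both positive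
  and nonpositive.\<close>

lemma maximum_principle:
  fixes f :: "'a::euclidean_space \<Rightarrow> real"
  assumes "open G" and lap: "\<And>x. x \<in> G \<Longrightarrow> has_laplacian f x (l x)"
    and pos: "\<And>x. x \<in> G \<Longrightarrow> 0 < f x \<Longrightarrow> 0 < l x"
    and bdry: "\<And>\<delta>. 0 < \<delta> \<Longrightarrow> \<exists>K. compact K \<and> K \<subseteq> G \<and> (\<forall>x\<in>G - K. f x < \<delta>)"
    and "x \<in> G"
  shows "f x \<le> 0"
proof (rule ccontr)
  assume "\<not> f x \<le> 0"
  then obtain K where K: "compact K" "K \<subseteq> G" "\<And>y. y \<in> G - K \<Longrightarrow> f y < f x"
    using bdry[of "f x"] by auto
  then have "x \<in> K"
    using \<open>x \<in> G\<close> by blast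
  moreover have "continuous_on K f"
    using lap K(2) has_laplacian_isCont continuous_at_imp_continuous_on by blast
  ultimately obtain z where z: "z \<in> K" "\<And>y. y \<in> K \<Longrightarrow> f y \<le> f z"
    using continuous_attains_sup[OF K(1)] by blast
  have "f x \<le> f z"
    using z(2) \<open>x \<in> K\<close> by blast
  have "z \<in> G"
    using z(1) K(2) by blast
  have "\<forall>\<^sub>F y in nhds z. y \<in> G"
    using \<open>open G\<close> \<open>z \<in> G\<close> by (rule eventually_nhds_in_open)
  then have "\<forall>\<^sub>F y in nhds z. f y \<le> f z"
  proof eventually_elim
    case (elim y)
    then show ?case
      using z(2)[of y] K(3)[of y] \<open>f x \<le> f z\<close> by fastforce
  qed
  with lap[OF \<open>z \<in> G\<close>] have "l z \<le> 0"
    by (rule has_laplacian_local_max)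
  moreover have "0 < l z"
    using pos[OF \<open>z \<in> G\<close>] \<open>f x \<le> f z\<close> \<open>\<not> f x \<le> 0\<close> by simp
  ultimately show False by simp
qed

text \<open>A sequence with \<open>v - w \<ge> \<delta>\<close> cannot approach the frontier, since
  \<open>v \<le> B\<close> keeps \<open>w\<close> bounded along it while \<open>w\<close> blows up.
  Together with \<open>bnd\<close>, which handles infinity, this supplies the compact sets for the
  maximum principle.\<close>

lemma comparison_blowup:
  fixes v w :: "'a::euclidean_space \<Rightarrow> real"
  assumes "open G" and B: "\<And>x. x \<in> G \<Longrightarrow> v x \<le> B"
    and bnd: "\<And>\<delta>. 0 < \<delta> \<Longrightarrow> bounded {x \<in> G. \<delta> \<le> v x - w x}"
    and lapv: "\<And>x. x \<in> G \<Longrightarrow> has_laplacian v x (lv x)"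
    and lapw: "\<And>x. x \<in> G \<Longrightarrow> has_laplacian w x (lw x)"
    and less: "\<And>x. x \<in> G \<Longrightarrow> w x < v x \<Longrightarrow> lw x < lv x"
    and blowup: "\<And>p. p \<in> frontier G \<Longrightarrow> filterlim w at_top (at p within G)"
    and "x \<in> G"
  shows "v x \<le> w x"
proof -
  have "v x - w x \<le> 0"
  proof (rule maximum_principle[where f = "\<lambda>x. v x - w x" and l = "\<lambda>x. lv x - lw x", OF \<open>open G\<close>])
    fix \<delta> :: real assume "0 < \<delta>"
    define S where "S = {x \<in> G. \<delta> \<le> v x - w x}"
    have "closed S"
      unfolding closed_sequential_limits
    proof safe
      fix s p assume s: "\<forall>n. s n \<in> S" "s \<longlonglongrightarrow> p"
      have sG: "s n \<in> G" "\<delta> \<le> v (s n) - w (s n)" for n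
        using s(1) by (auto simp: S_def)
      have p: "p \<in> closure G"
        using sG s(2) closure_sequential by blast
      have "p \<in> G"
      proof (rule ccontr)
        assume "p \<notin> G"
        then have "p \<in> frontier G"
          using p \<open>open G\<close> by (simp add: frontier_def interior_open)
        moreover have "filterlim s (at p within G) sequentially"
          using s(2) sG \<open>p \<notin> G\<close> by (auto simp: filterlim_at intro!: always_eventually)
        ultimately have "filterlim (\<lambda>n. w (s n)) at_top sequentially"
          using filterlim_compose[OF blowup] by blast
        then have "\<forall>\<^sub>F n in sequentially. B < w (s n)"
          by (simp add: filterlim_at_top_dense)
        then obtain n where "B < w (s n)"
          using eventually_happens' sequentially_bot by blast
        with sG[of n] B[of "s n"] \<open>0 < \<delta>\<close> show False
          by fastforce
      qed
      moreover from this have "isCont (\<lambda>x. v x - w x) p"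
        using has_laplacian_isCont[OF has_laplacian_diff[OF lapv lapw]] by blast
      then have "(\<lambda>n. v (s n) - w (s n)) \<longlonglongrightarrow> v p - w p"
        using isCont_tendsto_compose s(2) by blast
      then have "\<delta> \<le> v p - w p"
        using LIMSEQ_le_const sG(2) by blast
      ultimately show "p \<in> S"
        by (simp add: S_def)
    qed
    then have "compact S"
      using bnd[OF \<open>0 < \<delta>\<close>] by (simp add: compact_eq_bounded_closed S_def)
    then show "\<exists>K. compact K \<and> K \<subseteq> G \<and> (\<forall>x\<in>G - K. v x - w x < \<delta>)"
      by (intro exI[of _ S]) (auto simp: S_def)
  next
    fix y assume "y \<in> G"
    then show "has_laplacian (\<lambda>x. v x - w x) y (lv y - lw y)"
      using has_laplacian_diff lapv lapw by blast
  next
    fix y assume "y \<in> G" "0 < v y - w y"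
    then show "0 < lv y - lw y"
      using less[of y] by simp
  qed fact
  then show ?thesis by simp
qed

lemma comparison_blowup_bounded:
  fixes v w :: "'a::euclidean_space \<Rightarrow> real"
  assumes "open G" "bounded G" and cont: "continuous_on (closure G) v"
    and "\<And>x. x \<in> G \<Longrightarrow> has_laplacian v x (lv x)"
    and "\<And>x. x \<in> G \<Longrightarrow> has_laplacian w x (lw x)"
    and "\<And>x. x \<in> G \<Longrightarrow> w x < v x \<Longrightarrow> lw x < lv x"
    and "\<And>p. p \<in> frontier G \<Longrightarrow> filterlim w at_top (at p within G)"
    and "x \<in> G"
  shows "v x \<le> w x"
proof -
  have "compact (closure G)"
    using \<open>bounded G\<close> by (simp add: compact_closure)
  then obtain B where B: "\<And>y. y \<in> closure G \<Longrightarrow> \<bar>v y\<bar> \<le> B"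
    using compact_imp_bounded[OF compact_continuous_image[OF cont]]
    by (auto simp: bounded_iff)
  have "v y \<le> B" if "y \<in> G" for y
    using B[of y] closure_subset[of G] that by auto
  moreover have "bounded {x \<in> G. \<delta> \<le> v x - w x}" for \<delta>
    using \<open>bounded G\<close> by (rule bounded_subset) auto
  ultimately show ?thesis
    using assms comparison_blowup[of G v B w lv lw x] by blast
qed

section \<open>From the derivatives of the statement to gradients and Hessians\<close>

lemma frechet_derivative_eq:
  assumes "w differentiable (at x)"
  shows "frechet_derivative w (at x) h = (\<Sum>b\<in>Basis. frechet_derivative w (at x) b *\<^sub>R b) \<bullet> h"
proof -
  have lin: "linear (frechet_derivative w (at x))"
    using assms frechet_derivative_works has_derivative_linear by blast
  have "frechet_derivative w (at x) h = frechet_derivative w (at x) (\<Sum>b\<in>Basis. (h \<bullet> b) *\<^sub>R b)"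
    by (simp add: euclidean_representation)
  also have "\<dots> = (\<Sum>b\<in>Basis. (h \<bullet> b) * frechet_derivative w (at x) b)"
    using lin by (simp add: linear_sum linear_cmul)
  finally show ?thesis
    by (simp add: inner_sum_left inner_commute[of h] mult.commute)
qed

lemma smooth_on_hessian:
  fixes w :: "'a::euclidean_space \<Rightarrow> real"
  assumes "smooth_on G w"
  obtains g H where "\<And>x. x \<in> G \<Longrightarrow> (w has_derivative (\<lambda>h. g x \<bullet> h)) (at x)"
    and "\<And>x. x \<in> G \<Longrightarrow> (g has_derivative H x) (at x)"
    and "\<And>x. x \<in> G \<Longrightarrow> laplacian w x = linear_trace (H x)"
proof -
  have 2: "Ck_on 2 G w"
    using assms smooth_on_def by blast
  have d1: "w differentiable (at x)" if "x \<in> G" for x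
    using 2 that by (simp add: numeral_2_eq_2)
  have d2: "(\<lambda>x. frechet_derivative w (at x) v) differentiable (at x)" if "x \<in> G" for x v
    using 2 that by (simp add: numeral_2_eq_2)
  define g where "g x = (\<Sum>b\<in>Basis. frechet_derivative w (at x) b *\<^sub>R b)" for x
  define H where
    "H x h = (\<Sum>b\<in>Basis. frechet_derivative (\<lambda>y. frechet_derivative w (at y) b) (at x) h *\<^sub>R b)" for x h
  show thesis
  proof
    fix x assume x: "x \<in> G"
    show "(w has_derivative (\<lambda>h. g x \<bullet> h)) (at x)"
      using d1[OF x] frechet_derivative_eq[OF d1[OF x]] frechet_derivative_works[of w "at x"]
      unfolding g_def by (metis (no_types, lifting) has_derivative_eq_rhs ext)
    show "(g has_derivative H x) (at x)"
      unfolding g_def H_def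
      by (intro has_derivative_sum has_derivative_scaleR_left)
        (use d2[OF x] frechet_derivative_works in blast)
    show "laplacian w x = linear_trace (H x)"
      by (simp add: laplacian_def linear_trace_def H_def inner_sum_left inner_Basis if_distrib cong: if_cong)
  qed
qed

section \<open>Kelvin transform and interior estimates\<close>

lemma powr_minus_shift:
  fixes s m :: real
  assumes "s > 0"
  shows "s powr (- m) = s powr (- m - 1) * s" "s powr (- m - 1) = s powr (- m - 2) * s"
    "s powr (- m) = s powr (- m - 2) * s\<^sup>2"
proof -
  have "- m = (- m - 1) + 1" "- m - 1 = (- m - 2) + 1" by simp_all
  then show *: "s powr (- m) = s powr (- m - 1) * s" "s powr (- m - 1) = s powr (- m - 2) * s"
    using assms powr_add[of s "- m - 1" 1] powr_add[of s "- m - 2" 1] by (simp_all only:) simp_all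
  show "s powr (- m) = s powr (- m - 2) * s\<^sup>2"
    unfolding * by (simp add: power2_eq_square)
qed

lemma linear_trace_rank_one:
  fixes \<phi> :: "'a::euclidean_space \<Rightarrow> real"
  assumes "linear \<phi>"
  shows "linear_trace (\<lambda>h. \<phi> h *\<^sub>R y) = \<phi> y"
proof -
  have "\<phi> y = \<phi> (\<Sum>b\<in>Basis. (y \<bullet> b) *\<^sub>R b)"
    by (simp add: euclidean_representation)
  also have "\<dots> = (\<Sum>b\<in>Basis. (y \<bullet> b) * \<phi> b)"
    using assms by (simp add: linear_sum linear_cmul)
  finally show ?thesis
    by (simp add: linear_trace_def mult.commute)
qed

lemma linear_trace_ident: "linear_trace (\<lambda>h::'a::euclidean_space. h) = real DIM('a)"
  by (simp add: linear_trace_def)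

lemma linear_trace_diff: "linear_trace (\<lambda>h. H h - H' h) = linear_trace H - linear_trace H'"
  by (simp add: linear_trace_def inner_diff_left sum_subtractf)

lemma linear_inner_scaled: "linear (\<lambda>h. c * (x \<bullet> h))"
  by (simp add: linear_iff inner_add_right algebra_simps)

text \<open>The derivative of the inversion is a multiple of the identity plus a rank-one map, so
  beyond a scaling the trace changes only by one evaluation \<open>x \<bullet> H x\<close>.\<close>

lemma linear_trace_compose_inversion:
  assumes "linear H"
  shows "linear_trace (\<lambda>h. H (h /\<^sub>R s - (2 / s\<^sup>2 * (x \<bullet> h)) *\<^sub>R x)) =
    linear_trace H / s - 2 / s\<^sup>2 * (x \<bullet> H x)"
proof -
  have "(\<lambda>h. H (h /\<^sub>R s - (2 / s\<^sup>2 * (x \<bullet> h)) *\<^sub>R x)) =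
      (\<lambda>h. (1/s) *\<^sub>R H h - (2 / s\<^sup>2 * (x \<bullet> h)) *\<^sub>R H x)"
    using assms by (auto simp: linear_diff linear_cmul divide_inverse)
  then show ?thesis
    using linear_trace_rank_one[OF linear_inner_scaled, of "2 / s\<^sup>2" x "H x"]
    by (simp only: linear_trace_diff linear_trace_cmult) simp
qed

lemma has_derivative_inversion:
  fixes x :: "'a::euclidean_space"
  assumes "x \<noteq> 0"
  shows "((\<lambda>y. y /\<^sub>R (y \<bullet> y)) has_derivative
    (\<lambda>h. h /\<^sub>R (x \<bullet> x) - (2 / (x \<bullet> x)\<^sup>2 * (x \<bullet> h)) *\<^sub>R x)) (at x)"
  using assms
  by (auto intro!: derivative_eq_intros ext simp: inner_commute power2_eq_square field_simps)

text \<open>Here \<open>(y \<bullet> y) powr (- m)\<close> is |y|^(2-n), so this is the Kelvin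
  transform. Gradient and Hessian are computed in closed form; in the trace all terms with
  \<open>v\<close> and its gradient cancel because the dimension is 2m + 2.\<close>

lemma has_laplacian_kelvin:
  fixes v :: "'a::euclidean_space \<Rightarrow> real"
  defines "m \<equiv> (real DIM('a) - 2) / 2"
  assumes "x \<noteq> 0" and "has_laplacian v (x /\<^sub>R (x \<bullet> x)) l"
  shows "has_laplacian (\<lambda>y. (y \<bullet> y) powr (- m) * v (y /\<^sub>R (y \<bullet> y))) x ((x \<bullet> x) powr (- m - 2) * l)"
proof -
  obtain g H where gH: "has_hessian v g H (x /\<^sub>R (x \<bullet> x))" and l: "l = linear_trace H"
    using assms(3) has_laplacian_def by blast
  define \<Psi> where "\<Psi> y = y /\<^sub>R (y \<bullet> y)" for y :: 'a
  define D\<Psi> where "D\<Psi> y h = h /\<^sub>R (y \<bullet> y) - (2 / (y \<bullet> y)\<^sup>2 * (y \<bullet> h)) *\<^sub>R y" for y h :: 'a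
  have D\<Psi>: "(\<Psi> has_derivative D\<Psi> y) (at y)" if "y \<noteq> 0" for y
    using has_derivative_inversion[OF that] unfolding \<Psi>_def D\<Psi>_def .
  define G where "G y = (y \<bullet> y) powr (- m - 1) *\<^sub>R
      (g (\<Psi> y) - (2 * m * v (\<Psi> y) + 2 * (y \<bullet> g (\<Psi> y)) / (y \<bullet> y)) *\<^sub>R y)" for y
  define s where "s = x \<bullet> x"
  have s: "s > 0"
    using \<open>x \<noteq> 0\<close> by (simp add: s_def)
  have powr: "s powr (- m - 1) = s powr (-m - 2) * s" "s powr (-m) = s powr (-m-2) * s^2"
    using powr_minus_shift[OF s, of m] by simp_all
  have cont: "(\<Psi> \<longlongrightarrow> \<Psi> x) (nhds x)"
    using has_derivative_continuous[OF D\<Psi>[OF \<open>x \<noteq> 0\<close>]]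
    by (simp add: continuous_at tendsto_at_iff_tendsto_nhds)
  have "\<forall>\<^sub>F y in nhds x. (v has_derivative (\<lambda>h. g (\<Psi> y) \<bullet> h)) (at (\<Psi> y))"
    using gH cont unfolding has_hessian_def filterlim_iff \<Psi>_def by blast
  moreover have "\<forall>\<^sub>F y in nhds x. y \<in> - {0}"
    by (rule eventually_nhds_in_open) (use \<open>x \<noteq> 0\<close> in auto)
  ultimately have 1: "\<forall>\<^sub>F y in nhds x.
      ((\<lambda>y. (y \<bullet> y) powr (- m) * v (\<Psi> y)) has_derivative (\<lambda>h. G y \<bullet> h)) (at y)"
  proof eventually_elim
    case (elim y)
    then have y: "y \<noteq> 0" "y \<bullet> y > 0" by auto
    have p: "(y \<bullet> y) powr (- m) = (y \<bullet> y) powr (- m - 1) * (y \<bullet> y)"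
      using powr_minus_shift[OF y(2), of m] by simp
    have "((\<lambda>y. v (\<Psi> y)) has_derivative (\<lambda>h. g (\<Psi> y) \<bullet> D\<Psi> y h)) (at y)"
      using has_derivative_compose[OF D\<Psi>[OF y(1)] elim(1)] .
    moreover have "((\<lambda>y. (y \<bullet> y) powr (- m)) has_derivative
        (\<lambda>h. (y \<bullet> y) powr (- m - 1) * (- 2 * m * (y \<bullet> h)))) (at y)"
      using y p by (auto intro!: derivative_eq_intros ext simp: inner_commute field_simps)
    ultimately have "((\<lambda>y. (y \<bullet> y) powr (- m) * v (\<Psi> y)) has_derivative
        (\<lambda>h. (y \<bullet> y) powr (- m) * (g (\<Psi> y) \<bullet> D\<Psi> y h) +
             (y \<bullet> y) powr (- m - 1) * (- 2 * m * (y \<bullet> h)) * v (\<Psi> y))) (at y)"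
      by - (rule has_derivative_mult; assumption)
    moreover have "(y \<bullet> y) powr (- m) * (g (\<Psi> y) \<bullet> D\<Psi> y h) +
             (y \<bullet> y) powr (- m - 1) * (- 2 * m * (y \<bullet> h)) * v (\<Psi> y) = G y \<bullet> h" for h
    proof -
      have q: "(y \<bullet> y) * (g (\<Psi> y) \<bullet> D\<Psi> y h) = g (\<Psi> y) \<bullet> h - 2 * (y \<bullet> h) * (y \<bullet> g (\<Psi> y)) / (y \<bullet> y)"
        using y unfolding D\<Psi>_def
        by (simp add: inner_diff_right inner_commute power2_eq_square field_simps)
      have "(y \<bullet> y) powr (- m) * (g (\<Psi> y) \<bullet> D\<Psi> y h) =
          (y \<bullet> y) powr (- m - 1) * ((y \<bullet> y) * (g (\<Psi> y) \<bullet> D\<Psi> y h))"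
        using p by simp
      then show ?thesis
        unfolding G_def q
        by (simp add: inner_diff_left inner_add_left algebra_simps)
    qed
    ultimately show ?case by simp
  qed
  define \<Gamma> where "\<Gamma> = g (\<Psi> x)"
  define V where "V = v (\<Psi> x)"
  define c where "c = 2 * m * V + 2 * (x \<bullet> \<Gamma>) / s"
  define K where "K h = H (D\<Psi> x h)" for h
  have linH: "linear H"
    using gH has_hessian_linear by blast
  have "(v has_derivative (\<lambda>h. \<Gamma> \<bullet> h)) (at (\<Psi> x))"
    using has_hessian_derivative[OF gH] by (simp add: \<Gamma>_def \<Psi>_def)
  from has_derivative_compose[OF D\<Psi>[OF \<open>x \<noteq> 0\<close>] this]
  have Dv: "((\<lambda>y. v (\<Psi> y)) has_derivative (\<lambda>h. \<Gamma> \<bullet> D\<Psi> x h)) (at x)" .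
  have "(g has_derivative H) (at (\<Psi> x))"
    using gH by (simp add: has_hessian_def \<Psi>_def)
  from has_derivative_compose[OF D\<Psi>[OF \<open>x \<noteq> 0\<close>] this]
  have Dg: "((\<lambda>y. g (\<Psi> y)) has_derivative K) (at x)"
    unfolding K_def .
  \<comment> \<open>The derivative of the coefficient of \<open>y\<close> in \<open>G\<close>; since
    it multiplies the fixed vector \<open>x\<close>, it contributes only \<open>c' x\<close> to the
    trace.\<close>
  define c' where "c' h = 2 * m * (\<Gamma> \<bullet> D\<Psi> x h) +
      (2 / s * (\<Gamma> \<bullet> h) + 2 / s * (x \<bullet> K h) - 4 * (x \<bullet> \<Gamma>) / s^2 * (x \<bullet> h))" for h
  have Dc: "((\<lambda>y. 2 * m * v (\<Psi> y) + 2 * (y \<bullet> g (\<Psi> y)) / (y \<bullet> y)) has_derivative c') (at x)"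
    unfolding c'_def
    using s \<open>x \<noteq> 0\<close>
    by (auto intro!: derivative_eq_intros Dv Dg ext
        simp: \<Gamma>_def[symmetric] s_def[symmetric] inner_commute power2_eq_square field_simps)
  have Dp: "((\<lambda>y. (y \<bullet> y) powr (- m - 1)) has_derivative
        (\<lambda>h. s powr (- m - 2) * (- 2 * (m + 1) * (x \<bullet> h)))) (at x)"
    using s powr unfolding s_def
    by (auto intro!: derivative_eq_intros ext simp: inner_commute field_simps)
  define DG where "DG h = (s powr (- m - 2) * s) *\<^sub>R (K h - (c *\<^sub>R h + c' h *\<^sub>R x)) +
      (s powr (- m - 2) * (- 2 * (m + 1) * (x \<bullet> h))) *\<^sub>R (\<Gamma> - c *\<^sub>R x)" for h
  have 2: "(G has_derivative DG) (at x)"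
    unfolding G_def[abs_def] DG_def[abs_def]
    by (rule derivative_eq_intros Dp Dg Dc refl)+
      (simp add: powr \<Gamma>_def V_def c_def s_def powr[unfolded s_def])
  have lin_c': "linear c'"
    using Dc has_derivative_linear by blast
  have trK: "linear_trace K = l / s - 2 / s\<^sup>2 * (x \<bullet> H x)"
    unfolding K_def[abs_def] D\<Psi>_def l s_def[symmetric] by (rule linear_trace_compose_inversion[OF linH])
  have D\<Psi>x: "D\<Psi> x x = (- 1 / s) *\<^sub>R x"
    using s unfolding D\<Psi>_def s_def[symmetric]
    by (simp add: field_simps power2_eq_square scaleR_left_diff_distrib[symmetric])
  have Kx: "K x = (- 1 / s) *\<^sub>R H x"
    unfolding K_def D\<Psi>x using linH by (simp add: linear_cmul del: scaleR_minus_left)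
  have c'x: "c' x = - 2 * m * (x \<bullet> \<Gamma>) / s + (2 / s * (x \<bullet> \<Gamma>) - 2 / s^2 * (x \<bullet> H x) - 4 * (x \<bullet> \<Gamma>) / s)"
    unfolding c'_def D\<Psi>x Kx using s
    by (simp add: s_def[symmetric] inner_commute power2_eq_square field_simps)
  have DG: "DG = (\<lambda>h. (s powr (- m - 2)) *\<^sub>R (s *\<^sub>R (K h - (c *\<^sub>R h + c' h *\<^sub>R x)) +
      (- 2 * (m + 1) * (x \<bullet> h)) *\<^sub>R (\<Gamma> - c *\<^sub>R x)))"
    by (simp add: DG_def[abs_def] scaleR_add_right)
  have "linear_trace DG = s powr (- m - 2) *
      (s * (linear_trace K - (c * real DIM('a) + c' x)) + (- 2 * (m + 1)) * (x \<bullet> (\<Gamma> - c *\<^sub>R x)))"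
    unfolding DG linear_trace_cmult linear_trace_add linear_trace_diff linear_trace_ident
      linear_trace_rank_one[OF lin_c'] linear_trace_rank_one[OF linear_inner_scaled] ..
  also have "s * (linear_trace K - (c * real DIM('a) + c' x)) + (- 2 * (m + 1)) * (x \<bullet> (\<Gamma> - c *\<^sub>R x)) = l"
  proof -
    have n: "real DIM('a) = 2 * m + 2"
      by (simp add: m_def field_simps)
    show ?thesis
      unfolding trK c'x n c_def using s
      by (simp add: inner_diff_right s_def[symmetric] power2_eq_square field_simps)
  qed
  finally have tr: "linear_trace DG = s powr (- m - 2) * l" .
  have "has_hessian (\<lambda>y. (y \<bullet> y) powr (- m) * v (\<Psi> y)) G DG x"
    using 1 2 by (simp add: has_hessian_def)
  from has_laplacianI[OF this] show ?thesis
    unfolding tr \<Psi>_def s_def .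
qed

text \<open>With \<open>\<sigma> = 1\<close> the region \<open>s > 0\<close> is the ball, with
  \<open>\<sigma> = -1\<close> its exterior, so one computation serves the barriers for the upper
  and the lower bound. The dimension 2m + 2 removes every dependence on \<open>x - q\<close> except
  the power of \<open>s\<close>.\<close>

lemma has_laplacian_sphere_barrier:
  fixes x q :: "'a::euclidean_space" and \<sigma> \<rho> :: real
  defines "m \<equiv> (real DIM('a) - 2) / 2"
  defines "s \<equiv> (\<lambda>y. \<sigma> * (\<rho>\<^sup>2 - (y - q) \<bullet> (y - q)))"
  assumes "s x > 0" "\<sigma>\<^sup>2 = 1"
  shows "has_laplacian (\<lambda>y. s y powr (- m)) x (2 * m * real DIM('a) * \<rho>\<^sup>2 * s x powr (- m - 2))"
proof -
  have Ds: "(s has_derivative (\<lambda>h. - 2 * \<sigma> * ((y - q) \<bullet> h))) (at y)" for y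
    unfolding s_def by (auto intro!: derivative_eq_intros ext simp: inner_commute algebra_simps)
  have "continuous_on UNIV s"
    unfolding s_def by (intro continuous_intros)
  then have op: "open {y. 0 < s y}"
    using open_Collect_less[of "\<lambda>_. 0" s] by simp
  define g where "g y = (2 * \<sigma> * m * s y powr (- m - 1)) *\<^sub>R (y - q)" for y
  define H where "H h = (2 * \<sigma> * m * s x powr (- m - 2)) *\<^sub>R (s x *\<^sub>R h + (2 * \<sigma> * (m + 1) * ((x - q) \<bullet> h)) *\<^sub>R (x - q))" for h
  have p: "s y powr (- m) = s y powr (-m - 1) * s y" "s y powr (- m - 1) = s y powr (-m - 2) * s y" if "s y > 0" for y
    using powr_minus_shift[OF that, of m] by simp_all
  have powr': "((\<lambda>y. s y powr (- m)) has_derivative (\<lambda>h. g y \<bullet> h)) (at y)" if "s y > 0" for y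
    using that p[OF that]
    by (auto intro!: derivative_eq_intros Ds ext simp: g_def inner_diff_left field_simps)
  have Dp: "((\<lambda>y. s y powr (- m - 1)) has_derivative (\<lambda>h. s x powr (-m - 2) * (2 * \<sigma> * (m + 1) * ((x - q) \<bullet> h)))) (at x)"
    using assms(3) p[OF assms(3)]
    by (auto intro!: derivative_eq_intros Ds ext simp: field_simps)
  have "(g has_derivative H) (at x)"
    unfolding g_def[abs_def] H_def[abs_def]
    by (rule derivative_eq_intros Dp refl)+ (simp add: p(2)[OF assms(3)] algebra_simps)
  with powr' op assms(3) have "has_hessian (\<lambda>y. s y powr (- m)) g H x"
    by (intro has_hessianI_open[of "{y. 0 < s y}"]) auto
  from has_laplacianI[OF this]
  have "has_laplacian (\<lambda>y. s y powr (- m)) x (linear_trace H)" .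
  moreover have "linear_trace H = (2 * \<sigma> * m * s x powr (- m - 2)) *
      (s x * real DIM('a) + (2 * \<sigma> * (m + 1)) * ((x - q) \<bullet> (x - q)))"
    unfolding H_def[abs_def] linear_trace_cmult linear_trace_add linear_trace_ident
      linear_trace_rank_one[OF linear_inner_scaled] ..
  moreover have "s x * real DIM('a) + (2 * \<sigma> * (m + 1)) * ((x - q) \<bullet> (x - q)) = \<sigma> * real DIM('a) * \<rho>\<^sup>2"
  proof -
    have "2 * (m + 1) = real DIM('a)"
      by (simp add: m_def field_simps)
    then have "(2 * \<sigma> * (m + 1)) * ((x - q) \<bullet> (x - q)) = \<sigma> * real DIM('a) * ((x - q) \<bullet> (x - q))"
      by (simp add: algebra_simps)
    then show ?thesis
      by (simp add: s_def algebra_simps)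
  qed
  ultimately have "has_laplacian (\<lambda>y. s y powr (- m)) x
      ((2 * \<sigma> * m * s x powr (- m - 2)) * (\<sigma> * real DIM('a) * \<rho>\<^sup>2))"
    by simp
  moreover have "(2 * \<sigma> * m * s x powr (- m - 2)) * (\<sigma> * real DIM('a) * \<rho>\<^sup>2) =
      \<sigma>\<^sup>2 * (2 * m * real DIM('a) * \<rho>\<^sup>2 * s x powr (- m - 2))"
    by (simp add: power2_eq_square)
  ultimately show ?thesis
    using \<open>\<sigma>\<^sup>2 = 1\<close> by simp
qed

section \<open>Reflections and interior derivative estimates\<close>

definition reflection :: "'a::real_inner \<Rightarrow> 'a \<Rightarrow> 'a" where
  "reflection e y = y - (2 * (y \<bullet> e)) *\<^sub>R e"

lemma linear_reflection: "linear (reflection e)"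
  by (simp add: linear_iff reflection_def inner_add_left algebra_simps)

lemma reflection_self_adjoint: "reflection e y \<bullet> z = y \<bullet> reflection e z"
  by (simp add: reflection_def inner_diff_left inner_diff_right inner_commute)

lemma reflection_involutive: "norm e = 1 \<Longrightarrow> reflection e (reflection e y) = y"
  by (simp add: reflection_def inner_diff_left norm_eq_1 algebra_simps)

lemma norm_reflection: "norm e = 1 \<Longrightarrow> norm (reflection e y) = norm y"
  by (simp add: norm_eq_sqrt_inner reflection_self_adjoint reflection_involutive)

lemma linear_trace_reflection:
  assumes "linear H" "norm e = 1"
  shows "linear_trace (\<lambda>h. reflection e (H (reflection e h))) = linear_trace H"
proof -
  have ee: "e \<bullet> e = 1"
    using assms(2) by (simp add: norm_eq_1)
  have lin: "linear (\<lambda>h. 2 * (H h \<bullet> e))"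
    using assms(1) by (simp add: linear_iff inner_add_left algebra_simps)
  have "(\<lambda>h. reflection e (H (reflection e h))) =
    (\<lambda>h. H h - (2 * (e \<bullet> h)) *\<^sub>R H e - (2 * (H h \<bullet> e)) *\<^sub>R e + ((4 * (H e \<bullet> e)) * (e \<bullet> h)) *\<^sub>R e)"
    using assms(1)
    by (auto simp: reflection_def linear_diff linear_cmul inner_diff_left inner_commute algebra_simps)
  then show ?thesis
    by (simp only: linear_trace_diff linear_trace_add linear_trace_rank_one[OF linear_inner_scaled]
        linear_trace_rank_one[OF lin]) (simp add: ee inner_commute)
qed

lemma has_laplacian_reflect:
  assumes "has_laplacian v (reflection e x + c) l" "norm e = 1"
  shows "has_laplacian (\<lambda>y. v (reflection e y + c)) x l"
proof -
  obtain g H where gH: "has_hessian v g H (reflection e x + c)" "l = linear_trace H"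
    using assms has_laplacian_def by blast
  show ?thesis
    using has_laplacianI[OF has_hessian_affine[OF gH(1) linear_reflection linear_reflection reflection_self_adjoint]]
      linear_trace_reflection[OF has_hessian_linear[OF gH(1)] assms(2)] gH(2) by simp
qed

lemma has_hessian_norm_square: "has_hessian (\<lambda>y. y \<bullet> y) (\<lambda>y. 2 *\<^sub>R y) (\<lambda>h. 2 *\<^sub>R h) x"
  unfolding has_hessian_def
  by (auto intro!: derivative_eq_intros ext always_eventually simp: inner_commute)

lemma has_hessian_slab:
  "has_hessian (\<lambda>y. (y \<bullet> b) * (\<delta> - y \<bullet> b)) (\<lambda>y. (\<delta> - 2 * (y \<bullet> b)) *\<^sub>R b) (\<lambda>h. (- 2 * (b \<bullet> h)) *\<^sub>R b) x"
  unfolding has_hessian_def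
  by (auto intro!: derivative_eq_intros ext always_eventually simp: inner_commute algebra_simps)

text \<open>The difference of \<open>w\<close> and its reflection vanishes on the hyperplane orthogonal to \<open>b\<close>, so a
  barrier on the half ball that vanishes at the centre bounds the normal derivative there.\<close>

lemma gradient_estimate_unit:
  fixes w :: "'a::euclidean_space \<Rightarrow> real"
  assumes "0 < \<delta>"
    and hess: "\<And>y. y \<in> cball x \<delta> \<Longrightarrow> has_hessian w g (H y) y"
    and A: "\<And>y. y \<in> cball x \<delta> \<Longrightarrow> \<bar>w y\<bar> \<le> A"
    and F: "\<And>y. y \<in> cball x \<delta> \<Longrightarrow> \<bar>linear_trace (H y)\<bar> < F"
    and b: "norm b = 1"
  shows "g x \<bullet> b \<le> real DIM('a) * A / \<delta> + F * \<delta> / 2"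
proof -
  define n where "n = real DIM('a)"
  have n: "n \<ge> 1"
    unfolding n_def using DIM_positive[where 'a='a] by linarith
  have A0: "0 \<le> A" and F0: "0 < F"
    using A[of x] F[of x] \<open>0 < \<delta>\<close> by auto
  \<comment> \<open>The first part is harmonic, since the slab term has Laplacian -2 against 2n for
    \<open>y \<bullet> y\<close>, and it is at least 2A on the sphere |y| = \<delta>. The
    \<open>F\<close> part has Laplacian -2F, which outweighs the Laplacian of the odd difference.
    The slope at 0 along \<open>b\<close> is \<open>2 * n * A / \<delta> + F * \<delta>\<close>,
    twice the claimed bound.\<close>
  define \<psi> where "\<psi> y = 2 * A / \<delta>\<^sup>2 * (y \<bullet> y + n * ((y \<bullet> b) * (\<delta> - y \<bullet> b))) + F * ((y \<bullet> b) * (\<delta> - y \<bullet> b))" for y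
  define f where "f y = w (y + x) - w (reflection b y + x) - \<psi> y" for y
  define G where "G = {y. norm y < \<delta> \<and> 0 < y \<bullet> b}"
  define S where "S = {y. norm y \<le> \<delta> \<and> 0 \<le> y \<bullet> b}"
  have inball: "y + x \<in> cball x \<delta>" "reflection b y + x \<in> cball x \<delta>" if "norm y \<le> \<delta>" for y
    using that norm_reflection[OF b, of y] by (auto simp: dist_norm)
  define l where "l y = linear_trace (H (y + x)) - linear_trace (H (reflection b y + x)) + 2 * F" for y
  have lap: "has_laplacian f y (l y)" if "norm y \<le> \<delta>" for y
  proof -
    have 1: "has_laplacian (\<lambda>y. y \<bullet> y) y (2 * n)"
      using has_laplacianI[OF has_hessian_norm_square] unfolding linear_trace_cmult linear_trace_ident n_def .
    have 2: "has_laplacian (\<lambda>y. (y \<bullet> b) * (\<delta> - y \<bullet> b)) y (- 2)"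
      using has_laplacianI[OF has_hessian_slab[of b \<delta> y]] b
      unfolding linear_trace_rank_one[OF linear_inner_scaled] by (simp add: norm_eq_1)
    have "has_laplacian \<psi> y (2 * A / \<delta>\<^sup>2 * (2 * n + n * (- 2)) + F * (- 2))"
      unfolding \<psi>_def by (intro has_laplacian_add has_laplacian_cmult 1 2)
    moreover have "has_laplacian (\<lambda>y. w (y + x)) y (linear_trace (H (y + x)))"
      using has_laplacian_translate[OF has_laplacianI[OF hess[OF inball(1)[OF that]]]] .
    moreover have "has_laplacian (\<lambda>y. w (reflection b y + x)) y (linear_trace (H (reflection b y + x)))"
      using has_laplacian_reflect[OF has_laplacianI[OF hess[OF inball(2)[OF that]]] b] .
    ultimately have "has_laplacian f y (linear_trace (H (y + x)) - linear_trace (H (reflection b y + x)) -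
        (2 * A / \<delta>\<^sup>2 * (2 * n + n * (- 2)) + F * (- 2)))"
      unfolding f_def by (intro has_laplacian_diff)
    then show ?thesis
      by (simp add: l_def mult.commute)
  qed
  have closed: "closed S"
    unfolding S_def
    by (intro closed_Collect_conj closed_Collect_le continuous_intros)
  have "compact S"
    using closed bounded_subset[OF bounded_cball[of 0 \<delta>], of S]
    by (auto simp: compact_eq_bounded_closed S_def subset_eq dist_norm)
  have contS: "continuous_on S f"
    using lap has_laplacian_isCont by (intro continuous_at_imp_continuous_on) (auto simp: S_def)
  have bdry: "f y \<le> 0" if "y \<in> S" "y \<notin> G" for y
  proof -
    have y: "norm y \<le> \<delta>" "0 \<le> y \<bullet> b" using that by (auto simp: S_def)
    have le: "y \<bullet> b \<le> \<delta>"
      using y(1) Cauchy_Schwarz_ineq2[of y b] b by simp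
    have sl: "0 \<le> (y \<bullet> b) * (\<delta> - y \<bullet> b)"
      using y le by simp
    have "norm y = \<delta> \<or> y \<bullet> b = 0"
      using that(2) y by (auto simp: G_def)
    then consider "norm y = \<delta>" | "y \<bullet> b = 0"
      by blast
    then show ?thesis
    proof cases
      case 1
      have "\<psi> y \<ge> 2 * A / \<delta>\<^sup>2 * (y \<bullet> y)"
        unfolding \<psi>_def using sl A0 F0 n by (simp add: distrib_left)
      moreover have "2 * A / \<delta>\<^sup>2 * (y \<bullet> y) = 2 * A"
        using 1 \<open>0 < \<delta>\<close> by (simp add: dot_square_norm)
      ultimately show ?thesis
        using A[OF inball(1)[OF y(1)]] A[OF inball(2)[OF y(1)]] unfolding f_def by linarith
    next
      case 2
      then have "reflection b y = y"
        by (simp add: reflection_def)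
      then show ?thesis
        using A0 F0 n 2 by (simp add: f_def \<psi>_def)
    qed
  qed
  have neg: "f y \<le> 0" if "y \<in> G" for y
  proof (rule maximum_principle[where l = l])
    show "open G"
      unfolding G_def by (intro open_Collect_conj open_Collect_less continuous_intros)
    fix y assume "y \<in> G"
    then have "norm y \<le> \<delta>" by (simp add: G_def)
    then show "has_laplacian f y (l y)"
      by (rule lap)
    show "0 < l y"
      using F[OF inball(1)[OF \<open>norm y \<le> \<delta>\<close>]] F[OF inball(2)[OF \<open>norm y \<le> \<delta>\<close>]] by (simp add: l_def abs_less_iff)
  next
    fix \<epsilon> :: real assume "0 < \<epsilon>"
    define K where "K = {y \<in> S. \<epsilon> \<le> f y}"
    have "S \<inter> f -` {\<epsilon>..} = K" "S \<inter> K = K"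
      by (auto simp: K_def)
    then have "compact K"
      using compact_Int_closed[OF \<open>compact S\<close> continuous_closed_preimage[OF contS closed, of "{\<epsilon>..}"]]
      by simp
    moreover have "K \<subseteq> G"
      using bdry \<open>0 < \<epsilon>\<close> by (fastforce simp: K_def)
    moreover have "\<forall>y\<in>G - K. f y < \<epsilon>"
      by (auto simp: K_def S_def G_def)
    ultimately show "\<exists>K. compact K \<and> K \<subseteq> G \<and> (\<forall>y\<in>G - K. f y < \<epsilon>)"
      by blast
  qed fact
  define \<theta> where "\<theta> t = f (t *\<^sub>R b)" for t
  have rb: "reflection b (t *\<^sub>R b) = (- t) *\<^sub>R b" for t
    using b by (simp add: reflection_def norm_eq_1 scaleR_left_diff_distrib[symmetric])
  have \<theta>: "\<theta> t = w (x + t *\<^sub>R b) - w (x + t *\<^sub>R (- b)) -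
      (2 * A / \<delta>\<^sup>2 * (t * t + n * (t * (\<delta> - t))) + F * (t * (\<delta> - t)))" for t
    using b by (simp add: \<theta>_def f_def \<psi>_def rb norm_eq_1 add.commute)
  have x: "(w has_derivative (\<lambda>h. g x \<bullet> h)) (at (x + 0 *\<^sub>R b))" for b
    using has_hessian_derivative[OF hess[of x]] \<open>0 < \<delta>\<close> by simp
  note D = real_derivative_along_line[OF x, of b] real_derivative_along_line[OF x, of "- b"]
  have "(\<theta> has_real_derivative g x \<bullet> b - g x \<bullet> (- b) - (2 * A / \<delta>\<^sup>2 * (n * \<delta>) + F * \<delta>)) (at 0)"
    unfolding \<theta>[abs_def] by (rule derivative_eq_intros D refl | simp)+
  moreover have "g x \<bullet> b - g x \<bullet> (- b) - (2 * A / \<delta>\<^sup>2 * (n * \<delta>) + F * \<delta>) =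
      2 * (g x \<bullet> b - (n * A / \<delta> + F * \<delta> / 2))"
    using \<open>0 < \<delta>\<close> by (simp add: power2_eq_square field_simps)
  ultimately have der: "(\<theta> has_real_derivative 2 * (g x \<bullet> b - (n * A / \<delta> + F * \<delta> / 2))) (at 0)"
    by simp
  show ?thesis
  proof (rule ccontr)
    assume "\<not> ?thesis"
    then have "0 < 2 * (g x \<bullet> b - (n * A / \<delta> + F * \<delta> / 2))"
      by (simp add: n_def)
    from DERIV_pos_inc_right[OF der this] obtain d where d: "d > 0" "\<And>h. 0 < h \<Longrightarrow> h < d \<Longrightarrow> \<theta> 0 < \<theta> h"
      by auto
    define t where "t = min d \<delta> / 2"
    have t: "0 < t" "t < d" "t < \<delta>"
      using d(1) \<open>0 < \<delta>\<close> by (auto simp: t_def)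
    have "t *\<^sub>R b \<in> G"
      using t b b[unfolded norm_eq_1] by (simp add: G_def)
    then have "\<theta> t \<le> 0"
      using neg by (simp add: \<theta>_def)
    moreover have "\<theta> 0 = 0"
      by (simp add: \<theta>)
    ultimately show False
      using d(2)[OF t(1,2)] by simp
  qed
qed

lemma gradient_estimate:
  fixes w :: "'a::euclidean_space \<Rightarrow> real"
  assumes "0 < \<delta>"
    and "\<And>y. y \<in> cball x \<delta> \<Longrightarrow> has_hessian w g (H y) y"
    and "\<And>y. y \<in> cball x \<delta> \<Longrightarrow> \<bar>w y\<bar> \<le> A"
    and "\<And>y. y \<in> cball x \<delta> \<Longrightarrow> \<bar>linear_trace (H y)\<bar> < F"
  shows "norm (g x) \<le> real DIM('a) * A / \<delta> + F * \<delta> / 2"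
proof (cases "g x = 0")
  case True
  have "0 \<le> A" "0 < F"
    using assms(3)[of x] assms(4)[of x] \<open>0 < \<delta>\<close> by auto
  then show ?thesis
    using True \<open>0 < \<delta>\<close> by simp
next
  case False
  then have "g x \<bullet> sgn (g x) = norm (g x)"
    by (simp add: sgn_div_norm dot_square_norm power2_eq_square)
  moreover have "g x \<bullet> sgn (g x) \<le> real DIM('a) * A / \<delta> + F * \<delta> / 2"
    using gradient_estimate_unit[OF assms] False by (simp add: norm_sgn)
  ultimately show ?thesis by simp
qed

text \<open>The gradient estimate is applied to difference quotients of \<open>w\<close> in
  direction \<open>b\<close>, because a Hessian of \<open>g \<bullet> b\<close> would involve third
  derivatives. By the mean value theorem the quotients are bounded by \<open>A\<close> and their
  Laplacians by \<open>F\<close>; then \<open>t\<close> tends to 0.\<close>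

lemma hessian_estimate:
  fixes w :: "'a::euclidean_space \<Rightarrow> real"
  assumes "0 < \<delta>"
    and hess: "\<And>y. y \<in> cball x (2 * \<delta>) \<Longrightarrow> has_hessian w g (H y) y"
    and A: "\<And>y. y \<in> cball x (2 * \<delta>) \<Longrightarrow> norm (g y) \<le> A"
    and D: "\<And>y. y \<in> cball x (2 * \<delta>) \<Longrightarrow> ((\<lambda>y. linear_trace (H y)) has_derivative D y) (at y)"
    and F: "\<And>y b. y \<in> cball x (2 * \<delta>) \<Longrightarrow> norm b = 1 \<Longrightarrow> \<bar>D y b\<bar> < F"
  shows "norm (H x h) \<le> (real DIM('a) * A / \<delta> + F * \<delta> / 2) * norm h"
proof -
  define C where "C = real DIM('a) * A / \<delta> + F * \<delta> / 2"
  have unit: "norm (H x b) \<le> C" if b: "norm b = 1" for b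
  proof -
    have in2: "y + s *\<^sub>R b \<in> cball x (2 * \<delta>)" if "y \<in> cball x \<delta>" "\<bar>s\<bar> \<le> \<delta>" for y s
      using that b norm_triangle_ineq[of "x - y" "- (s *\<^sub>R b)"] by (auto simp: dist_norm algebra_simps)
    have est: "norm ((g (x + t *\<^sub>R b) - g x) /\<^sub>R t) \<le> C" if t: "0 < t" "t < \<delta>" for t
    proof -
      define w' where "w' y = (1/t) * (w (y + t *\<^sub>R b) + (-1) * w y)" for y
      define g' where "g' y = (1/t) *\<^sub>R (g (y + t *\<^sub>R b) + (-1) *\<^sub>R g y)" for y
      define H' where "H' y h = (1/t) *\<^sub>R (H (y + t *\<^sub>R b) h + (-1) *\<^sub>R H y h)" for y h
      have mvt: "\<exists>s. 0 < s \<and> s < t \<and> u (y + t *\<^sub>R b) - u y = t * Du (y + s *\<^sub>R b) b"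
        if "y \<in> cball x \<delta>" "\<And>y. y \<in> cball x (2 * \<delta>) \<Longrightarrow> (u has_derivative Du y) (at y)"
        for u :: "'a \<Rightarrow> real" and Du y
        using MVT2[OF \<open>0 < t\<close>, of "\<lambda>s. u (y + s *\<^sub>R b)" "\<lambda>s. Du (y + s *\<^sub>R b) b"]
          real_derivative_along_line[OF that(2)[OF in2[OF that(1)]]] t by fastforce
      have "norm (g' x) \<le> C"
        unfolding C_def
      proof (rule gradient_estimate[OF \<open>0 < \<delta>\<close>, where w = w' and g = g' and H = H'])
        fix y assume y: "y \<in> cball x \<delta>"
        have h1: "has_hessian w g (H (y + t *\<^sub>R b)) (y + t *\<^sub>R b)"
          using hess[OF in2[OF y]] t by simp
        have h2: "has_hessian w g (H y) y"
          using hess in2[OF y, of 0] \<open>0 < \<delta>\<close> by simp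
        from has_hessian_affine[of w g _ id y "t *\<^sub>R b" id] h1
        have "has_hessian (\<lambda>y. w (y + t *\<^sub>R b)) (\<lambda>y. g (y + t *\<^sub>R b)) (H (y + t *\<^sub>R b)) y"
          by (simp add: linear_id)
        then show "has_hessian w' g' (H' y) y"
          unfolding w'_def g'_def H'_def
          by (intro has_hessian_cmult has_hessian_add h2)
        obtain s where s: "0 < s" "s < t" "w (y + t *\<^sub>R b) - w y = t * (g (y + s *\<^sub>R b) \<bullet> b)"
          using mvt[OF y has_hessian_derivative[OF hess]] by blast
        have "\<bar>w' y\<bar> = \<bar>g (y + s *\<^sub>R b) \<bullet> b\<bar>"
          using s(3) t by (simp add: w'_def)
        also have "\<dots> \<le> norm (g (y + s *\<^sub>R b))"
          using Cauchy_Schwarz_ineq2[of "g (y + s *\<^sub>R b)" b] b by simp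
        also have "\<dots> \<le> A"
          using A in2[OF y, of s] s t by simp
        finally show "\<bar>w' y\<bar> \<le> A" .
        obtain s where s: "0 < s" "s < t" "linear_trace (H (y + t *\<^sub>R b)) - linear_trace (H y) = t * D (y + s *\<^sub>R b) b"
          using mvt[OF y D] by blast
        have "linear_trace (H' y) = (1/t) * (linear_trace (H (y + t *\<^sub>R b)) + (-1) * linear_trace (H y))"
          unfolding H'_def[abs_def] linear_trace_cmult linear_trace_add ..
        then have "\<bar>linear_trace (H' y)\<bar> = \<bar>D (y + s *\<^sub>R b) b\<bar>"
          using s(3) t by simp
        then show "\<bar>linear_trace (H' y)\<bar> < F"
          using F[OF _ b] in2[OF y, of s] s t by simp
      qed
      then show ?thesis
        by (simp add: g'_def divide_inverse)
    qed
    have "(g has_derivative H x) (at x)"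
      using hess[of x] \<open>0 < \<delta>\<close> by (simp add: has_hessian_def)
    \<comment> \<open>Testing against this fixed direction turns the limit of vectors into a limit
      of reals with value \<open>norm (H x b)\<close>.\<close>
    define c where "c = sgn (H x b)"
    have c: "norm c \<le> 1" "H x b \<bullet> c = norm (H x b)"
      by (simp_all add: c_def norm_sgn)
        (cases "H x b = 0"; simp add: sgn_div_norm dot_square_norm power2_eq_square)
    have "((\<lambda>y. g y \<bullet> c) has_derivative (\<lambda>h. H x h \<bullet> c)) (at (x + 0 *\<^sub>R b))"
      using \<open>(g has_derivative H x) (at x)\<close> by (auto intro!: derivative_eq_intros)
    from real_derivative_along_line[OF this]
    have "((\<lambda>t. (g (x + t *\<^sub>R b) \<bullet> c - g x \<bullet> c) / t) \<longlongrightarrow> norm (H x b)) (at 0)"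
      by (simp add: DERIV_def c(2))
    then have "((\<lambda>t. (g (x + t *\<^sub>R b) \<bullet> c - g x \<bullet> c) / t) \<longlongrightarrow> norm (H x b)) (at_right 0)"
      by (rule tendsto_mono[OF at_le, rotated]) simp
    moreover have "\<forall>\<^sub>F t in at_right 0. (g (x + t *\<^sub>R b) \<bullet> c - g x \<bullet> c) / t \<le> C"
    proof -
      have "(g (x + t *\<^sub>R b) \<bullet> c - g x \<bullet> c) / t \<le> C" if t: "0 < t" "t < \<delta>" for t
      proof -
        have "(g (x + t *\<^sub>R b) \<bullet> c - g x \<bullet> c) / t = ((g (x + t *\<^sub>R b) - g x) /\<^sub>R t) \<bullet> c"
          by (simp add: inner_diff_left divide_inverse mult.commute)
        also have "\<dots> \<le> norm ((g (x + t *\<^sub>R b) - g x) /\<^sub>R t) * norm c"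
          by (rule norm_cauchy_schwarz)
        also have "\<dots> \<le> C"
          using est[OF t] c(1) mult_left_le[of "norm c"] norm_ge_zero by (meson order_trans)
        finally show ?thesis .
      qed
      then show ?thesis
        using \<open>0 < \<delta>\<close> by (auto simp: eventually_at_right_field intro!: exI[of _ \<delta>])
    qed
    ultimately show ?thesis
      by (rule tendsto_upperbound) simp
  qed
  have lin: "linear (H x)"
    using has_hessian_linear[OF hess[of x]] \<open>0 < \<delta>\<close> by simp
  show ?thesis
  proof (cases "h = 0")
    case False
    have "H x h = norm h *\<^sub>R H x (sgn h)"
      using False lin by (simp add: linear_cmul[symmetric] sgn_div_norm)
    then show ?thesis
      using unit[of "sgn h"] False by (simp add: norm_sgn C_def mult.commute)
  qed (use lin linear_0 in auto)
qed

section \<open>Bounds for solutions of the Loewner--Nirenberg problem\<close>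

definition ln_nonlinearity :: "real \<Rightarrow> real \<Rightarrow> real" where
  "ln_nonlinearity n t = 1/4 * n * (n - 2) * t powr ((n + 2) / (n - 2))"

lemma ln_nonlinearity_strict_mono:
  assumes "n > 2" "0 \<le> s" "s < t"
  shows "ln_nonlinearity n s < ln_nonlinearity n t"
  using assms by (simp add: ln_nonlinearity_def powr_less_mono2)

lemma ln_nonlinearity_nonneg: "n > 2 \<Longrightarrow> 0 \<le> ln_nonlinearity n t"
  by (simp add: ln_nonlinearity_def)

text \<open>Rests on m (n + 2) / (n - 2) = m + 2 for m = (n - 2) / 2, which matches the weights m
  and m + 2 in the conformal covariance of the Laplacian.\<close>

lemma ln_nonlinearity_scale:
  assumes "n > 2" "0 \<le> s" "0 \<le> t"
  shows "ln_nonlinearity n (s powr ((n - 2) / 2) * t) = s powr ((n - 2) / 2 + 2) * ln_nonlinearity n t"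
proof -
  have "(n - 2) / 2 * ((n + 2) / (n - 2)) = (n - 2) / 2 + 2"
    using assms by (simp add: field_simps)
  then show ?thesis
    using assms by (simp add: ln_nonlinearity_def powr_mult powr_powr)
qed

lemma powr_mult_powr_minus:
  fixes a b m :: real
  assumes "0 < a" "0 < b"
  shows "a powr m * b powr (- m) = (a / b) powr m"
  using assms by (simp add: powr_divide powr_minus_divide)

lemma ln_solutionD:
  fixes w :: "'a::euclidean_space \<Rightarrow> real"
  assumes "loewner_nirenberg_solution G w"
  shows "\<And>x. x \<in> G \<Longrightarrow> 0 \<le> w x"
    and "\<And>p. p \<in> frontier G \<Longrightarrow> filterlim w at_top (at p within G)"
  using assms by (simp_all add: loewner_nirenberg_solution_def)

lemma ln_solution_hessian:
  fixes w :: "'a::euclidean_space \<Rightarrow> real"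
  assumes "loewner_nirenberg_solution G w" "open G"
  obtains g H where "\<And>x. x \<in> G \<Longrightarrow> has_hessian w g (H x) x"
    and "\<And>x. x \<in> G \<Longrightarrow> linear_trace (H x) = ln_nonlinearity (real DIM('a)) (w x)"
proof -
  have "smooth_on G w"
    using assms by (simp add: loewner_nirenberg_solution_def)
  then obtain g H where gH: "\<And>x. x \<in> G \<Longrightarrow> (w has_derivative (\<lambda>h. g x \<bullet> h)) (at x)"
    "\<And>x. x \<in> G \<Longrightarrow> (g has_derivative H x) (at x)"
    "\<And>x. x \<in> G \<Longrightarrow> laplacian w x = linear_trace (H x)"
    using smooth_on_hessian by blast
  show thesis
  proof
    fix x assume "x \<in> G"
    then show "has_hessian w g (H x) x"
      using has_hessianI_open[OF \<open>open G\<close>] gH by blast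
    show "linear_trace (H x) = ln_nonlinearity (real DIM('a)) (w x)"
      using assms(1) gH(3)[OF \<open>x \<in> G\<close>] \<open>x \<in> G\<close>
      unfolding loewner_nirenberg_solution_def ln_nonlinearity_def by metis
  qed
qed

lemma ln_solution_laplacian:
  fixes w :: "'a::euclidean_space \<Rightarrow> real"
  assumes "loewner_nirenberg_solution G w" "open G" "x \<in> G"
  shows "has_laplacian w x (ln_nonlinearity (real DIM('a)) (w x))"
  by (rule ln_solution_hessian[OF assms(1,2)]) (metis assms(3) has_laplacianI)

text \<open>The constant c = \<open>(2 * \<rho>) powr m\<close> is forced: equating Laplacian and
  nonlinearity of c times the barrier gives c^(2/m) = 4 \<rho>^2. These are the hyperbolic metrics
  inside and outside the sphere.\<close>

lemma ln_solution_sphere: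
  fixes x q :: "'a::euclidean_space"
  defines "m \<equiv> (real DIM('a) - 2) / 2"
  assumes dim: "DIM('a) \<ge> 3" and "0 < \<rho>" "\<sigma>\<^sup>2 = 1"
    and s: "\<sigma> * (\<rho>\<^sup>2 - (x - q) \<bullet> (x - q)) > 0"
  shows "has_laplacian (\<lambda>y. (2 * \<rho>) powr m * (\<sigma> * (\<rho>\<^sup>2 - (y - q) \<bullet> (y - q))) powr (- m)) x
    (ln_nonlinearity (real DIM('a)) ((2 * \<rho>) powr m * (\<sigma> * (\<rho>\<^sup>2 - (x - q) \<bullet> (x - q))) powr (- m)))"
proof -
  define S where "S = \<sigma> * (\<rho>\<^sup>2 - (x - q) \<bullet> (x - q))"
  have S: "S > 0" using s by (simp add: S_def)
  have n: "real DIM('a) > 2" using dim by simp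
  have *: "(2 * \<rho>) powr m * S powr (- m) = (2 * \<rho> / S) powr m"
    using S \<open>0 < \<rho>\<close> by (simp add: powr_divide powr_minus_divide)
  have "ln_nonlinearity (real DIM('a)) ((2 * \<rho> / S) powr m * 1) =
      (2 * \<rho> / S) powr (m + 2) * ln_nonlinearity (real DIM('a)) 1"
    unfolding m_def using S \<open>0 < \<rho>\<close> n by (intro ln_nonlinearity_scale) auto
  also have "\<dots> = (2 * \<rho>) powr (m + 2) * S powr (- m - 2) * (1/4 * real DIM('a) * (2 * m))"
  proof -
    have "S powr (- m - 2) = S powr (- (m + 2))"
      by (rule arg_cong[of _ _ "\<lambda>z. S powr z"]) simp
    then have "(2 * \<rho> / S) powr (m + 2) = (2 * \<rho>) powr (m + 2) * S powr (- m - 2)"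
      using S \<open>0 < \<rho>\<close> powr_mult_powr_minus[of "2 * \<rho>" S "m + 2"] by simp
    then show ?thesis
      by (simp add: ln_nonlinearity_def m_def)
  qed
  also have "(2 * \<rho>) powr (m + 2) = (2 * \<rho>) powr m * (4 * \<rho>\<^sup>2)"
    using \<open>0 < \<rho>\<close> by (simp add: powr_add power2_eq_square)
  finally have "ln_nonlinearity (real DIM('a)) ((2 * \<rho>) powr m * S powr (- m)) =
      (2 * \<rho>) powr m * (2 * m * real DIM('a) * \<rho>\<^sup>2 * S powr (- m - 2))"
    unfolding * by simp
  then show ?thesis
    using has_laplacian_cmult[OF has_laplacian_sphere_barrier[OF s \<open>\<sigma>\<^sup>2 = 1\<close>], of "(2 * \<rho>) powr m"]
    unfolding m_def[symmetric] S_def by simp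
qed

text \<open>Where \<open>w < v\<close>, strict monotonicity of the nonlinearity orders the
  Laplacians strictly. Only the larger function may blow up; this asymmetry is the reason for
  translating the other one later.\<close>

lemma ln_comparison:
  fixes v w :: "'a::euclidean_space \<Rightarrow> real"
  assumes dim: "DIM('a) \<ge> 3" and "open G" "bounded G" "continuous_on (closure G) v"
    and "\<And>x. x \<in> G \<Longrightarrow> has_laplacian v x (lv x)"
    and sub: "\<And>x. x \<in> G \<Longrightarrow> ln_nonlinearity (real DIM('a)) (v x) \<le> lv x"
    and "\<And>x. x \<in> G \<Longrightarrow> has_laplacian w x (lw x)"
    and super: "\<And>x. x \<in> G \<Longrightarrow> lw x \<le> ln_nonlinearity (real DIM('a)) (w x)"
    and nonneg: "\<And>x. x \<in> G \<Longrightarrow> 0 \<le> w x"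
    and "\<And>p. p \<in> frontier G \<Longrightarrow> filterlim w at_top (at p within G)"
    and "x \<in> G"
  shows "v x \<le> w x"
proof (rule comparison_blowup_bounded[OF assms(2,3,4,5,7)])
  fix x assume "x \<in> G" "w x < v x"
  then show "lw x < lv x"
    using ln_nonlinearity_strict_mono[of "real DIM('a)" "w x" "v x"] dim
      sub[of x] super[of x] nonneg[of x] by simp
qed (use assms in auto)

text \<open>Comparison with the solution in the ball, which blows up on the sphere and has exactly
  the bounding value at the centre.\<close>

lemma ln_solution_upper_bound:
  fixes u :: "'a::euclidean_space \<Rightarrow> real"
  assumes dim: "DIM('a) \<ge> 3" and sol: "loewner_nirenberg_solution V u" and "open V"
    and "0 < r" "cball x r \<subseteq> V"
  shows "u x \<le> (2 / r) powr ((real DIM('a) - 2) / 2)"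
proof -
  define m where "m = (real DIM('a) - 2) / 2"
  have m: "m > 0" using dim by (simp add: m_def)
  define s where "s y = 1 * (r\<^sup>2 - (y - x) \<bullet> (y - x))" for y
  define \<beta> where "\<beta> y = (2 * r) powr m * s y powr (- m)" for y
  have s: "s y > 0" if "y \<in> ball x r" for y
    using that \<open>0 < r\<close> by (simp add: s_def dist_norm norm_minus_commute dot_square_norm power_strict_mono)
  have in_V: "y \<in> V" if "y \<in> ball x r" for y
    using that assms(5) by auto
  have "u x \<le> \<beta> x"
  proof (rule ln_comparison[OF dim, where G = "ball x r"])
    show "continuous_on (closure (ball x r)) u"
      using has_laplacian_isCont[OF ln_solution_laplacian[OF sol \<open>open V\<close>]] assms(4,5)
      by (intro continuous_at_imp_continuous_on) (auto simp: closure_ball)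
    show "has_laplacian \<beta> y (ln_nonlinearity (real DIM('a)) (\<beta> y))" if "y \<in> ball x r" for y
      using ln_solution_sphere[OF dim \<open>0 < r\<close>, of 1 y x] s[OF that]
      unfolding \<beta>_def s_def m_def by simp
    show "filterlim \<beta> at_top (at p within ball x r)" if "p \<in> frontier (ball x r)" for p
    proof -
      have sp: "s p = 0"
        using that \<open>0 < r\<close> by (simp add: s_def frontier_ball dist_norm norm_minus_commute dot_square_norm)
      have "(s \<longlongrightarrow> s p) (at p within ball x r)"
        unfolding s_def by (intro tendsto_intros)
      moreover have ev: "\<forall>\<^sub>F y in at p within ball x r. 0 < s y"
        using s by (auto simp: eventually_at_filter)
      ultimately have "((\<lambda>y. s y powr m) \<longlongrightarrow> 0) (at p within ball x r)"
        using tendsto_powr'[of s 0 "at p within ball x r" "\<lambda>_. m" m] m sp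
          eventually_mono[OF ev, of "\<lambda>y. 0 \<le> s y"] by simp
      then have "filterlim (\<lambda>y. inverse (s y powr m)) at_top (at p within ball x r)"
        by (rule filterlim_inverse_at_top) (use ev in \<open>auto elim: eventually_mono\<close>)
      then show ?thesis
        unfolding \<beta>_def powr_minus using \<open>0 < r\<close>
        by (intro filterlim_tendsto_pos_mult_at_top[OF tendsto_const]) auto
    qed
  qed (use in_V ln_solution_laplacian[OF sol \<open>open V\<close>] \<open>0 < r\<close> in \<open>auto simp: \<beta>_def\<close>)
  also have "\<beta> x = (2 / r) powr m"
  proof -
    have "\<beta> x = (2 * r / r\<^sup>2) powr m"
      using \<open>0 < r\<close> powr_mult_powr_minus[of "2 * r" "r\<^sup>2" m] by (simp add: \<beta>_def s_def)
    then show ?thesis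
      using \<open>0 < r\<close> by (simp add: power2_eq_square)
  qed
  finally show ?thesis by (simp add: m_def)
qed

text \<open>The balls fill an open cone with vertex \<open>p\<close> and axis \<open>- e\<close>.
  Admitting every \<open>p\<close> outside \<open>V\<close> and every \<open>s\<close> makes the
  condition scale invariant, as befits an infinite cone.\<close>

definition exterior_cone :: "'a::euclidean_space set \<Rightarrow> 'a \<Rightarrow> real \<Rightarrow> bool" where
  "exterior_cone V e c \<longleftrightarrow> (\<forall>p s. p \<notin> V \<longrightarrow> 0 < s \<longrightarrow> ball (p - s *\<^sub>R e) (c * s) \<inter> V = {})"

text \<open>The solution outside a small sphere in the complement is bounded on \<open>V\<close>,
  whereas \<open>u\<close> blows up at the frontier. It also decays at infinity, which takes care of
  an unbounded \<open>V\<close>.\<close>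

lemma ln_solution_lower_bound:
  fixes u :: "'a::euclidean_space \<Rightarrow> real"
  assumes dim: "DIM('a) \<ge> 3" and sol: "loewner_nirenberg_solution V u" and "open V"
    and ext: "exterior_cone V e c" and "0 < c" "norm e = 1" and x: "x \<in> V" and "V \<noteq> UNIV"
  shows "(c / (4 * infdist x (- V))) powr ((real DIM('a) - 2) / 2) \<le> u x"
proof -
  define m where "m = (real DIM('a) - 2) / 2"
  have m: "m > 0" using dim by (simp add: m_def)
  define d where "d = infdist x (- V)"
  have "closed (- V)" "- V \<noteq> {}"
    using \<open>open V\<close> \<open>V \<noteq> UNIV\<close> by auto
  then have d: "d > 0"
    unfolding d_def using x infdist_pos_not_in_closed[of "- V" x] by simp
  obtain p where p: "p \<notin> V" "dist x p = d"
    using infdist_attains_inf[OF \<open>closed (- V)\<close> \<open>- V \<noteq> {}\<close>] unfolding d_def by (metis ComplD)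
  define q where "q = p - d *\<^sub>R e"
  \<comment> \<open>Half the radius of the ball provided by the cone condition, so that
    \<open>V\<close> keeps a distance of at least \<open>\<rho>\<close> from the sphere and the
    barrier stays bounded.\<close>
  define \<rho> where "\<rho> = c * d / 2"
  have \<rho>: "\<rho> > 0" using d \<open>0 < c\<close> by (simp add: \<rho>_def)
  have far: "norm (y - q) \<ge> 2 * \<rho>" if "y \<in> V" for y
  proof -
    have "y \<notin> ball q (c * d)"
      using ext p d that unfolding exterior_cone_def q_def by blast
    then show ?thesis
      by (simp add: \<rho>_def dist_norm norm_minus_commute)
  qed
  define s where "s y = (-1) * (\<rho>\<^sup>2 - (y - q) \<bullet> (y - q))" for y
  define \<beta> where "\<beta> y = (2 * \<rho>) powr m * s y powr (- m)" for y
  have s: "s y \<ge> 3 * \<rho>\<^sup>2" if "y \<in> V" for y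
    using power_mono[OF far[OF that], of 2] \<rho> by (simp add: s_def dot_square_norm power_mult_distrib)
  have s0: "s y > 0" if "y \<in> V" for y
    using s[OF that] \<rho> by (smt (verit) zero_less_power)
  have "\<beta> x \<le> u x"
  proof (rule comparison_blowup[OF \<open>open V\<close>])
    show "\<beta> y \<le> (2 * \<rho>) powr m * (3 * \<rho>\<^sup>2) powr (- m)" if "y \<in> V" for y
      unfolding \<beta>_def using s[OF that] \<rho> m by (intro mult_left_mono powr_mono2') auto
    show lapb: "has_laplacian \<beta> y (ln_nonlinearity (real DIM('a)) (\<beta> y))" if "y \<in> V" for y
      using ln_solution_sphere[OF dim \<rho>, of "-1" y q] s0[OF that]
      unfolding \<beta>_def s_def m_def by simp
    show "ln_nonlinearity (real DIM('a)) (u y) < ln_nonlinearity (real DIM('a)) (\<beta> y)"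
      if "y \<in> V" "u y < \<beta> y" for y
      using ln_nonlinearity_strict_mono ln_solutionD(1)[OF sol that(1)] that dim by simp
    fix \<delta> :: real assume "0 < \<delta>"
    define B where "B = ((2 * \<rho>) powr m / \<delta>) powr (1 / m)"
    have "norm (y - q) \<le> sqrt (B + \<rho>\<^sup>2)" if y: "y \<in> V" "\<delta> \<le> \<beta> y - u y" for y
    proof -
      have "\<delta> \<le> \<beta> y"
        using y ln_solutionD(1)[OF sol y(1)] by simp
      then have "s y powr m \<le> (2 * \<rho>) powr m / \<delta>"
        using s0[OF y(1)] \<open>0 < \<delta>\<close> by (simp add: \<beta>_def powr_minus field_simps)
      then have "(s y powr m) powr (1 / m) \<le> B"
        unfolding B_def using m by (intro powr_mono2) auto
      then have "s y \<le> B"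
        using s0[OF y(1)] m by (simp add: powr_powr)
      then show ?thesis
        by (simp add: s_def dot_square_norm real_le_rsqrt)
    qed
    then show "bounded {y \<in> V. \<delta> \<le> \<beta> y - u y}"
      by (intro bounded_subset[OF bounded_cball[of q "sqrt (B + \<rho>\<^sup>2)"]])
        (auto simp: dist_norm norm_minus_commute)
  qed (use ln_solution_laplacian[OF sol \<open>open V\<close>] ln_solutionD[OF sol] x in auto)
  moreover have "(c / (4 * d)) powr m \<le> \<beta> x"
  proof -
    have "norm (x - q) \<le> 2 * d"
      using norm_triangle_ineq[of "x - p" "d *\<^sub>R e"] p d \<open>norm e = 1\<close>
      by (simp add: q_def dist_norm algebra_simps)
    then have "(norm (x - q))\<^sup>2 \<le> (2 * d)\<^sup>2"
      by (rule power_mono) simp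
    then have "s x \<le> 4 * d\<^sup>2"
      unfolding s_def dot_square_norm power_mult_distrib
      by simp (use zero_le_power2[of \<rho>] in linarith)
    then have "(4 * d\<^sup>2) powr (- m) \<le> s x powr (- m)"
      using s0[OF x] m by (intro powr_mono2') auto
    then have "(2 * \<rho>) powr m * (4 * d\<^sup>2) powr (- m) \<le> \<beta> x"
      unfolding \<beta>_def by (intro mult_left_mono) auto
    moreover have "(2 * \<rho>) powr m * (4 * d\<^sup>2) powr (- m) = (2 * \<rho> / (4 * d\<^sup>2)) powr m"
      using \<rho> d by (intro powr_mult_powr_minus) auto
    moreover have "2 * \<rho> / (4 * d\<^sup>2) = c / (4 * d)"
      using d by (simp add: \<rho>_def power2_eq_square)
    ultimately show ?thesis by simp
  qed
  ultimately show ?thesis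
    by (simp add: m_def d_def)
qed

text \<open>The explicit lower bound takes the place of a strong maximum principle.\<close>

lemma ln_solution_pos:
  fixes u :: "'a::euclidean_space \<Rightarrow> real"
  assumes "DIM('a) \<ge> 3" "loewner_nirenberg_solution V u" "open V"
    "exterior_cone V e c" "0 < c" "norm e = 1" "x \<in> V" "V \<noteq> UNIV"
  shows "0 < u x"
proof -
  have "infdist x (- V) > 0"
    using assms infdist_pos_not_in_closed[of "- V" x] by auto
  then have "0 < (c / (4 * infdist x (- V))) powr ((real DIM('a) - 2) / 2)"
    using \<open>0 < c\<close> by simp
  then show ?thesis
    using ln_solution_lower_bound[OF assms] by linarith
qed

text \<open>At distance d from the complement everything scales in a = 8/d: \<open>u\<close>, its
  gradient and its Hessian are at most multiples of a^m, a^(m+1) and a^(m+2). Since m p = m + 2, the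
  lower bound for \<open>u\<close> bounds u^p below by a multiple of a^(m+2), so the nonlinearity
  controls the Hessian, with a constant depending only on the dimension and
  \<open>c\<close>.\<close>

lemma ln_solution_hessian_bound:
  fixes c :: real
  assumes dim: "DIM('a::euclidean_space) \<ge> 3" and "0 < c"
  obtains C where "C > 0"
    and "\<And>(V :: 'a set) u e g H x h. loewner_nirenberg_solution V u \<Longrightarrow> open V \<Longrightarrow> V \<noteq> UNIV \<Longrightarrow>
      exterior_cone V e c \<Longrightarrow> norm e = 1 \<Longrightarrow> (\<And>x. x \<in> V \<Longrightarrow> has_hessian u g (H x) x) \<Longrightarrow>
      (\<And>x. x \<in> V \<Longrightarrow> linear_trace (H x) = ln_nonlinearity (real DIM('a)) (u x)) \<Longrightarrow>
      x \<in> V \<Longrightarrow> norm (H x h) \<le> C * ln_nonlinearity (real DIM('a)) (u x) * norm h"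
proof -
  define n where "n = real DIM('a)"
  define m where "m = (n - 2) / 2"
  define p where "p = (n + 2) / (n - 2)"
  have n: "n > 2" using dim by (simp add: n_def)
  have m: "m > 0" using n by (simp add: m_def)
  have p: "p > 1" "m * (p - 1) = 2" using n by (simp_all add: p_def m_def field_simps)
  define cn where "cn = 1/4 * n * (n - 2)"
  have cn: "cn > 0" using n by (simp add: cn_def)
  have N: "ln_nonlinearity n t = cn * t powr p" for t
    by (simp add: ln_nonlinearity_def cn_def p_def)
  define C1 where "C1 = n / 2 + 2 * cn"
  have C1: "C1 > 0" using n cn by (simp add: C1_def)
  define C2 where "C2 = n * C1 + cn * p * C1"
  have C2: "C2 > 0" using n cn p C1 by (simp add: C2_def add_pos_pos)
  define C where "C = C2 * (32 / c) powr (m + 2) / cn"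
  show thesis
  proof
    show "C > 0"
      using C2 cn \<open>0 < c\<close> by (simp add: C_def)
    fix V :: "'a set" and u e g H x h
    assume sol: "loewner_nirenberg_solution V u" and "open V" "V \<noteq> UNIV" "exterior_cone V e c"
      "norm e = 1" and hess: "\<And>x. x \<in> V \<Longrightarrow> has_hessian u g (H x) x"
      and tr: "\<And>x. x \<in> V \<Longrightarrow> linear_trace (H x) = ln_nonlinearity (real DIM('a)) (u x)"
      and x: "x \<in> V"
    have tr: "linear_trace (H y) = cn * u y powr p" if "y \<in> V" for y
      using tr[OF that] N by (simp add: n_def)
    define d where "d = infdist x (- V)"
    have "closed (- V)" "- V \<noteq> {}"
      using \<open>open V\<close> \<open>V \<noteq> UNIV\<close> by auto
    then have d: "d > 0"
      unfolding d_def using x infdist_pos_not_in_closed[of "- V" x] by simp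
    \<comment> \<open>A ball of radius \<open>d / 4\<close> around a point at distance at most
      \<open>d / 2\<close> from \<open>x\<close> still lies in \<open>V\<close>, and the upper bound
      from it is \<open>(2 / (d / 4)) powr m\<close>.\<close>
    define a where "a = 8 / d"
    have a: "a > 0" using d by (simp add: a_def)
    have inV: "y \<in> V" if "dist x y < d" for y
    proof (rule ccontr)
      assume "y \<notin> V"
      then have "d \<le> dist x y"
        unfolding d_def by (intro infdist_le) auto
      then show False using that by simp
    qed
    have upos: "0 < u y" if "y \<in> V" for y
      using ln_solution_pos[OF dim sol] that \<open>open V\<close> \<open>V \<noteq> UNIV\<close> \<open>exterior_cone V e c\<close> \<open>0 < c\<close>
        \<open>norm e = 1\<close> by blast
    have upper: "u y \<le> a powr m" if "dist x y \<le> d / 2" for y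
    proof -
      have "cball y (d / 4) \<subseteq> V"
      proof
        fix z assume "z \<in> cball y (d / 4)"
        then have "dist x z < d"
          using dist_triangle[of x z y] that d by (simp add: dist_commute)
        then show "z \<in> V" by (rule inV)
      qed
      from ln_solution_upper_bound[OF dim sol \<open>open V\<close> _ this] d show ?thesis
        by (simp add: a_def m_def n_def)
    qed
    have upow: "u y powr p \<le> a powr (m + 2)" "u y powr (p - 1) \<le> a powr 2" if "dist x y \<le> d / 2" for y
    proof -
      have y: "0 \<le> u y" using upos[OF inV] that d by (simp add: less_imp_le)
      have "u y powr p \<le> (a powr m) powr p"
        using upper[OF that] y p by (intro powr_mono2) auto
      also have "\<dots> = a powr (m + 2)"
        using p(2) by (simp add: powr_powr algebra_simps)
      finally show "u y powr p \<le> a powr (m + 2)" .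
      have "u y powr (p - 1) \<le> (a powr m) powr (p - 1)"
        using upper[OF that] y p by (intro powr_mono2) auto
      also have "\<dots> = a powr 2"
        using p(2) by (simp add: powr_powr)
      finally show "u y powr (p - 1) \<le> a powr 2" .
    qed
    have grad: "norm (g y) \<le> C1 * a powr (m + 1)" if "dist x y \<le> d / 4" for y
    proof -
      have in2: "dist x z \<le> d / 2" if "z \<in> cball y (d / 4)" for z
        using dist_triangle[of x z y] \<open>dist x y \<le> d / 4\<close> that by (simp add: dist_commute)
      have inV2: "z \<in> V" if "z \<in> cball y (d / 4)" for z
        using in2[OF that] d by (intro inV) simp
      have "norm (g y) \<le> real DIM('a) * a powr m / (d / 4) + (2 * cn * a powr (m + 2)) * (d / 4) / 2"
      proof (rule gradient_estimate[where w = u and g = g and x = y and H = H])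
        fix z assume z: "z \<in> cball y (d / 4)"
        show "has_hessian u g (H z) z"
          using hess inV2[OF z] by blast
        show "\<bar>u z\<bar> \<le> a powr m"
          using upper[OF in2[OF z]] upos[OF inV2[OF z]] by simp
        have "cn * u z powr p \<le> cn * a powr (m + 2)"
          using upow(1)[OF in2[OF z]] cn by simp
        moreover have "0 < cn * a powr (m + 2)"
          using cn a by simp
        moreover have "0 \<le> cn * u z powr p"
          using cn by simp
        ultimately show "\<bar>linear_trace (H z)\<bar> < 2 * cn * a powr (m + 2)"
          unfolding tr[OF inV2[OF z]] by linarith
      qed (use d in simp)
      also have "\<dots> = C1 * a powr (m + 1)"
      proof -
        have pw: "a powr (m + 2) = a powr m * a\<^sup>2" "a powr (m + 1) = a powr m * a"
          using a by (simp_all add: powr_add)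
        have dd: "d = 8 / a"
          using d by (simp add: a_def)
        show ?thesis
          unfolding pw dd using a by (simp add: C1_def n_def power2_eq_square field_simps)
      qed
      finally show ?thesis .
    qed
    have "norm (H x h) \<le> (real DIM('a) * (C1 * a powr (m + 1)) / (d / 8) +
        (2 * cn * p * C1 * a powr (m + 3)) * (d / 8) / 2) * norm h"
    proof (rule hessian_estimate[where w = u and g = g and x = x and H = H and h = h and D = "\<lambda>y h. cn * p * u y powr (p - 1) * (g y \<bullet> h)"])
      fix y assume "y \<in> cball x (2 * (d / 8))"
      then have y: "dist x y \<le> d / 4" by simp
      then have yV: "y \<in> V" using d by (intro inV) simp
      show "has_hessian u g (H y) y"
        using hess yV by blast
      show "norm (g y) \<le> C1 * a powr (m + 1)"
        using grad[OF y] .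
      \<comment> \<open>The equation expresses the trace through \<open>u\<close>, so the gradient
        bound already controls its derivative.\<close>
      have "((\<lambda>y. cn * u y powr p) has_derivative (\<lambda>h. cn * p * u y powr (p - 1) * (g y \<bullet> h))) (at y)"
        using upos[OF yV] powr_add[of "u y" "p - 1" 1]
        by (auto intro!: derivative_eq_intros has_hessian_derivative[OF hess[OF yV]] ext)
      then show "((\<lambda>y. linear_trace (H y)) has_derivative (\<lambda>h. cn * p * u y powr (p - 1) * (g y \<bullet> h))) (at y)"
        by (rule has_derivative_transform_within_open[OF _ \<open>open V\<close> yV]) (simp add: tr)
      fix b :: 'a assume b: "norm b = 1"
      have "\<bar>cn * p * u y powr (p - 1) * (g y \<bullet> b)\<bar> = cn * p * u y powr (p - 1) * \<bar>g y \<bullet> b\<bar>"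
        using cn p by (simp add: abs_mult)
      also have "\<dots> \<le> cn * p * a powr 2 * (C1 * a powr (m + 1))"
        using upow(2)[of y] y d cn p grad[OF y] Cauchy_Schwarz_ineq2[of "g y" b] b
        by (intro mult_mono) auto
      also have "\<dots> = cn * p * C1 * a powr (m + 3)"
      proof -
        have "a powr 2 * a powr (m + 1) = a powr (m + 3)"
          by (simp add: powr_add[symmetric] add.commute)
        then show ?thesis by (simp add: algebra_simps del: powr_numeral)
      qed
      also have "\<dots> < 2 * cn * p * C1 * a powr (m + 3)"
        using cn p C1 a by simp
      finally show "\<bar>cn * p * u y powr (p - 1) * (g y \<bullet> b)\<bar> < 2 * cn * p * C1 * a powr (m + 3)" .
    qed (use d in simp)
    also have "real DIM('a) * (C1 * a powr (m + 1)) / (d / 8) +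
        (2 * cn * p * C1 * a powr (m + 3)) * (d / 8) / 2 = C2 * a powr (m + 2)"
    proof -
      have pw: "a powr (m + 2) = a powr (m + 1) * a" "a powr (m + 3) = a powr (m + 1) * a\<^sup>2"
        using a powr_add[of a "m + 1" 1] powr_add[of a "m + 1" 2] by (simp_all add: add.assoc)
      have dd: "d = 8 / a"
        using d by (simp add: a_def)
      show ?thesis
        unfolding pw dd using a by (simp add: C2_def n_def power2_eq_square field_simps)
    qed
    also have "C2 * a powr (m + 2) \<le> C * ln_nonlinearity (real DIM('a)) (u x)"
    proof -
      have "(c / (4 * d)) powr m \<le> u x"
        using ln_solution_lower_bound[OF dim sol \<open>open V\<close> \<open>exterior_cone V e c\<close> \<open>0 < c\<close> \<open>norm e = 1\<close> x \<open>V \<noteq> UNIV\<close>]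
        by (simp add: d_def m_def n_def)
      then have "((c / (4 * d)) powr m) powr p \<le> u x powr p"
        using p by (intro powr_mono2) auto
      moreover have "m * p = m + 2"
        using p(2) by (simp add: algebra_simps)
      ultimately have "(c / (4 * d)) powr (m + 2) \<le> u x powr p"
        by (simp add: powr_powr)
      moreover have "c / (4 * d) = a * (c / 32)"
        using d by (simp add: a_def)
      ultimately have "a powr (m + 2) * (c / 32) powr (m + 2) \<le> u x powr p"
        using powr_mult[of a "c / 32" "m + 2"] by simp
      then have "(32 / c) powr (m + 2) * (a powr (m + 2) * (c / 32) powr (m + 2)) \<le> (32 / c) powr (m + 2) * u x powr p"
        by (rule mult_left_mono) simp
      moreover have "(32 / c) powr (m + 2) * (c / 32) powr (m + 2) = 1"
        using \<open>0 < c\<close> by (subst powr_mult[symmetric]) auto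
      ultimately have "a powr (m + 2) \<le> (32 / c) powr (m + 2) * u x powr p"
        by (metis mult.commute mult.assoc mult_1)
      then have "C2 * a powr (m + 2) \<le> C2 * ((32 / c) powr (m + 2) * u x powr p)"
        using C2 by simp
      then show ?thesis
        using cn N by (simp add: C_def n_def)
    qed
    finally show "norm (H x h) \<le> C * ln_nonlinearity (real DIM('a)) (u x) * norm h"
      by (simp add: mult_right_mono)
  qed
qed

section \<open>Barriers from conformal transformations\<close>

text \<open>With \<open>Q b = b + k\<close> and |k| at most \<epsilon>, the change of
  \<open>H b \<bullet> b\<close> consists of three terms, each at most \<epsilon> B; the quadratic
  one uses \<open>\<epsilon> \<le> 1\<close>.\<close>

lemma laplacian_linear_perturbation:
  fixes u :: "'a::euclidean_space \<Rightarrow> real"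
  assumes hess: "has_hessian u g H (Q x + a)" and Q: "linear Q"
    and \<epsilon>: "\<And>h. norm (Q h - h) \<le> \<epsilon> * norm h" "0 \<le> \<epsilon>" "\<epsilon> \<le> 1"
    and B: "\<And>h. norm (H h) \<le> B * norm h"
  obtains l where "has_laplacian (\<lambda>x. u (Q x + a)) x l"
    and "\<bar>l - linear_trace H\<bar> \<le> 3 * real DIM('a) * \<epsilon> * B"
proof
  have adj: "adjoint Q y \<bullet> z = y \<bullet> Q z" for y z
    using adjoint_works[OF Q, of z y] by (simp add: inner_commute)
  show "has_laplacian (\<lambda>x. u (Q x + a)) x (linear_trace (\<lambda>h. adjoint Q (H (Q h))))"
    using has_laplacianI[OF has_hessian_affine[OF hess Q adjoint_linear[OF Q] adj]] .
  have H: "linear H"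
    using hess by (rule has_hessian_linear)
  have "\<bar>H (Q b) \<bullet> Q b - H b \<bullet> b\<bar> \<le> 3 * \<epsilon> * B" if "b \<in> Basis" for b
  proof -
    define k where "k = Q b - b"
    have k: "norm k \<le> \<epsilon>"
      using \<epsilon>(1)[of b] that by (simp add: k_def)
    have B0: "0 \<le> B"
      using B[of b] that norm_ge_zero[of "H b"] by (simp del: norm_ge_zero)
    have "H (Q b) \<bullet> Q b - H b \<bullet> b = H k \<bullet> b + H b \<bullet> k + H k \<bullet> k"
      using H by (simp add: k_def linear_diff inner_diff_left inner_diff_right)
    moreover have "\<bar>H k \<bullet> b\<bar> \<le> (B * \<epsilon>) * 1"
      using Cauchy_Schwarz_ineq2[of "H k" b] B[of k] k B0 that mult_left_mono[OF k B0] by simp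
    moreover have "\<bar>H b \<bullet> k\<bar> \<le> B * \<epsilon>"
    proof -
      have "norm (H b) * norm k \<le> B * \<epsilon>"
        using B[of b] k B0 that by (intro mult_mono) auto
      then show ?thesis
        using Cauchy_Schwarz_ineq2[of "H b" k] by linarith
    qed
    moreover have "\<bar>H k \<bullet> k\<bar> \<le> B * \<epsilon>"
    proof -
      have "norm (H k) * norm k \<le> (B * \<epsilon>) * 1"
        using B[of k] k B0 \<epsilon>(2,3) mult_left_mono[OF k B0] by (intro mult_mono) auto
      then show ?thesis
        using Cauchy_Schwarz_ineq2[of "H k" k] by linarith
    qed
    ultimately show ?thesis by (simp add: mult.commute)
  qed
  then have "\<bar>\<Sum>b\<in>Basis. H (Q b) \<bullet> Q b - H b \<bullet> b\<bar> \<le> (\<Sum>b\<in>(Basis::'a set). 3 * \<epsilon> * B)"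
    by (intro order_trans[OF sum_abs sum_mono])
  then show "\<bar>linear_trace (\<lambda>h. adjoint Q (H (Q h))) - linear_trace H\<bar> \<le> 3 * real DIM('a) * \<epsilon> * B"
    unfolding linear_trace_adjoint[OF adj] by (simp add: linear_trace_def sum_subtractf algebra_simps)
qed

lemma has_laplacian_scale:
  assumes "has_laplacian v (c *\<^sub>R x + a) l"
  shows "has_laplacian (\<lambda>y. v (c *\<^sub>R y + a)) x (c\<^sup>2 * l)"
proof -
  obtain g H where gH: "has_hessian v g H (c *\<^sub>R x + a)" "l = linear_trace H"
    using assms has_laplacian_def by blast
  have lin: "linear (\<lambda>y. c *\<^sub>R y)"
    by (simp add: linear_iff scaleR_add_right)
  have "has_laplacian (\<lambda>y. v (c *\<^sub>R y + a)) x (linear_trace (\<lambda>h. c *\<^sub>R H (c *\<^sub>R h)))"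
    using has_laplacianI[OF has_hessian_affine[OF gH(1) lin lin]] by simp
  also have "(\<lambda>h. c *\<^sub>R H (c *\<^sub>R h)) = (\<lambda>h. c\<^sup>2 *\<^sub>R H h)"
    using has_hessian_linear[OF gH(1)] by (simp add: linear_cmul power2_eq_square)
  finally show ?thesis
    by (simp add: linear_trace_cmult gH(2))
qed

text \<open>The point that \<open>mobius\<close> sends to infinity. It depends on \<open>K\<close>,
  \<open>e\<close> and \<open>b\<close> but not on the surfaces, which is why one map can straighten
  all spheres through it.\<close>

definition mobius_pole :: "'a::euclidean_space \<Rightarrow> real \<Rightarrow> 'a \<Rightarrow> 'a" where
  "mobius_pole e K b = b + (1 / K) *\<^sub>R e"

text \<open>In the coordinate \<open>h = x - b\<close> this is
  \<open>(h - K |h|\<^sup>2 e) / (1 - 2 K (h \<bullet> e) + K\<^sup>2 |h|\<^sup>2)\<close>, the special conformal transformation that is tangent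
  to the identity at \<open>b\<close>; the denominator, \<open>mobius_denom\<close>, is the inverse of the conformal factor.\<close>

definition mobius :: "'a::euclidean_space \<Rightarrow> real \<Rightarrow> 'a \<Rightarrow> 'a \<Rightarrow> 'a" where
  "mobius e K b x = (let j = x - mobius_pole e K b in
     (1 / K\<^sup>2) *\<^sub>R reflection e (j /\<^sub>R (j \<bullet> j)) - (1 / K) *\<^sub>R e)"

definition mobius_denom :: "'a::euclidean_space \<Rightarrow> real \<Rightarrow> 'a \<Rightarrow> 'a \<Rightarrow> real" where
  "mobius_denom e K b x = K\<^sup>2 * ((x - mobius_pole e K b) \<bullet> (x - mobius_pole e K b))"

lemma mobius_denom_pos: "K \<noteq> 0 \<Longrightarrow> x \<noteq> mobius_pole e K b \<Longrightarrow> 0 < mobius_denom e K b x"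
  by (simp add: mobius_denom_def)

lemma mobius_denom_eq:
  assumes "K \<noteq> 0" "norm e = 1"
  shows "mobius_denom e K b x = 1 - 2 * K * ((x - b) \<bullet> e) + K\<^sup>2 * ((x - b) \<bullet> (x - b))"
proof -
  define h where "h = x - b"
  have *: "x - mobius_pole e K b = h - (1 / K) *\<^sub>R e"
    by (simp add: h_def mobius_pole_def)
  show ?thesis
    using assms(1) assms(2)[unfolded norm_eq_1] unfolding mobius_denom_def h_def[symmetric] *
    by (simp add: inner_diff_left inner_diff_right inner_commute power2_eq_square field_simps)
qed

lemma mobius_scaled:
  assumes "K \<noteq> 0" "norm e = 1" "x \<noteq> mobius_pole e K b"
  shows "mobius_denom e K b x *\<^sub>R mobius e K b x = (x - b) - (K * ((x - b) \<bullet> (x - b))) *\<^sub>R e"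
proof -
  define h where "h = x - b"
  define j where "j = h - (1 / K) *\<^sub>R e"
  have j: "x - mobius_pole e K b = j"
    by (simp add: h_def j_def mobius_pole_def)
  have "j \<noteq> 0" using assms(3) j by auto
  have ee: "e \<bullet> e = 1" using assms(2) by (simp add: norm_eq_1)
  have ref: "reflection e (j /\<^sub>R (j \<bullet> j)) = (1 / (j \<bullet> j)) *\<^sub>R (j - (2 * (j \<bullet> e)) *\<^sub>R e)"
    by (simp add: reflection_def scaleR_diff_right divide_inverse)
  have "mobius_denom e K b x *\<^sub>R mobius e K b x =
      (K\<^sup>2 * (j \<bullet> j)) *\<^sub>R ((1 / K\<^sup>2) *\<^sub>R (1 / (j \<bullet> j)) *\<^sub>R (j - (2 * (j \<bullet> e)) *\<^sub>R e) - (1 / K) *\<^sub>R e)"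
    by (simp add: mobius_denom_def mobius_def Let_def j ref)
  also have "\<dots> = j - (2 * (j \<bullet> e)) *\<^sub>R e - (K * (j \<bullet> j)) *\<^sub>R e"
    using \<open>j \<noteq> 0\<close> \<open>K \<noteq> 0\<close> by (simp add: scaleR_diff_right power2_eq_square)
  also have "\<dots> = j - (2 * (j \<bullet> e) + K * (j \<bullet> j)) *\<^sub>R e"
    by (simp add: scaleR_add_left)
  also have "2 * (j \<bullet> e) + K * (j \<bullet> j) = K * (h \<bullet> h) - 1 / K"
    using \<open>K \<noteq> 0\<close> ee
    by (simp add: j_def inner_diff_left inner_diff_right inner_commute power2_eq_square field_simps)
  also have "j - (K * (h \<bullet> h) - 1 / K) *\<^sub>R e = h - (K * (h \<bullet> h)) *\<^sub>R e"
    by (simp add: j_def scaleR_diff_left)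
  finally show ?thesis
    by (simp add: h_def)
qed

text \<open>Controls how fast images escape to infinity near the pole, for the blow-up of the
  barrier there.\<close>

lemma norm_mobius_le:
  assumes "K \<noteq> 0" "norm e = 1" "x \<noteq> mobius_pole e K b"
  shows "norm (mobius e K b x) \<le> 1 / (K\<^sup>2 * norm (x - mobius_pole e K b)) + 1 / \<bar>K\<bar>"
proof -
  define j where "j = x - mobius_pole e K b"
  have "j \<noteq> 0" using assms(3) j_def by auto
  have "norm ((1 / K\<^sup>2) *\<^sub>R reflection e (j /\<^sub>R (j \<bullet> j))) = 1 / (K\<^sup>2 * norm j)"
    using \<open>j \<noteq> 0\<close> by (simp add: norm_reflection[OF assms(2)] dot_square_norm power2_eq_square field_simps)
  then show ?thesis
    using norm_triangle_ineq4[of "(1 / K\<^sup>2) *\<^sub>R reflection e (j /\<^sub>R (j \<bullet> j))" "(1 / K) *\<^sub>R e"] assms(2)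
    by (simp add: mobius_def Let_def j_def[symmetric])
qed

lemma isCont_mobius:
  assumes "x \<noteq> mobius_pole e K b"
  shows "isCont (mobius e K b) x"
  unfolding mobius_def[abs_def] Let_def reflection_def
  using assms by (intro continuous_intros) auto

lemma isCont_mobius_denom: "isCont (mobius_denom e K b) x"
  unfolding mobius_denom_def[abs_def] by (intro continuous_intros)

text \<open>Conformal covariance: the map is composed of a translation, an inversion, a reflection
  and a similarity. The Kelvin transform supplies the weight of the inversion, and the powers of
  \<open>K\<close> complete it to the inverse denominator.\<close>

lemma has_laplacian_mobius:
  fixes v :: "'a::euclidean_space \<Rightarrow> real"
  defines "m \<equiv> (real DIM('a) - 2) / 2"
  assumes "K \<noteq> 0" "norm e = 1" "x \<noteq> mobius_pole e K b" and lap: "has_laplacian v (mobius e K b x) l"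
  shows "has_laplacian (\<lambda>y. (1 / mobius_denom e K b y) powr m * v (mobius e K b y)) x
    ((1 / mobius_denom e K b x) powr (m + 2) * l)"
proof -
  define q where "q = mobius_pole e K b"
  define s where "s y = (y - q) \<bullet> (y - q)" for y
  define v1 where "v1 z = v ((1 / K\<^sup>2) *\<^sub>R z + - ((1 / K) *\<^sub>R e))" for z
  define v2 where "v2 z = v1 (reflection e z + 0)" for z
  define v3 where "v3 j = (j \<bullet> j) powr (- m) * v2 (j /\<^sub>R (j \<bullet> j))" for j
  have mob: "mobius e K b y = (1 / K\<^sup>2) *\<^sub>R reflection e ((y - q) /\<^sub>R s y) + - ((1 / K) *\<^sub>R e)" for y
    by (simp add: mobius_def Let_def q_def s_def)
  have "has_laplacian v1 (reflection e ((x - q) /\<^sub>R s x) + 0) ((1 / K\<^sup>2)\<^sup>2 * l)"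
    unfolding v1_def by (rule has_laplacian_scale) (use lap in \<open>simp add: mob\<close>)
  then have "has_laplacian v2 ((x - q) /\<^sub>R s x) ((1 / K\<^sup>2)\<^sup>2 * l)"
    unfolding v2_def by (rule has_laplacian_reflect) fact
  then have "has_laplacian v3 (x + - q) (s x powr (- m - 2) * ((1 / K\<^sup>2)\<^sup>2 * l))"
    unfolding v3_def using has_laplacian_kelvin[of "x - q" v2] assms(4)
    by (simp add: m_def s_def q_def)
  from has_laplacian_cmult[OF has_laplacian_translate[OF this], of "(K\<^sup>2) powr (- m)"]
  have "has_laplacian (\<lambda>y. (K\<^sup>2) powr (- m) * v3 (y + - q)) x
      ((K\<^sup>2) powr (- m) * (s x powr (- m - 2) * ((1 / K\<^sup>2)\<^sup>2 * l)))" .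
  moreover have "(\<lambda>y. (K\<^sup>2) powr (- m) * v3 (y + - q)) =
      (\<lambda>y. (1 / mobius_denom e K b y) powr m * v (mobius e K b y))"
  proof
    fix y
    have "(1 / mobius_denom e K b y) powr m = (K\<^sup>2 * s y) powr (- m)"
      using powr_minus_divide[of "K\<^sup>2 * s y" m]
      by (simp add: mobius_denom_def s_def q_def powr_divide)
    then show "(K\<^sup>2) powr (- m) * v3 (y + - q) = (1 / mobius_denom e K b y) powr m * v (mobius e K b y)"
      by (simp add: v3_def v2_def v1_def mob s_def powr_mult)
  qed
  moreover have "(K\<^sup>2) powr (- m) * (s x powr (- m - 2) * ((1 / K\<^sup>2)\<^sup>2 * l)) =
      (1 / mobius_denom e K b x) powr (m + 2) * l"
  proof -
    have *: "- m - 2 = - (m + 2)" by simp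
    have "(1 / mobius_denom e K b x) powr (m + 2) = (K\<^sup>2 * s x) powr (- m - 2)"
      unfolding * powr_minus_divide by (simp add: mobius_denom_def s_def q_def powr_divide)
    moreover have "(K\<^sup>2) powr (- m) * (1 / K\<^sup>2)\<^sup>2 = (K\<^sup>2) powr (- m - 2)"
      using powr_minus_shift(3)[of "K\<^sup>2" m] \<open>K \<noteq> 0\<close> by (simp add: power_divide)
    ultimately show ?thesis
      by (simp add: powr_mult)
  qed
  ultimately show ?thesis by simp
qed

text \<open>\<open>exp \<tau>\<close> multiplies the conformal factor inside the power, so that the
  nonlinearity gains exactly \<open>exp (2 * \<tau>)\<close> relative to the Laplacian in every
  dimension.\<close>

definition mobius_barrier ::
    "real \<Rightarrow> 'a::euclidean_space \<Rightarrow> real \<Rightarrow> 'a \<Rightarrow> ('a \<Rightarrow> 'a) \<Rightarrow> ('a \<Rightarrow> real) \<Rightarrow> 'a \<Rightarrow> real" where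
  "mobius_barrier \<tau> e K b Q u x =
     (exp \<tau> / mobius_denom e K b x) powr ((real DIM('a) - 2) / 2) * u (Q (mobius e K b x))"

text \<open>The pole is excluded explicitly because division by zero gives \<open>mobius\<close> the
  value \<open>- (1 / K) *\<^sub>R e\<close> there, which \<open>Q\<close> could send into
  \<open>V\<close>.\<close>

definition mobius_domain ::
    "'a::euclidean_space set \<Rightarrow> 'a \<Rightarrow> real \<Rightarrow> 'a \<Rightarrow> ('a \<Rightarrow> 'a) \<Rightarrow> 'a set" where
  "mobius_domain V e K b Q = {x. x \<noteq> mobius_pole e K b \<and> Q (mobius e K b x) \<in> V}"

text \<open>Packaged so that a single \<open>C\<close> serves all \<open>K\<close>, \<open>b\<close>
  and \<open>\<tau>\<close>; the two implications make the barrier a supersolution or a subsolution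
  according to the size of \<open>\<tau>\<close>.\<close>

definition mobius_barrier_estimate ::
    "real \<Rightarrow> 'a::euclidean_space set \<Rightarrow> ('a \<Rightarrow> real) \<Rightarrow> 'a \<Rightarrow> bool" where
  "mobius_barrier_estimate C V u e \<longleftrightarrow>
     (\<forall>K b A a \<epsilon> \<tau> x. K \<noteq> 0 \<and> linear A \<and> (\<forall>h. norm (A h - h) \<le> \<epsilon> * norm h) \<and> 0 \<le> \<epsilon> \<and> \<epsilon> \<le> 1 \<and>
        x \<in> mobius_domain V e K b (\<lambda>w. A w + a) \<longrightarrow>
        (\<exists>L. has_laplacian (mobius_barrier \<tau> e K b (\<lambda>w. A w + a) u) x L \<and>
          (1 + C * \<epsilon> \<le> exp (2 * \<tau>) \<longrightarrow>
             L \<le> ln_nonlinearity (real DIM('a)) (mobius_barrier \<tau> e K b (\<lambda>w. A w + a) u x)) \<and>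
          (exp (2 * \<tau>) \<le> 1 - C * \<epsilon> \<longrightarrow>
             ln_nonlinearity (real DIM('a)) (mobius_barrier \<tau> e K b (\<lambda>w. A w + a) u x) \<le> L)))"

text \<open>By the Hessian bound the linear map changes the Laplacian of \<open>u\<close> by at most
  a multiple of \<epsilon> times the nonlinearity itself. The error is thus relative, and a constant
  factor compensates it even where \<open>u\<close> is unbounded.\<close>

lemma mobius_barrier_laplacian:
  fixes c :: real
  assumes dim: "DIM('a::euclidean_space) \<ge> 3" and "0 < c"
  obtains C where "C > 0"
    and "\<And>(V :: 'a set) u e. loewner_nirenberg_solution V u \<Longrightarrow> open V \<Longrightarrow> V \<noteq> UNIV \<Longrightarrow>
      exterior_cone V e c \<Longrightarrow> norm e = 1 \<Longrightarrow> mobius_barrier_estimate C V u e"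
proof -
  define n where "n = real DIM('a)"
  define m where "m = (n - 2) / 2"
  have n: "n > 2" using dim by (simp add: n_def)
  obtain C where "C > 0" and C: "\<And>(V :: 'a set) u e g H x h. loewner_nirenberg_solution V u \<Longrightarrow> open V \<Longrightarrow> V \<noteq> UNIV \<Longrightarrow>
      exterior_cone V e c \<Longrightarrow> norm e = 1 \<Longrightarrow> (\<And>x. x \<in> V \<Longrightarrow> has_hessian u g (H x) x) \<Longrightarrow>
      (\<And>x. x \<in> V \<Longrightarrow> linear_trace (H x) = ln_nonlinearity n (u x)) \<Longrightarrow>
      x \<in> V \<Longrightarrow> norm (H x h) \<le> C * ln_nonlinearity n (u x) * norm h"
    using ln_solution_hessian_bound[OF dim \<open>0 < c\<close>] unfolding n_def by blast
  show thesis
  proof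
    show "3 * n * C > 0" using n \<open>C > 0\<close> by simp
    fix V :: "'a set" and u e
    assume sol: "loewner_nirenberg_solution V u" and V: "open V" "V \<noteq> UNIV" "exterior_cone V e c"
      and e: "norm e = 1"
    show "mobius_barrier_estimate (3 * n * C) V u e"
      unfolding mobius_barrier_estimate_def
    proof (intro allI impI, elim conjE, goal_cases)
      case (1 K b A a \<epsilon> \<tau> x)
      then have "K \<noteq> 0" and A: "linear A" and \<epsilon>: "\<And>h. norm (A h - h) \<le> \<epsilon> * norm h" "0 \<le> \<epsilon>" "\<epsilon> \<le> 1"
        and x: "x \<in> mobius_domain V e K b (\<lambda>w. A w + a)"
        by auto
      define w where "w = mobius e K b x"
      define W where "W = mobius_barrier \<tau> e K b (\<lambda>w. A w + a) u"
      have np: "x \<noteq> mobius_pole e K b" and y: "A w + a \<in> V"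
        using x by (auto simp: mobius_domain_def w_def)
      obtain g H where gH: "\<And>x. x \<in> V \<Longrightarrow> has_hessian u g (H x) x"
        "\<And>x. x \<in> V \<Longrightarrow> linear_trace (H x) = ln_nonlinearity n (u x)"
        using ln_solution_hessian[OF sol V(1)] unfolding n_def by blast
      define r where "r = ln_nonlinearity n (u (A w + a))"
      have r: "0 \<le> r" using n by (simp add: r_def ln_nonlinearity_nonneg)
      have H: "norm (H (A w + a) h) \<le> (C * r) * norm h" for h
        unfolding r_def by (rule C[OF sol V e gH y])
      obtain l where l: "has_laplacian (\<lambda>w. u (A w + a)) w l"
        "\<bar>l - linear_trace (H (A w + a))\<bar> \<le> 3 * n * \<epsilon> * (C * r)"
        using laplacian_linear_perturbation[OF gH(1)[OF y] A \<epsilon> H] unfolding n_def by blast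
      have l': "\<bar>l - r\<bar> \<le> (3 * n * C * \<epsilon>) * r"
        using l(2) gH(2)[OF y] by (simp add: r_def algebra_simps)
      define \<mu> where "\<mu> = 1 / mobius_denom e K b x"
      have \<mu>: "\<mu> > 0" using mobius_denom_pos[OF \<open>K \<noteq> 0\<close> np] by (simp add: \<mu>_def)
      have Wy: "W z = exp \<tau> powr m * ((1 / mobius_denom e K b z) powr m * u (A (mobius e K b z) + a))" for z
      proof -
        have "0 \<le> mobius_denom e K b z" by (simp add: mobius_denom_def)
        then have "(exp \<tau> * (1 / mobius_denom e K b z)) powr m = exp \<tau> powr m * (1 / mobius_denom e K b z) powr m"
          by (intro powr_mult)
        then show ?thesis
          by (simp add: W_def mobius_barrier_def m_def n_def)
      qed
      have lap: "has_laplacian W x (exp \<tau> powr m * (\<mu> powr (m + 2) * l))"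
        unfolding Wy[abs_def] \<mu>_def
        using has_laplacian_mobius[OF \<open>K \<noteq> 0\<close> e np, of "\<lambda>w. u (A w + a)" l] l(1)
        by (intro has_laplacian_cmult) (simp add: w_def m_def n_def)
      have "W x = (exp \<tau> * \<mu>) powr ((n - 2) / 2) * u (A w + a)"
        by (simp add: W_def mobius_barrier_def \<mu>_def n_def w_def)
      then have "ln_nonlinearity n (W x) = (exp \<tau> * \<mu>) powr (m + 2) * r"
        using ln_nonlinearity_scale[OF n, of "exp \<tau> * \<mu>" "u (A w + a)"] \<mu> ln_solutionD(1)[OF sol y]
        by (simp add: m_def r_def)
      also have "\<dots> = exp \<tau> powr m * (\<mu> powr (m + 2) * (exp (2 * \<tau>) * r))"
      proof -
        have "exp \<tau> powr (m + 2) = exp \<tau> powr m * exp (2 * \<tau>)"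
          by (simp add: powr_def exp_add[symmetric] algebra_simps)
        then show ?thesis
          using \<mu> by (simp add: powr_mult)
      qed
      finally have rhs: "ln_nonlinearity n (W x) = exp \<tau> powr m * (\<mu> powr (m + 2) * (exp (2 * \<tau>) * r))" .
      have "l \<le> exp (2 * \<tau>) * r" if "1 + 3 * n * C * \<epsilon> \<le> exp (2 * \<tau>)"
        using l' mult_right_mono[OF that r] by (simp add: algebra_simps)
      moreover have "exp (2 * \<tau>) * r \<le> l" if "exp (2 * \<tau>) \<le> 1 - 3 * n * C * \<epsilon>"
        using l' mult_right_mono[OF that r] by (simp add: algebra_simps)
      ultimately show ?case
        using lap unfolding W_def[symmetric] n_def[symmetric] rhs
        by (intro exI[of _ "exp \<tau> powr m * (\<mu> powr (m + 2) * l)"]) (auto intro!: mult_left_mono)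
    qed
  qed
qed

section \<open>Boundary behaviour of the barrier\<close>

lemma open_mobius_domain:
  assumes "open V" "continuous_on UNIV Q"
  shows "open (mobius_domain V e K b Q)"
proof -
  have "continuous_on (- {mobius_pole e K b}) (\<lambda>x. Q (mobius e K b x))"
    by (intro continuous_on_compose2[OF assms(2)] continuous_at_imp_continuous_on ballI isCont_mobius) auto
  then have "open ((\<lambda>x. Q (mobius e K b x)) -` V \<inter> - {mobius_pole e K b})"
    using \<open>open V\<close> continuous_on_open_vimage[of "- {mobius_pole e K b}"] by auto
  moreover have "(\<lambda>x. Q (mobius e K b x)) -` V \<inter> - {mobius_pole e K b} = mobius_domain V e K b Q"
    by (auto simp: mobius_domain_def)
  ultimately show ?thesis by simp
qed

lemma filterlim_powr_minus_at_top:
  fixes f :: "'a \<Rightarrow> real"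
  assumes "(f \<longlongrightarrow> 0) F" "\<forall>\<^sub>F x in F. 0 < f x" "0 < m"
  shows "filterlim (\<lambda>x. (1 / f x) powr m) at_top F"
proof -
  have "((\<lambda>x. f x powr m) \<longlongrightarrow> 0) F"
    using tendsto_powr'[OF assms(1) tendsto_const, of m] eventually_mono[OF assms(2), of "\<lambda>x. 0 \<le> f x"] assms(3)
    by simp
  then have "filterlim (\<lambda>x. inverse (f x powr m)) at_top F"
    by (rule filterlim_inverse_at_top) (use assms(2) in \<open>auto elim: eventually_mono\<close>)
  moreover have "\<forall>\<^sub>F x in F. inverse (f x powr m) = (1 / f x) powr m"
    using assms(2) by eventually_elim (simp add: powr_divide inverse_eq_divide)
  ultimately show ?thesis
    by (rule filterlim_cong[OF refl refl, THEN iffD1, rotated])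
qed

text \<open>Away from the pole the argument of \<open>u\<close> tends to the frontier of
  \<open>V\<close> and the conformal factor has a positive limit. Near the pole, at distance t, the
  argument may be as far away as a multiple of 1/t, where \<open>u\<close> is still at least a
  multiple of t^m, while the conformal weight grows like t^(-2m).\<close>

lemma mobius_barrier_blowup:
  fixes V :: "'a::euclidean_space set"
  assumes dim: "DIM('a) \<ge> 3" and sol: "loewner_nirenberg_solution V u" and V: "open V" "V \<noteq> UNIV"
    "exterior_cone V e c" and "0 < c" and e: "norm e = 1" and "K \<noteq> 0" and A: "linear A"
    and \<epsilon>: "\<And>h. norm (A h - h) \<le> norm h"
    and p: "p \<in> frontier (mobius_domain V e K b (\<lambda>w. A w + a))"
  shows "filterlim (mobius_barrier \<tau> e K b (\<lambda>w. A w + a) u) at_top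
    (at p within mobius_domain V e K b (\<lambda>w. A w + a))"
proof -
  define m where "m = (real DIM('a) - 2) / 2"
  have m: "m > 0" using dim by (simp add: m_def)
  define D where "D = mobius_domain V e K b (\<lambda>w. A w + a)"
  define y where "y x = A (mobius e K b x) + a" for x
  have contA: "continuous_on UNIV (\<lambda>w. A w + a)"
    using A by (intro continuous_intros linear_continuous_on) (simp add: linear_conv_bounded_linear)
  have "open D"
    unfolding D_def using V(1) contA by (rule open_mobius_domain)
  then have pD: "p \<in> closure D" "p \<notin> D"
    using p by (auto simp: D_def[symmetric] frontier_def interior_open)
  have inD: "\<forall>\<^sub>F x in at p within D. x \<in> D"
    by (simp add: eventually_at_filter)
  have D: "x \<noteq> mobius_pole e K b" "y x \<in> V" if "x \<in> D" for x
    using that by (auto simp: D_def mobius_domain_def y_def)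
  show ?thesis
  proof (cases "p = mobius_pole e K b")
    case False
    have isc: "isCont y p"
      unfolding y_def using contA isCont_mobius[OF False]
      by (intro isCont_o2[of p "mobius e K b" "\<lambda>w. A w + a"])
        (auto simp: continuous_on_eq_continuous_at)
    then have ty: "(y \<longlongrightarrow> y p) (at p within D)"
      by (metis isCont_def tendsto_mono at_le subset_UNIV)
    have "y p \<notin> V"
      using pD(2) False by (auto simp: D_def mobius_domain_def y_def)
    have "y p \<in> closure V"
      unfolding closure_approachable
    proof safe
      fix \<eta> :: real assume "0 < \<eta>"
      then obtain d where d: "d > 0" "\<And>x. dist x p < d \<Longrightarrow> dist (y x) (y p) < \<eta>"
        using isc unfolding continuous_at_eps_delta by blast
      obtain x where "x \<in> D" "dist x p < d"
        using pD(1) d(1) unfolding closure_approachable by blast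
      then show "\<exists>z\<in>V. dist z (y p) < \<eta>"
        using d(2) D(2) by blast
    qed
    then have "y p \<in> frontier V"
      using \<open>y p \<notin> V\<close> V(1) by (simp add: frontier_def interior_open)
    then have "filterlim u at_top (at (y p) within V)"
      using ln_solutionD(2)[OF sol] by blast
    moreover have "filterlim y (at (y p) within V) (at p within D)"
      unfolding filterlim_at
      by (intro conjI ty eventually_mono[OF inD]) (metis D(2) \<open>y p \<notin> V\<close>)+
    ultimately have "filterlim (\<lambda>x. u (y x)) at_top (at p within D)"
      by (rule filterlim_compose)
    moreover have "((\<lambda>x. (exp \<tau> / mobius_denom e K b x) powr m) \<longlongrightarrow>
        (exp \<tau> / mobius_denom e K b p) powr m) (at p within D)"
    proof -
      have "(mobius_denom e K b \<longlongrightarrow> mobius_denom e K b p) (at p within D)"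
        using isCont_mobius_denom by (metis isCont_def tendsto_mono at_le subset_UNIV)
      then show ?thesis
        using mobius_denom_pos[OF \<open>K \<noteq> 0\<close> False] by (intro tendsto_intros) auto
    qed
    ultimately have "filterlim (\<lambda>x. (exp \<tau> / mobius_denom e K b x) powr m * u (y x)) at_top (at p within D)"
      using mobius_denom_pos[OF \<open>K \<noteq> 0\<close> False]
      by (intro filterlim_tendsto_pos_mult_at_top[where c = "(exp \<tau> / mobius_denom e K b p) powr m"]) auto
    then show ?thesis
      by (simp add: mobius_barrier_def[abs_def] m_def y_def D_def)
  next
    case True
    obtain z where z: "z \<notin> V" using V(2) by blast
    \<comment> \<open>The part of the bound for the distance to \<open>z\<close> that stays finite
      at the pole; the factor 2 comes from \<open>norm (A h) \<le> 2 * norm h\<close>.\<close>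
    define \<alpha> where "\<alpha> = norm (a - z) + 2 / \<bar>K\<bar>"
    define t where "t x = norm (x - p)" for x
    define f where "f x = 4 * (K\<^sup>2 * \<alpha> * (t x)\<^sup>2 + 2 * t x) / (exp \<tau> * c)" for x
    have \<alpha>: "\<alpha> > 0" using \<open>K \<noteq> 0\<close> by (simp add: \<alpha>_def add_nonneg_pos)
    have lower: "(1 / f x) powr m \<le> mobius_barrier \<tau> e K b (\<lambda>w. A w + a) u x" if "x \<in> D" for x
    proof -
      have x: "x \<noteq> p" "y x \<in> V" using D[OF that] True by auto
      have t: "t x > 0" using x by (simp add: t_def)
      have A2: "norm (A h) \<le> 2 * norm h" for h
        using \<epsilon>[of h] norm_triangle_ineq[of "A h - h" h] by simp
      have mob: "norm (mobius e K b x) \<le> 1 / (K\<^sup>2 * t x) + 1 / \<bar>K\<bar>"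
        using norm_mobius_le[OF \<open>K \<noteq> 0\<close> e] x(1) True by (simp add: t_def)
      have "infdist (y x) (- V) \<le> dist (y x) z"
        using z by (intro infdist_le) auto
      also have "\<dots> \<le> norm (A (mobius e K b x)) + norm (a - z)"
        using norm_triangle_ineq[of "A (mobius e K b x)" "a - z"] by (simp add: y_def dist_norm algebra_simps)
      also have "\<dots> \<le> \<alpha> + 2 / (K\<^sup>2 * t x)"
        using A2[of "mobius e K b x"] mob by (simp add: \<alpha>_def)
      finally have inf: "infdist (y x) (- V) \<le> \<alpha> + 2 / (K\<^sup>2 * t x)" .
      have infpos: "0 < infdist (y x) (- V)"
        using infdist_pos_not_in_closed[of "- V" "y x"] V x(2) by auto
      have "(c / (4 * (\<alpha> + 2 / (K\<^sup>2 * t x)))) powr m \<le> (c / (4 * infdist (y x) (- V))) powr m"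
        using inf infpos m \<open>0 < c\<close> by (intro powr_mono2 divide_left_mono) auto
      also have "\<dots> \<le> u (y x)"
        using ln_solution_lower_bound[OF dim sol V(1,3) \<open>0 < c\<close> e x(2) V(2)] by (simp add: m_def)
      finally have u: "(c / (4 * (\<alpha> + 2 / (K\<^sup>2 * t x)))) powr m \<le> u (y x)" .
      have den: "mobius_denom e K b x = K\<^sup>2 * (t x)\<^sup>2"
        by (simp add: mobius_denom_def True[symmetric] t_def dot_square_norm)
      have pos: "0 < \<alpha> + 2 / (K\<^sup>2 * t x)"
        using \<alpha> t \<open>K \<noteq> 0\<close> by (simp add: add_pos_pos)
      have "1 / f x = (exp \<tau> / mobius_denom e K b x) * (c / (4 * (\<alpha> + 2 / (K\<^sup>2 * t x))))"
      proof -
        define Y where "Y = \<alpha> + 2 / (K\<^sup>2 * t x)"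
        have "K\<^sup>2 * \<alpha> * (t x)\<^sup>2 + 2 * t x = K\<^sup>2 * (t x)\<^sup>2 * Y"
          using t \<open>K \<noteq> 0\<close> by (simp add: Y_def field_simps power2_eq_square)
        then show ?thesis
          unfolding f_def den Y_def[symmetric] by (simp add: mult_ac)
      qed
      then have "(1 / f x) powr m =
          (exp \<tau> / mobius_denom e K b x) powr m * (c / (4 * (\<alpha> + 2 / (K\<^sup>2 * t x)))) powr m"
        using pos \<open>0 < c\<close> den by (simp add: powr_mult[symmetric])
      also have "\<dots> \<le> (exp \<tau> / mobius_denom e K b x) powr m * u (y x)"
        using u by (intro mult_left_mono) auto
      finally show ?thesis
        by (simp add: mobius_barrier_def m_def y_def)
    qed
    have "(f \<longlongrightarrow> 4 * (K\<^sup>2 * \<alpha> * (t p)\<^sup>2 + 2 * t p) / (exp \<tau> * c)) (at p within D)"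
      unfolding f_def t_def using \<open>0 < c\<close> by (intro tendsto_intros) auto
    then have f0: "(f \<longlongrightarrow> 0) (at p within D)"
      by (simp add: t_def)
    have "\<forall>\<^sub>F x in at p within D. 0 < f x"
      using inD
    proof eventually_elim
      case (elim x)
      then have "t x > 0"
        using D(1) True by (simp add: t_def)
      then show ?case
        using \<alpha> \<open>0 < c\<close> \<open>K \<noteq> 0\<close> by (simp add: f_def add_pos_pos)
    qed
    from filterlim_powr_minus_at_top[OF f0 this m]
    show ?thesis
      unfolding D_def[symmetric]
      by (rule filterlim_at_top_mono) (use inD lower in \<open>auto elim: eventually_mono\<close>)
  qed
qed

section \<open>Diffeomorphisms near the identity\<close>

lemma blinfun_near_identity_inverse:
  fixes A :: "'a::euclidean_space \<Rightarrow>\<^sub>L 'a"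
  assumes "norm (A - id_blinfun) \<le> 1 / 2"
  obtains B :: "'a \<Rightarrow>\<^sub>L 'a" where "A o\<^sub>L B = id_blinfun" "B o\<^sub>L A = id_blinfun" "norm B \<le> 2"
proof -
  have lower: "norm h \<le> 2 * norm (A h)" for h
  proof -
    have "norm (A h - h) \<le> 1 / 2 * norm h"
      using norm_blinfun[of "A - id_blinfun" h] mult_right_mono[OF assms norm_ge_zero[of h]]
      by (simp add: blinfun.diff_left)
    then show ?thesis
      using norm_triangle_ineq2[of h "A h"] by (simp add: norm_minus_commute)
  qed
  have lin: "linear (blinfun_apply A)"
    by (simp add: blinfun.bounded_linear_right bounded_linear.linear)
  moreover have "inj (blinfun_apply A)"
    unfolding linear_injective_0[OF lin] using lower by (metis norm_le_zero_iff norm_zero mult_zero_right)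
  ultimately obtain B where B: "linear B" "\<And>x. B (A x) = x" "\<And>x. A (B x) = x"
    using linear_injective_isomorphism by blast
  define B' where "B' = Blinfun B"
  have B': "blinfun_apply B' = B"
    using B(1) by (simp add: B'_def bounded_linear_Blinfun_apply linear_conv_bounded_linear)
  show thesis
  proof
    show "A o\<^sub>L B' = id_blinfun" "B' o\<^sub>L A = id_blinfun"
      by (rule blinfun_eqI, simp add: B' B)+
    show "norm B' \<le> 2"
      using lower[of "B h" for h] B by (intro norm_blinfun_bound) (auto simp: B')
  qed
qed

text \<open>By the mean value bound \<open>T\<close> minus the identity is 1/2-Lipschitz on the
  convex set, so \<open>T\<close> shrinks distances at most by half.\<close>

lemma near_identity_expansion:
  fixes T :: "'a::euclidean_space \<Rightarrow> 'a" and DT :: "'a \<Rightarrow> 'a \<Rightarrow>\<^sub>L 'a"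
  assumes "convex U" and der: "\<And>x. x \<in> U \<Longrightarrow> (T has_derivative blinfun_apply (DT x)) (at x)"
    and near: "\<And>x. x \<in> U \<Longrightarrow> norm (DT x - id_blinfun) \<le> 1 / 2"
    and "x \<in> U" "y \<in> U"
  shows "norm (x - y) \<le> 2 * norm (T x - T y)"
proof -
  have "norm ((T x - x) - (T y - y)) \<le> 1 / 2 * norm (x - y)"
  proof (rule differentiable_bound[OF \<open>convex U\<close> _ _ assms(4,5)])
    fix x assume "x \<in> U"
    show "((\<lambda>x. T x - x) has_derivative blinfun_apply (DT x - id_blinfun)) (at x within U)"
      using has_derivative_diff[OF has_derivative_at_withinI[OF der[OF \<open>x \<in> U\<close>]] has_derivative_ident]
      by (rule has_derivative_eq_rhs) (simp add: blinfun.diff_left fun_eq_iff)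
    show "onorm (blinfun_apply (DT x - id_blinfun)) \<le> 1 / 2"
      using near[OF \<open>x \<in> U\<close>] by (simp add: norm_blinfun.rep_eq)
  qed
  then show ?thesis
    using norm_triangle_ineq2[of "x - y" "T x - T y"]
    by (simp add: norm_minus_commute algebra_simps)
qed

text \<open>The expansion bound gives injectivity and a 2-Lipschitz inverse, invariance of domain an
  open image. For the inverse derivatives, B_z - B_w = B_z (D_w - D_z) B_w transfers the Lipschitz
  bound; the factor 8 is one 2 from each B and one from the inverse map.\<close>

lemma C11_diffeo_near_identity:
  fixes T :: "'a::euclidean_space \<Rightarrow> 'a" and DT :: "'a \<Rightarrow> 'a \<Rightarrow>\<^sub>L 'a"
  assumes U: "convex U" "open U" and der: "\<And>x. x \<in> U \<Longrightarrow> (T has_derivative blinfun_apply (DT x)) (at x)"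
    and lip: "K-lipschitz_on U DT"
    and near: "\<And>x. x \<in> U \<Longrightarrow> norm (DT x - id_blinfun) \<le> 1 / 2"
  shows "C11_diffeo_on U T"
proof -
  have expand: "norm (x - y) \<le> 2 * norm (T x - T y)" if "x \<in> U" "y \<in> U" for x y
    using near_identity_expansion[OF U(1) der near that] .
  have inj: "inj_on T U"
    using expand by (intro inj_onI) fastforce
  have cont: "continuous_on U T"
    using der has_derivative_continuous continuous_at_imp_continuous_on by blast
  have op: "open (T ` U)"
    using invariance_of_domain cont U(2) inj by blast
  define S where "S = inv_into U T"
  have S: "S z \<in> U" "T (S z) = z" if "z \<in> T ` U" for z
    using that by (auto simp: S_def inv_into_into f_inv_into_f)
  have Slip: "norm (S z - S w) \<le> 2 * norm (z - w)" if "z \<in> T ` U" "w \<in> T ` U" for z w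
    using expand[OF S(1)[OF that(1)] S(1)[OF that(2)]] S(2) that by simp
  have "\<forall>x\<in>U. \<exists>B. DT x o\<^sub>L B = id_blinfun \<and> B o\<^sub>L DT x = id_blinfun \<and> norm B \<le> 2"
    using blinfun_near_identity_inverse near by metis
  then obtain B where B: "\<And>x. x \<in> U \<Longrightarrow> DT x o\<^sub>L B x = id_blinfun"
    "\<And>x. x \<in> U \<Longrightarrow> B x o\<^sub>L DT x = id_blinfun" "\<And>x. x \<in> U \<Longrightarrow> norm (B x) \<le> 2"
    by metis
  have K0: "0 \<le> K" using lip lipschitz_on_nonneg by blast
  have "(S has_derivative blinfun_apply (B (S z))) (at z)" if z: "z \<in> T ` U" for z
  proof (rule has_derivative_inverse_basic)
    show "(T has_derivative blinfun_apply (DT (S z))) (at (S z))"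
      using der S(1)[OF z] by blast
    show "blinfun_apply (B (S z)) \<circ> blinfun_apply (DT (S z)) = id"
      using B(2)[OF S(1)[OF z]] by (metis blinfun_compose.rep_eq id_blinfun.rep_eq eq_id_iff)
    have "continuous_on (T ` U) S"
      using Slip by (intro lipschitz_on_continuous_on[of 2] lipschitz_onI) (auto simp: dist_norm)
    then show "continuous (at z) S"
      using op z continuous_on_eq_continuous_at by blast
    show "bounded_linear (blinfun_apply (B (S z)))"
      by (rule blinfun.bounded_linear_right)
  qed (use op z S(2) in auto)
  moreover have "(8 * K)-lipschitz_on (T ` U) (\<lambda>z. B (S z))"
  proof (rule lipschitz_onI)
    fix z w assume zw: "z \<in> T ` U" "w \<in> T ` U"
    note s = S(1)[OF zw(1)] S(1)[OF zw(2)]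
    have "B (S z) - B (S w) = B (S z) o\<^sub>L (DT (S w) - DT (S z)) o\<^sub>L B (S w)"
    proof (rule blinfun_eqI)
      fix h
      have "DT (S w) (B (S w) h) = h" for h
        using B(1)[OF s(2)] by (metis blinfun_apply_blinfun_compose id_blinfun.rep_eq)
      moreover have "B (S z) (DT (S z) h) = h" for h
        using B(2)[OF s(1)] by (metis blinfun_apply_blinfun_compose id_blinfun.rep_eq)
      ultimately show "(B (S z) - B (S w)) h = (B (S z) o\<^sub>L (DT (S w) - DT (S z)) o\<^sub>L B (S w)) h"
        by (simp add: blinfun.diff_left blinfun.diff_right)
    qed
    then have "norm (B (S z) - B (S w)) \<le> norm (B (S z)) * norm (DT (S w) - DT (S z)) * norm (B (S w))"
      using order_trans[OF norm_blinfun_compose mult_right_mono[OF norm_blinfun_compose norm_ge_zero]]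
      by (simp only:)
    also have "\<dots> \<le> 2 * (K * norm (S w - S z)) * 2"
      using B(3)[OF s(1)] B(3)[OF s(2)] lipschitz_onD[OF lip s(2) s(1)] K0
      by (intro mult_mono) (auto simp: dist_norm)
    also have "\<dots> \<le> 2 * (K * (2 * norm (w - z))) * 2"
      using Slip[OF zw(2,1)] K0 by (intro mult_right_mono mult_left_mono) auto
    finally show "dist (B (S z)) (B (S w)) \<le> 8 * K * dist z w"
      by (simp add: dist_norm norm_minus_commute)
  qed (use K0 in simp)
  ultimately have "C11_map_on (T ` U) S"
    unfolding C11_map_on_def by (intro exI[of _ "\<lambda>z. B (S z)"] exI[of _ "8 * K"]) simp
  moreover have "C11_map_on U T"
    unfolding C11_map_on_def using der lip by (intro exI[of _ DT] exI[of _ K]) simp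
  ultimately show ?thesis
    using U(2) inj op by (simp add: C11_diffeo_on_def S_def)
qed

lemma C11_map_continuous_on: "C11_map_on U T \<Longrightarrow> continuous_on U T"
  unfolding C11_map_on_def using has_derivative_continuous continuous_at_imp_continuous_on by blast

lemma image_closure_point:
  fixes T :: "'a::topological_space \<Rightarrow> 'b::topological_space"
  assumes "open U" "continuous_on U T" "T ` (A \<inter> U) \<subseteq> B" "x \<in> U" "x \<in> closure A"
  shows "T x \<in> closure B"
proof -
  have "x \<in> closure (A \<inter> U)"
    using open_Int_closure_subset[OF assms(1), of A] assms(4,5) by (auto simp: Int_commute)
  then have "T x \<in> closure (T ` (A \<inter> U))"
  proof -
    show ?thesis
      unfolding closure_iff_nhds_not_empty
    proof safe
      fix W V assume W: "V \<subseteq> W" "open V" "T x \<in> V" "T ` (A \<inter> U) \<inter> W = {}"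
      have "open (T -` V \<inter> U)"
        using continuous_on_open_vimage[OF assms(1)] assms(2) W(2) by blast
      moreover have "x \<in> T -` V \<inter> U"
        using W(3) assms(4) by blast
      ultimately obtain z where "z \<in> A \<inter> U" "z \<in> T -` V"
        using \<open>x \<in> closure (A \<inter> U)\<close> unfolding closure_iff_nhds_not_empty by blast
      then show False
        using W by blast
    qed
  qed
  then show ?thesis
    using closure_mono[OF assms(3)] by blast
qed

text \<open>Continuity of \<open>T\<close> and of its inverse carries closure points both ways, and
  the frontier of an open set is its closure without the set.\<close>

lemma C11_diffeo_image_frontier:
  fixes T :: "'a::euclidean_space \<Rightarrow> 'a"
  assumes T: "C11_diffeo_on U T" and "open A" "open B" and AB: "T ` (A \<inter> U) = B \<inter> T ` U"
  shows "T ` (frontier A \<inter> U) = frontier B \<inter> T ` U"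
proof -
  define S where "S = inv_into U T"
  have U: "open U" "inj_on T U" "open (T ` U)" "continuous_on U T" "continuous_on (T ` U) S"
    using T C11_map_continuous_on unfolding C11_diffeo_on_def S_def by blast+
  have S: "S (T x) = x" if "x \<in> U" for x
    using U(2) that by (simp add: S_def)
  have "S ` (B \<inter> T ` U) \<subseteq> A"
    using S unfolding AB[symmetric] by auto
  then have cl: "T x \<in> closure B \<longleftrightarrow> x \<in> closure A" if "x \<in> U" for x
    using image_closure_point[OF U(1,4), of A B x] image_closure_point[OF U(3,5), of B A "T x"] AB S that
    by auto
  have mem: "T x \<in> B \<longleftrightarrow> x \<in> A" if "x \<in> U" for x
    using AB U(2) that by (auto simp: inj_on_def)
  show ?thesis
    using cl mem \<open>open A\<close> \<open>open B\<close> by (auto simp: frontier_def interior_open)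
qed

section \<open>Corners and their tangent cones\<close>

lemma hcoord_diff: "hcoord e x - hcoord e y = hcoord e (x - y)"
  by (simp add: hcoord_def inner_diff_left scaleR_left_diff_distrib algebra_simps)

lemma inner_hcoord: "a \<bullet> e = 0 \<Longrightarrow> a \<bullet> hcoord e x = a \<bullet> x"
  by (simp add: hcoord_def inner_diff_right)

lemma hcoord_orthogonal: "norm e = 1 \<Longrightarrow> hcoord e x \<bullet> e = 0"
  by (simp add: hcoord_def inner_diff_left norm_eq_1)

lemma inner_self_hcoord: "norm e = 1 \<Longrightarrow> x \<bullet> x = (x \<bullet> e)\<^sup>2 + hcoord e x \<bullet> hcoord e x"
  by (simp add: hcoord_def inner_diff_left inner_diff_right norm_eq_1 inner_commute power2_eq_square)

lemma norm_hcoord_le: "norm e = 1 \<Longrightarrow> norm (hcoord e x) \<le> norm x"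
  using inner_self_hcoord[of e x] by (simp add: norm_le)

lemma hcoord_add_scale: "norm e = 1 \<Longrightarrow> hcoord e (x + t *\<^sub>R e) = hcoord e x"
  by (simp add: hcoord_def inner_add_left norm_eq_1 scaleR_left_distrib)

lemma hcoord_in_hdisc: "norm e = 1 \<Longrightarrow> x \<in> ball x0 r \<Longrightarrow> hcoord e x \<in> hdisc e x0 r"
  using norm_hcoord_le[of e "x - x0"]
  by (simp add: hdisc_def hcoord_orthogonal dist_norm hcoord_diff norm_minus_commute)

lemma convex_hdisc: "convex (hdisc e x0 r)"
proof -
  have "hdisc e x0 r = {y. e \<bullet> y = 0} \<inter> ball (hcoord e x0) r"
    by (auto simp: hdisc_def dist_commute inner_commute)
  then show ?thesis
    by (simp add: convex_Int convex_hyperplane)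
qed

text \<open>Near \<open>x0\<close>, a point is in \<open>\<Omega>\<close>, and a point is in the tangent cone \<open>V\<close>, if the set of indices of
  the surfaces, or tangent planes, below it belongs to \<open>\<I>\<close>. The vectors \<open>\<nu>' i\<close> are dual to the
  unnormalized normals \<open>e - Df i x0'\<close>.\<close>

locale corner =
  fixes \<Omega> V :: "'a::euclidean_space set" and x0 e :: 'a and R M N :: real and k :: nat
    and f :: "nat \<Rightarrow> 'a \<Rightarrow> real" and Df :: "nat \<Rightarrow> 'a \<Rightarrow> 'a" and \<nu>' :: "nat \<Rightarrow> 'a"
    and \<I> :: "nat set set"
  assumes R: "R > 0" and e: "norm e = 1" and k: "1 \<le> k"
    and der: "\<And>i y. i < k \<Longrightarrow> y \<in> hdisc e x0 R \<Longrightarrow>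
      (f i has_derivative (\<lambda>h. Df i y \<bullet> h)) (at y within hdisc e x0 R)"
    and orth: "\<And>i y. i < k \<Longrightarrow> y \<in> hdisc e x0 R \<Longrightarrow> Df i y \<bullet> e = 0"
    and Df_le: "\<And>i y. i < k \<Longrightarrow> y \<in> hdisc e x0 R \<Longrightarrow> norm (Df i y) \<le> M"
    and lip: "\<And>i. i < k \<Longrightarrow> M-lipschitz_on (hdisc e x0 R) (Df i)"
    and f_x0: "\<And>i. i < k \<Longrightarrow> f i (hcoord e x0) = x0 \<bullet> e"
    and open_\<Omega>: "open \<Omega>" and bounded_\<Omega>: "bounded \<Omega>" and x0: "x0 \<in> frontier \<Omega>"
    and \<Omega>_iff: "\<And>x. x \<in> ball x0 R \<Longrightarrow> x \<in> \<Omega> \<longleftrightarrow> {i. i < k \<and> f i (hcoord e x) < x \<bullet> e} \<in> \<I>"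
    and upward: "\<And>x t. x \<in> \<Omega> \<Longrightarrow> 0 < t \<Longrightarrow> x \<in> ball x0 R \<Longrightarrow> x + t *\<^sub>R e \<in> ball x0 R \<Longrightarrow> x + t *\<^sub>R e \<in> \<Omega>"
    and V_def: "V = {x. {i. i < k \<and> 0 < (e - Df i (hcoord e x0)) \<bullet> (x - x0)} \<in> \<I>}"
    and dual: "\<And>i j. i < k \<Longrightarrow> j < k \<Longrightarrow> \<nu>' i \<bullet> (e - Df j (hcoord e x0)) = (if i = j then 1 else 0)"
    and dual_le: "\<And>i. i < k \<Longrightarrow> norm (\<nu>' i) \<le> N"
begin

text \<open>Not normalized, so that \<open>\<nu> i \<bullet> e = 1\<close>: a shift along
  \<open>e\<close> raises all linear heights and all heights \<open>\<eta> i\<close> by the same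
  amount.\<close>

definition \<nu> :: "nat \<Rightarrow> 'a" where "\<nu> i = e - Df i (hcoord e x0)"

definition \<eta> :: "nat \<Rightarrow> 'a \<Rightarrow> real" where "\<eta> i x = x \<bullet> e - f i (hcoord e x)"

text \<open>Each dual vector changes one linear height and leaves the others fixed, so adding the
  nonlinear parts of the heights along these vectors satisfies all k conditions
  simultaneously.\<close>

definition T :: "'a \<Rightarrow> 'a" where "T x = x + (\<Sum>i<k. (\<eta> i x - \<nu> i \<bullet> (x - x0)) *\<^sub>R \<nu>' i)"

lemma ee: "e \<bullet> e = 1"
  using e by (simp add: norm_eq_1)

lemma M_nonneg: "0 \<le> M"
  using lip[of 0] k lipschitz_on_nonneg by force

lemma N_nonneg: "0 \<le> N"
  using dual_le[of 0] k norm_ge_zero[of "\<nu>' 0"] by linarith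

lemma hdisc: "x \<in> ball x0 R \<Longrightarrow> hcoord e x \<in> hdisc e x0 R"
  using hcoord_in_hdisc[OF e] .

lemma hdisc_x0: "hcoord e x0 \<in> hdisc e x0 R"
  using hdisc R by simp

lemma \<Omega>_iff': "x \<in> ball x0 R \<Longrightarrow> x \<in> \<Omega> \<longleftrightarrow> {i. i < k \<and> 0 < \<eta> i x} \<in> \<I>"
  using \<Omega>_iff by (simp add: \<eta>_def)

lemma V_iff: "x \<in> V \<longleftrightarrow> {i. i < k \<and> 0 < \<nu> i \<bullet> (x - x0)} \<in> \<I>"
  by (simp add: V_def \<nu>_def)

lemma inner_sum_dual:
  assumes "j < k"
  shows "\<nu> j \<bullet> (\<Sum>i<k. c i *\<^sub>R \<nu>' i) = c j"
proof -
  have "\<nu> j \<bullet> (\<Sum>i<k. c i *\<^sub>R \<nu>' i) = (\<Sum>i<k. c i * (if i = j then 1 else 0))"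
    unfolding inner_sum_right using dual assms
    by (intro sum.cong) (auto simp: \<nu>_def inner_commute)
  then show ?thesis
    using assms by (simp add: if_distrib[of "\<lambda>z. c _ * z"] cong: if_cong)
qed

lemma norm_sum_dual_le:
  assumes "\<And>i. i < k \<Longrightarrow> \<bar>c i\<bar> \<le> b"
  shows "norm (\<Sum>i<k. c i *\<^sub>R \<nu>' i) \<le> real k * N * b"
proof -
  have "norm (\<Sum>i<k. c i *\<^sub>R \<nu>' i) \<le> (\<Sum>i<k. b * N)"
  proof (rule sum_norm_le)
    fix i assume "i \<in> {..<k}"
    then show "norm (c i *\<^sub>R \<nu>' i) \<le> b * N"
      using assms[of i] dual_le[of i] abs_ge_zero[of "c i"] by (simp add: mult_mono)
  qed
  then show ?thesis
    by (simp add: mult_ac)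
qed

lemma \<nu>_T: "i < k \<Longrightarrow> \<nu> i \<bullet> (T x - x0) = \<eta> i x"
  using inner_sum_dual[of i "\<lambda>i. \<eta> i x - \<nu> i \<bullet> (x - x0)"]
  by (simp add: T_def inner_diff_right inner_add_right algebra_simps)

lemma \<eta>_x0: "i < k \<Longrightarrow> \<eta> i x0 = 0"
  using f_x0 by (simp add: \<eta>_def)

lemma T_x0: "T x0 = x0"
  by (simp add: T_def \<eta>_x0)

text \<open>\<open>T\<close> preserves index patterns exactly, and \<Omega> and \<open>V\<close> are
  described by the same family of patterns.\<close>

lemma T_in_V_iff: "x \<in> ball x0 R \<Longrightarrow> T x \<in> V \<longleftrightarrow> x \<in> \<Omega>"
  unfolding V_iff \<Omega>_iff' by (simp add: \<nu>_T cong: conj_cong)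

lemma \<eta>_has_derivative:
  assumes "i < k" "x \<in> ball x0 R"
  shows "(\<eta> i has_derivative (\<lambda>h. (e - Df i (hcoord e x)) \<bullet> h)) (at x)"
proof -
  have 1: "(hcoord e has_derivative hcoord e) (at x within ball x0 R)"
    unfolding hcoord_def[abs_def] by (auto intro!: derivative_eq_intros)
  have 2: "(f i has_derivative (\<lambda>h. Df i (hcoord e x) \<bullet> h)) (at (hcoord e x) within hcoord e ` ball x0 R)"
    using hdisc by (intro has_derivative_subset[OF der[OF assms(1) hdisc[OF assms(2)]]]) auto
  have "((\<lambda>x. f i (hcoord e x)) has_derivative (\<lambda>h. Df i (hcoord e x) \<bullet> hcoord e h)) (at x within ball x0 R)"
    using has_derivative_in_compose[OF 1 2] .
  then have "((\<lambda>x. f i (hcoord e x)) has_derivative (\<lambda>h. Df i (hcoord e x) \<bullet> h)) (at x)"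
    unfolding at_within_open[OF assms(2) open_ball]
      inner_hcoord[OF orth[OF assms(1) hdisc[OF assms(2)]]] .
  then have "((\<lambda>x. x \<bullet> e - f i (hcoord e x)) has_derivative (\<lambda>h. h \<bullet> e - Df i (hcoord e x) \<bullet> h)) (at x)"
    by (intro derivative_intros)
  then show ?thesis
    unfolding \<eta>_def[abs_def]
    by (rule has_derivative_eq_rhs) (simp add: inner_diff_left inner_commute[of e] fun_eq_iff)
qed

lemma \<eta>_isCont: "i < k \<Longrightarrow> x \<in> ball x0 R \<Longrightarrow> isCont (\<eta> i) x"
  using \<eta>_has_derivative has_derivative_continuous by blast

lemma \<eta>_shift: "\<eta> i (x + t *\<^sub>R e) = \<eta> i x + t"
  by (simp add: \<eta>_def hcoord_add_scale[OF e] inner_add_left ee)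

lemma norm_normal_le: "i < k \<Longrightarrow> x \<in> ball x0 R \<Longrightarrow> norm (e - Df i (hcoord e x)) \<le> 1 + M"
  using norm_triangle_ineq4[of e "Df i (hcoord e x)"] Df_le[OF _ hdisc] e by fastforce

lemma Df_diff_le:
  assumes "i < k" "x \<in> ball x0 R" "y \<in> ball x0 R"
  shows "norm (Df i (hcoord e x) - Df i (hcoord e y)) \<le> M * norm (x - y)"
proof -
  have "norm (Df i (hcoord e x) - Df i (hcoord e y)) \<le> M * norm (hcoord e x - hcoord e y)"
    using lipschitz_onD[OF lip[OF assms(1)] hdisc[OF assms(2)] hdisc[OF assms(3)]] by (simp add: dist_norm)
  also have "\<dots> \<le> M * norm (x - y)"
    unfolding hcoord_diff using norm_hcoord_le[OF e] M_nonneg by (intro mult_left_mono)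
  finally show ?thesis .
qed

lemma \<eta>_le:
  assumes "i < k" "x \<in> ball x0 R"
  shows "\<bar>\<eta> i x\<bar> \<le> (1 + M) * norm (x - x0)"
proof -
  have "norm (\<eta> i x - \<eta> i x0) \<le> (1 + M) * norm (x - x0)"
  proof (rule differentiable_bound[where f' = "\<lambda>x h. (e - Df i (hcoord e x)) \<bullet> h"])
    fix y assume y: "y \<in> ball x0 R"
    show "(\<eta> i has_derivative (\<lambda>h. (e - Df i (hcoord e y)) \<bullet> h)) (at y within ball x0 R)"
      using \<eta>_has_derivative[OF assms(1) y] by (rule has_derivative_at_withinI)
    show "onorm (\<lambda>h. (e - Df i (hcoord e y)) \<bullet> h) \<le> 1 + M"
    proof (rule onorm_le)
      fix h
      show "norm ((e - Df i (hcoord e y)) \<bullet> h) \<le> (1 + M) * norm h"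
        using Cauchy_Schwarz_ineq2[of "e - Df i (hcoord e y)" h]
          mult_right_mono[OF norm_normal_le[OF assms(1) y] norm_ge_zero[of h]] by simp
    qed
  qed (use assms R in auto)
  then show ?thesis
    using \<eta>_x0[OF assms(1)] by simp
qed

text \<open>Along the segment between the horizontal projections \<open>Df i\<close> varies by at
  most \<open>M\<close> times its length; the mean value bound for \<open>f i\<close> minus its
  linear part then leaves only the horizontal displacement.\<close>

lemma \<eta>_taylor:
  assumes "i < k" "x \<in> ball x0 R" "b \<in> ball x0 R"
  shows "\<bar>f i (hcoord e x) - f i (hcoord e b) - Df i (hcoord e b) \<bullet> (x - b)\<bar> \<le>
    M * (hcoord e (x - b) \<bullet> hcoord e (x - b))"
proof -
  define X where "X = hcoord e x"
  define B where "B = hcoord e b"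
  have XB: "X \<in> hdisc e x0 R" "B \<in> hdisc e x0 R"
    using assms hdisc by (auto simp: X_def B_def)
  define S where "S = closed_segment B X"
  have S: "S \<subseteq> hdisc e x0 R"
    unfolding S_def by (rule closed_segment_subset[OF XB(2,1) convex_hdisc])
  have "norm ((f i X - Df i B \<bullet> X) - (f i B - Df i B \<bullet> B)) \<le> (M * norm (X - B)) * norm (X - B)"
  proof (rule differentiable_bound[where f' = "\<lambda>y h. (Df i y - Df i B) \<bullet> h" and S = S])
    fix y assume y: "y \<in> S"
    have "(f i has_derivative (\<lambda>h. Df i y \<bullet> h)) (at y within S)"
      using der[OF assms(1)] y S has_derivative_subset by blast
    then have "((\<lambda>y. f i y - Df i B \<bullet> y) has_derivative (\<lambda>h. Df i y \<bullet> h - Df i B \<bullet> h)) (at y within S)"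
      by (intro derivative_intros)
    then show "((\<lambda>y. f i y - Df i B \<bullet> y) has_derivative (\<lambda>h. (Df i y - Df i B) \<bullet> h)) (at y within S)"
      by (simp add: inner_diff_left)
    have "norm (Df i y - Df i B) \<le> M * norm (y - B)"
      using lipschitz_onD[OF lip[OF assms(1)], of y B] y S XB by (auto simp: dist_norm)
    also have "\<dots> \<le> M * norm (X - B)"
      using y M_nonneg segment_bound(1)[of y B X] by (intro mult_left_mono) (auto simp: S_def)
    finally have *: "norm (Df i y - Df i B) \<le> M * norm (X - B)" .
    show "onorm (\<lambda>h. (Df i y - Df i B) \<bullet> h) \<le> M * norm (X - B)"
    proof (rule onorm_le)
      fix h
      show "norm ((Df i y - Df i B) \<bullet> h) \<le> M * norm (X - B) * norm h"
        using Cauchy_Schwarz_ineq2[of "Df i y - Df i B" h] mult_right_mono[OF * norm_ge_zero[of h]] by simp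
    qed
  qed (auto simp: S_def)
  moreover have "Df i B \<bullet> (X - B) = Df i B \<bullet> (x - b)"
    unfolding X_def B_def hcoord_diff using inner_hcoord orth[OF assms(1) hdisc[OF assms(3)]] by blast
  moreover have "norm (X - B) * norm (X - B) = hcoord e (x - b) \<bullet> hcoord e (x - b)"
    unfolding X_def B_def hcoord_diff by (simp add: dot_square_norm power2_eq_square)
  ultimately show ?thesis
    unfolding X_def[symmetric] B_def[symmetric] by (simp add: inner_diff_right algebra_simps)
qed

section \<open>Regularity of \<open>T\<close>\<close>

definition DT :: "'a \<Rightarrow> 'a \<Rightarrow>\<^sub>L 'a" where
  "DT x = Blinfun (\<lambda>h. h + (\<Sum>i<k. ((Df i (hcoord e x0) - Df i (hcoord e x)) \<bullet> h) *\<^sub>R \<nu>' i))"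

lemma DT_apply: "DT x h = h + (\<Sum>i<k. ((Df i (hcoord e x0) - Df i (hcoord e x)) \<bullet> h) *\<^sub>R \<nu>' i)"
  unfolding DT_def by (subst bounded_linear_Blinfun_apply) (auto intro!: bounded_linear_intros)

lemma T_has_derivative:
  assumes "x \<in> ball x0 R"
  shows "(T has_derivative blinfun_apply (DT x)) (at x)"
proof -
  have "((\<lambda>x. x + (\<Sum>i<k. (\<eta> i x - \<nu> i \<bullet> (x - x0)) *\<^sub>R \<nu>' i)) has_derivative
      (\<lambda>h. h + (\<Sum>i<k. ((e - Df i (hcoord e x)) \<bullet> h - \<nu> i \<bullet> (h - 0)) *\<^sub>R \<nu>' i))) (at x)"
    by (intro derivative_intros \<eta>_has_derivative assms) auto
  then show ?thesis
    unfolding T_def[abs_def] by (simp add: DT_apply[abs_def] \<nu>_def inner_diff_left)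
qed

lemma DT_diff_le:
  assumes "x \<in> ball x0 R" "y \<in> ball x0 R"
  shows "norm (DT x - DT y) \<le> real k * N * M * norm (x - y)"
proof (rule norm_blinfun_bound)
  show "0 \<le> real k * N * M * norm (x - y)"
    using N_nonneg M_nonneg by simp
  fix h
  have "(DT x - DT y) h = (\<Sum>i<k. ((Df i (hcoord e y) - Df i (hcoord e x)) \<bullet> h) *\<^sub>R \<nu>' i)"
    by (simp add: blinfun.diff_left DT_apply sum_subtractf[symmetric] inner_diff_left scaleR_diff_left)
  also have "norm \<dots> \<le> real k * N * (M * norm (x - y) * norm h)"
  proof (rule norm_sum_dual_le)
    fix i assume "i < k"
    show "\<bar>(Df i (hcoord e y) - Df i (hcoord e x)) \<bullet> h\<bar> \<le> M * norm (x - y) * norm h"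
      using Cauchy_Schwarz_ineq2[of "Df i (hcoord e y) - Df i (hcoord e x)" h]
        mult_right_mono[OF Df_diff_le[OF \<open>i < k\<close> assms] norm_ge_zero[of h]]
      by (simp add: norm_minus_commute)
  qed
  finally show "norm ((DT x - DT y) h) \<le> real k * N * M * norm (x - y) * norm h"
    by (simp add: mult.assoc)
qed

lemma DT_x0: "DT x0 = id_blinfun"
  by (rule blinfun_eqI) (simp add: DT_apply)

lemma T_diffeo:
  assumes "0 < r" "r \<le> R" "real k * N * M * r \<le> 1 / 2"
  shows "C11_diffeo_on (ball x0 r) T"
proof (rule C11_diffeo_near_identity)
  have sub: "x \<in> ball x0 R" if "x \<in> ball x0 r" for x
    using that assms(2) by simp
  show "(T has_derivative blinfun_apply (DT x)) (at x)" if "x \<in> ball x0 r" for x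
    using T_has_derivative[OF sub[OF that]] .
  show "(real k * N * M)-lipschitz_on (ball x0 r) DT"
    using DT_diff_le sub N_nonneg M_nonneg by (intro lipschitz_onI) (auto simp: dist_norm)
  show "norm (DT x - id_blinfun) \<le> 1 / 2" if "x \<in> ball x0 r" for x
  proof -
    have "norm (DT x - id_blinfun) \<le> real k * N * M * norm (x - x0)"
      using DT_diff_le[OF sub[OF that], of x0] R by (simp add: DT_x0)
    also have "\<dots> \<le> real k * N * M * r"
      using that N_nonneg M_nonneg by (intro mult_left_mono) (auto simp: dist_norm norm_minus_commute)
    finally show ?thesis using assms(3) by simp
  qed
qed auto

lemma T_image: "r \<le> R \<Longrightarrow> T ` (\<Omega> \<inter> ball x0 r) = V \<inter> T ` ball x0 r"
  using T_in_V_iff by fastforce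

lemma exists_radius: "\<exists>r>0. r \<le> R \<and> real k * N * M * r \<le> 1 / 2"
proof -
  define a where "a = real k * N * M"
  have a: "0 \<le> a" using N_nonneg M_nonneg by (simp add: a_def)
  have "a * min R (1 / (2 * (a + 1))) \<le> a * (1 / (2 * (a + 1)))"
    using a by (intro mult_left_mono) auto
  also have "\<dots> \<le> 1 / 2"
    using a by (simp add: field_simps)
  finally show ?thesis
    using R a unfolding a_def[symmetric]
    by (intro exI[of _ "min R (1 / (2 * (a + 1)))"]) auto
qed

text \<open>Every sign pattern occurs near \<open>x0\<close>, since \<open>T\<close> is a local homeomorphism.\<close>

lemma pattern_attained:
  obtains \<delta> where "\<delta> > 0"
    and "\<And>c. (\<And>i. i < k \<Longrightarrow> \<bar>c i\<bar> \<le> \<delta>) \<Longrightarrow> \<exists>x\<in>ball x0 (R / 2). \<forall>i<k. \<eta> i x = c i"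
proof -
  obtain r where r: "r > 0" "r \<le> R" "real k * N * M * r \<le> 1 / 2"
    using exists_radius by blast
  define r' where "r' = r / 2"
  have "C11_diffeo_on (ball x0 r') T"
    using r N_nonneg M_nonneg by (intro T_diffeo) (auto simp: r'_def)
  then have "open (T ` ball x0 r')"
    by (simp add: C11_diffeo_on_def)
  moreover have "x0 \<in> T ` ball x0 r'"
    using T_x0 r(1) by (intro image_eqI[of _ _ x0]) (auto simp: r'_def)
  ultimately obtain d where d: "d > 0" "ball x0 d \<subseteq> T ` ball x0 r'"
    using open_contains_ball by metis
  show thesis
  proof
    \<comment> \<open>Chosen so that every combination of the dual vectors with coefficients up to
      \<open>\<delta>\<close> has norm below \<open>d\<close>.\<close>
    define \<delta> where "\<delta> = d / (2 * (real k * N + 1))"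
    have kN: "0 \<le> real k * N" using N_nonneg by simp
    show "\<delta> > 0" using d(1) kN by (simp add: \<delta>_def)
    fix c assume c: "\<And>i. i < k \<Longrightarrow> \<bar>c i\<bar> \<le> \<delta>"
    define y where "y = x0 + (\<Sum>i<k. c i *\<^sub>R \<nu>' i)"
    have "norm (y - x0) \<le> real k * N * \<delta>"
      unfolding y_def using norm_sum_dual_le[of c \<delta>] c by simp
    also have "\<dots> \<le> (real k * N + 1) * \<delta>"
      using \<open>\<delta> > 0\<close> by simp
    also have "\<dots> = d / 2"
    proof -
      have "a \<noteq> 0 \<Longrightarrow> a * (d / (2 * a)) = d / 2" for a :: real
        by simp
      then show ?thesis
        unfolding \<delta>_def using kN by (metis add_nonneg_pos less_irrefl zero_less_one)
    qed
    also have "\<dots> < d"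
      using d(1) by simp
    finally have "y \<in> ball x0 d"
      by (simp add: dist_norm norm_minus_commute)
    then obtain x where x: "x \<in> ball x0 r'" "T x = y"
      using d(2) by blast
    have "\<eta> i x = c i" if "i < k" for i
      using \<nu>_T[OF that, of x] x(2) inner_sum_dual[OF that, of c] by (simp add: y_def)
    moreover have "x \<in> ball x0 (R / 2)"
      using x(1) r(2) by (simp add: r'_def)
    ultimately show "\<exists>x\<in>ball x0 (R / 2). \<forall>i<k. \<eta> i x = c i"
      by blast
  qed
qed

text \<open>Turns a property of points, that \<Omega> lies above a graph, into a property of
  patterns: a point with pattern \<open>I\<close> is moved upward until its pattern is
  \<open>J\<close>.\<close>

lemma \<I>_upward:
  assumes "I \<in> \<I>" "I \<subseteq> J" "J \<subseteq> {..<k}"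
  shows "J \<in> \<I>"
proof -
  obtain \<delta> where \<delta>: "\<delta> > 0" "\<And>c. (\<And>i. i < k \<Longrightarrow> \<bar>c i\<bar> \<le> \<delta>) \<Longrightarrow> \<exists>x\<in>ball x0 (R / 2). \<forall>i<k. \<eta> i x = c i"
    using pattern_attained by metis
  define s where "s = min (\<delta> / 3) (R / 8)"
  have s: "0 < s" "3 * s \<le> \<delta>" "2 * s < R / 2"
    using \<delta>(1) R by (auto simp: s_def)
  \<comment> \<open>A shift by 2s turns the heights s, -s, -3s into 3s, s, -s, so that exactly the
    indices in \<open>J\<close> become positive.\<close>
  have "\<exists>x\<in>ball x0 (R / 2). \<forall>i<k. \<eta> i x = (if i \<in> I then s else if i \<in> J then - s else - 3 * s)"
    by (rule \<delta>(2)) (use s in auto)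
  then obtain x where x: "x \<in> ball x0 (R / 2)"
    "\<And>i. i < k \<Longrightarrow> \<eta> i x = (if i \<in> I then s else if i \<in> J then - s else - 3 * s)"
    by blast
  have xR: "x \<in> ball x0 R" using x(1) R by simp
  have "{i. i < k \<and> 0 < \<eta> i x} = I"
    using x(2) s assms by (auto split: if_splits)
  then have "x \<in> \<Omega>"
    using \<Omega>_iff'[OF xR] assms(1) by simp
  have xs: "x + (2 * s) *\<^sub>R e \<in> ball x0 R"
    using x(1) s norm_triangle_ineq[of "x - x0" "(2 * s) *\<^sub>R e"] e
    by (simp add: dist_norm norm_minus_commute algebra_simps)
  have "x + (2 * s) *\<^sub>R e \<in> \<Omega>"
    using upward[OF \<open>x \<in> \<Omega>\<close> _ xR xs] s by simp
  moreover have "{i. i < k \<and> 0 < \<eta> i (x + (2 * s) *\<^sub>R e)} = J"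
    unfolding \<eta>_shift using x(2) s assms by (auto split: if_splits)
  ultimately show ?thesis
    using \<Omega>_iff'[OF xs] by simp
qed

lemma \<I>_mono:
  assumes "{i. i < k \<and> P i} \<in> \<I>" "\<And>i. i < k \<Longrightarrow> P i \<Longrightarrow> Q i"
  shows "{i. i < k \<and> Q i} \<in> \<I>"
  using assms by (intro \<I>_upward[OF assms(1)]) auto

lemma empty_notin_\<I>: "{} \<notin> \<I>"
proof
  assume "{} \<in> \<I>"
  then have "{i. i < k \<and> 0 < \<eta> i x0} \<in> \<I>"
    by (rule \<I>_upward) auto
  then have "x0 \<in> \<Omega>"
    using \<Omega>_iff'[of x0] R by simp
  then show False
    using x0 open_\<Omega> by (simp add: frontier_def interior_open)
qed

lemma full_in_\<I>: "{..<k} \<in> \<I>"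
proof -
  have "x0 \<in> closure \<Omega>"
    using x0 by (simp add: frontier_def)
  then obtain x where "x \<in> \<Omega>" "dist x x0 < R"
    using R by (meson closure_approachable)
  then have "{i. i < k \<and> 0 < \<eta> i x} \<in> \<I>"
    using \<Omega>_iff'[of x] by (simp add: dist_commute)
  then show ?thesis
    by (rule \<I>_upward) auto
qed

text \<open>The cells that make up the cone involve non-strict inequalities; upward closedness lets
  these be dropped, which leaves finite intersections of open half-spaces.\<close>

lemma open_V: "open V"
proof (subst open_subopen, safe)
  fix x assume "x \<in> V"
  define I where "I = {i. i < k \<and> 0 < \<nu> i \<bullet> (x - x0)}"
  have "I \<in> \<I>" using \<open>x \<in> V\<close> by (simp add: V_iff I_def)
  define U where "U = (\<Inter>i\<in>I. {y. 0 < \<nu> i \<bullet> (y - x0)})"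
  have "open U"
    unfolding U_def by (intro open_INT ballI open_Collect_less continuous_intros) (simp add: I_def)
  moreover have "x \<in> U"
    by (simp add: U_def I_def)
  moreover have "U \<subseteq> V"
  proof
    fix y assume "y \<in> U"
    then have "I \<subseteq> {i. i < k \<and> 0 < \<nu> i \<bullet> (y - x0)}"
      by (auto simp: U_def I_def)
    then show "y \<in> V"
      unfolding V_iff using \<I>_upward[OF \<open>I \<in> \<I>\<close>] by blast
  qed
  ultimately show "\<exists>U. open U \<and> x \<in> U \<and> U \<subseteq> V" by blast
qed

lemma x0_notin_V: "x0 \<notin> V"
  using empty_notin_\<I> by (simp add: V_iff)

lemma \<nu>_e: "i < k \<Longrightarrow> \<nu> i \<bullet> e = 1"
  using orth[OF _ hdisc_x0] by (simp add: \<nu>_def inner_diff_left ee)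

lemma norm_\<nu>_le: "i < k \<Longrightarrow> norm (\<nu> i) \<le> 1 + M"
  using norm_normal_le[of i x0] R by (simp add: \<nu>_def)

text \<open>Passing from \<open>p\<close> to a point of the ball raises no linear height: the shift
  loses \<open>s\<close>, because \<open>\<nu> i \<bullet> e = 1\<close>, and the radius times
  |\<nu> i| regains at most \<open>s\<close>. A point of the ball in \<open>V\<close> would
  therefore put \<open>p\<close> into \<open>V\<close>.\<close>

lemma exterior_cone_V: "exterior_cone V e (1 / (1 + M))"
  unfolding exterior_cone_def
proof (intro allI impI)
  fix p s assume p: "p \<notin> V" and s: "0 < (s::real)"
  show "ball (p - s *\<^sub>R e) (1 / (1 + M) * s) \<inter> V = {}"
  proof (rule ccontr)
    assume "ball (p - s *\<^sub>R e) (1 / (1 + M) * s) \<inter> V \<noteq> {}"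
    then obtain z where z: "norm (z - (p - s *\<^sub>R e)) < 1 / (1 + M) * s" "z \<in> V"
      by (auto simp: dist_norm norm_minus_commute)
    have "0 < \<nu> i \<bullet> (p - x0)" if "i < k" "0 < \<nu> i \<bullet> (z - x0)" for i
    proof -
      have "\<nu> i \<bullet> (z - (p - s *\<^sub>R e)) \<le> norm (\<nu> i) * norm (z - (p - s *\<^sub>R e))"
        by (rule norm_cauchy_schwarz)
      also have "\<dots> \<le> (1 + M) * (1 / (1 + M) * s)"
        using z(1) norm_\<nu>_le[OF that(1)] M_nonneg by (intro mult_mono) auto
      also have "\<dots> = s"
        using M_nonneg by simp
      finally have "\<nu> i \<bullet> (z - (p - s *\<^sub>R e)) \<le> s" .
      moreover have "\<nu> i \<bullet> (z - x0) = \<nu> i \<bullet> (p - x0) + \<nu> i \<bullet> (z - (p - s *\<^sub>R e)) - s"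
        using \<nu>_e[OF that(1)] by (simp add: inner_diff_right)
      ultimately show ?thesis using that(2) by simp
    qed
    then have "p \<in> V"
      using \<I>_mono[OF z(2)[unfolded V_iff], of "\<lambda>i. 0 < \<nu> i \<bullet> (p - x0)"] by (simp add: V_iff)
    then show False using p by blast
  qed
qed

text \<open>Points of \<Omega> close to \<open>x\<close> have smaller heights than the shifted
  point, so upward closedness applies. This makes translated functions continuous up to the
  boundary.\<close>

lemma closure_shift:
  assumes x: "x \<in> closure \<Omega>" "x \<in> ball x0 R" and "0 < t" and xt: "x + t *\<^sub>R e \<in> ball x0 R"
  shows "x + t *\<^sub>R e \<in> \<Omega>"
proof -
  define U where "U = ball x0 R \<inter> (\<Inter>i<k. ball x0 R \<inter> {y. \<eta> i y < \<eta> i x + t})"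
  have "open (ball x0 R \<inter> {y. \<eta> i y < \<eta> i x + t})" if "i < k" for i
  proof -
    have "continuous_on (ball x0 R) (\<eta> i)"
      using \<eta>_isCont[OF that] continuous_at_imp_continuous_on by blast
    then have "open (\<eta> i -` {..<\<eta> i x + t} \<inter> ball x0 R)"
      by (subst (asm) continuous_on_open_vimage) auto
    moreover have "\<eta> i -` {..<\<eta> i x + t} \<inter> ball x0 R = ball x0 R \<inter> {y. \<eta> i y < \<eta> i x + t}"
      by auto
    ultimately show ?thesis by simp
  qed
  then have "open U"
    unfolding U_def by (intro open_Int[OF open_ball open_INT]) auto
  moreover have "x \<in> U"
    using x(2) \<open>0 < t\<close> by (simp add: U_def)
  ultimately obtain y where y: "y \<in> \<Omega>" "y \<in> U"
    using x(1) unfolding closure_iff_nhds_not_empty by blast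
  then have yR: "y \<in> ball x0 R" by (simp add: U_def)
  have "{i. i < k \<and> 0 < \<eta> i y} \<in> \<I>"
    using \<Omega>_iff'[OF yR] y(1) by simp
  then have "{i. i < k \<and> 0 < \<eta> i (x + t *\<^sub>R e)} \<in> \<I>"
  proof (rule \<I>_mono)
    fix i assume "i < k" "0 < \<eta> i y"
    moreover have "\<eta> i y < \<eta> i x + t"
      using y(2) \<open>i < k\<close> unfolding U_def by blast
    ultimately show "0 < \<eta> i (x + t *\<^sub>R e)"
      by (simp add: \<eta>_shift)
  qed
  then show ?thesis
    using \<Omega>_iff'[OF xt] by simp
qed

end

section \<open>Comparison near a corner\<close>

text \<open>\<open>\<kappa>\<close> is the curvature scale of the comparison spheres:
  \<open>2 * M \<le> \<kappa>\<close> makes them bend faster than the surfaces,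
  \<open>32 * (1 + M) \<le> \<kappa> * R\<close> lets the quadratic term win beyond distance R/4
  from \<open>b\<close>, and \<open>near\<close> keeps every \<open>1 + K * d i\<close> between 1/2
  and 3/2.\<close>

locale corner_point = corner +
  fixes b :: "'a::euclidean_space" and \<kappa> :: real
  assumes b: "b \<in> \<Omega>" and \<kappa>: "0 < \<kappa>" "2 * M \<le> \<kappa>" "32 * (1 + M) \<le> \<kappa> * R"
    and near: "\<kappa> * ((1 + M) * norm (b - x0)) \<le> 1 / 2" "(1 + M) * norm (b - x0) \<le> R / 8"
begin

lemma b_near: "norm (b - x0) \<le> R / 8"
proof -
  have "1 * norm (b - x0) \<le> (1 + M) * norm (b - x0)"
    using M_nonneg by (intro mult_right_mono) auto
  then show ?thesis using near(2) by simp
qed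

lemma b_ball: "b \<in> ball x0 R"
  using b_near R by (simp add: dist_norm norm_minus_commute)

definition d :: "nat \<Rightarrow> real" where "d i = \<eta> i b"

definition \<mu> :: "nat \<Rightarrow> 'a" where "\<mu> i = e - Df i (hcoord e b)"

lemma d_le: "i < k \<Longrightarrow> \<bar>d i\<bar> \<le> (1 + M) * norm (b - x0)"
  using \<eta>_le[OF _ b_ball] by (simp add: d_def)

lemma d_small: "i < k \<Longrightarrow> \<bar>d i\<bar> \<le> R / 8"
  using d_le near(2) by fastforce

lemma Kd_small:
  assumes "i < k" "\<bar>K\<bar> = \<kappa>"
  shows "\<bar>K * d i\<bar> \<le> 1 / 2"
proof -
  have "\<bar>K * d i\<bar> \<le> \<kappa> * ((1 + M) * norm (b - x0))"
    unfolding abs_mult assms(2) using d_le[OF assms(1)] \<kappa>(1) by (intro mult_left_mono) auto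
  then show ?thesis using near(1) by simp
qed

text \<open>\<open>mobius\<close> straightens sphere i to a plane with normal
  \<open>\<mu> i\<close>; the dual vectors make \<open>A K\<close> turn this normal into
  \<open>\<nu> i\<close>, and the factor \<open>1 + K * d i\<close> adjusts the offset of the
  plane.\<close>

definition A :: "real \<Rightarrow> 'a \<Rightarrow> 'a" where
  "A K h = h + (\<Sum>i<k. (((1 + K * d i) *\<^sub>R \<mu> i - \<nu> i) \<bullet> h) *\<^sub>R \<nu>' i)"

abbreviation Dom :: "real \<Rightarrow> 'a set" where
  "Dom K \<equiv> mobius_domain V e K b (\<lambda>w. A K w + T b)"

abbreviation barrier :: "real \<Rightarrow> real \<Rightarrow> ('a \<Rightarrow> real) \<Rightarrow> 'a \<Rightarrow> real" where
  "barrier \<tau> K \<equiv> mobius_barrier \<tau> e K b (\<lambda>w. A K w + T b)"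

lemma linear_A: "linear (A K)"
  by (simp add: linear_iff A_def inner_add_right scaleR_add_left sum.distrib scaleR_add_right
      scaleR_sum_right)

lemma \<nu>_A: "i < k \<Longrightarrow> \<nu> i \<bullet> A K h = (1 + K * d i) * (\<mu> i \<bullet> h)"
  using inner_sum_dual[of i "\<lambda>i. ((1 + K * d i) *\<^sub>R \<mu> i - \<nu> i) \<bullet> h"]
  by (simp add: A_def inner_add_right inner_diff_left)

text \<open>\<open>\<mu> i - \<nu> i\<close> is O(|b - x0|) because the gradients are Lipschitz, and
  so is \<open>K * d i\<close> because the surfaces pass through \<open>x0\<close>. This is the
  source of the rate in the theorem.\<close>

lemma A_near_identity:
  assumes "\<bar>K\<bar> = \<kappa>"
  shows "norm (A K h - h) \<le> (real k * N * (\<kappa> * (1 + M)\<^sup>2 + M)) * norm (b - x0) * norm h"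
proof -
  have "A K h - h = (\<Sum>i<k. (((1 + K * d i) *\<^sub>R \<mu> i - \<nu> i) \<bullet> h) *\<^sub>R \<nu>' i)"
    by (simp add: A_def)
  also have "norm \<dots> \<le> real k * N * ((\<kappa> * (1 + M)\<^sup>2 + M) * norm (b - x0) * norm h)"
  proof (rule norm_sum_dual_le)
    fix i assume i: "i < k"
    have eq: "(1 + K * d i) *\<^sub>R \<mu> i - \<nu> i = (\<mu> i - \<nu> i) + (K * d i) *\<^sub>R \<mu> i"
      by (simp add: scaleR_add_left)
    have "norm (\<mu> i - \<nu> i) \<le> M * norm (b - x0)"
      using Df_diff_le[OF i b_ball, of x0] R by (simp add: \<mu>_def \<nu>_def norm_minus_commute)
    moreover have "norm ((K * d i) *\<^sub>R \<mu> i) \<le> (\<kappa> * ((1 + M) * norm (b - x0))) * (1 + M)"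
      unfolding norm_scaleR abs_mult assms \<mu>_def
      using d_le[OF i] \<kappa>(1) norm_normal_le[OF i b_ball] M_nonneg by (intro mult_mono mult_left_mono) auto
    ultimately have "norm ((1 + K * d i) *\<^sub>R \<mu> i - \<nu> i) \<le>
        M * norm (b - x0) + (\<kappa> * ((1 + M) * norm (b - x0))) * (1 + M)"
      unfolding eq by (intro order_trans[OF norm_triangle_ineq add_mono])
    also have "\<dots> = (\<kappa> * (1 + M)\<^sup>2 + M) * norm (b - x0)"
      by (simp add: power2_eq_square algebra_simps)
    finally have *: "norm ((1 + K * d i) *\<^sub>R \<mu> i - \<nu> i) \<le> (\<kappa> * (1 + M)\<^sup>2 + M) * norm (b - x0)" .
    show "\<bar>((1 + K * d i) *\<^sub>R \<mu> i - \<nu> i) \<bullet> h\<bar> \<le> (\<kappa> * (1 + M)\<^sup>2 + M) * norm (b - x0) * norm h"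
      using order_trans[OF Cauchy_Schwarz_ineq2 mult_right_mono[OF * norm_ge_zero]] .
  qed
  finally show ?thesis
    by (simp add: mult.assoc)
qed

section \<open>Touching spheres and the two comparison domains\<close>

definition slope :: "nat \<Rightarrow> 'a \<Rightarrow> real" where "slope i x = Df i (hcoord e b) \<bullet> (x - b)"

text \<open>Vertical coordinate relative to the point where the vertical line through
  \<open>b\<close> meets surface i.\<close>

definition height :: "nat \<Rightarrow> 'a \<Rightarrow> real" where "height i x = (x - b) \<bullet> e + d i"

definition horiz :: "'a \<Rightarrow> real" where "horiz x = hcoord e (x - b) \<bullet> hcoord e (x - b)"

text \<open>\<open>F K i\<close> vanishes on the sphere that is tangent to the surface \<open>i\<close> vertically below \<open>b\<close>; the
  transformation \<open>mobius e K b\<close> followed by \<open>A K\<close> maps it to the tangent plane \<open>i\<close> of the cone.\<close>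

definition F :: "real \<Rightarrow> nat \<Rightarrow> 'a \<Rightarrow> real" where
  "F K i x = (1 + K * d i) * (height i x - slope i x) - K * ((height i x)\<^sup>2 + horiz x)"

lemma horiz_nonneg: "0 \<le> horiz x"
  by (simp add: horiz_def)

text \<open>A polynomial identity once the denominator is cleared and |x - b|^2 is split into
  vertical and horizontal parts. The denominator being positive, the sign of \<open>F\<close> tells
  on which side of plane i the image lies.\<close>

lemma F_mobius:
  assumes "K \<noteq> 0" "x \<noteq> mobius_pole e K b" "i < k"
  shows "mobius_denom e K b x * (\<nu> i \<bullet> (A K (mobius e K b x) + T b - x0)) = F K i x"
proof -
  define h where "h = x - b"
  define D where "D = mobius_denom e K b x"
  have "\<nu> i \<bullet> (A K (mobius e K b x) + T b - x0) =
      (1 + K * d i) * (\<mu> i \<bullet> mobius e K b x) + d i"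
    using \<nu>_A[OF assms(3)] \<nu>_T[OF assms(3), of b] by (simp add: inner_add_right inner_diff_right d_def)
  then have f0: "D * (\<nu> i \<bullet> (A K (mobius e K b x) + T b - x0)) =
      (1 + K * d i) * (\<mu> i \<bullet> (D *\<^sub>R mobius e K b x)) + D * d i"
    by (simp add: algebra_simps)
  have f1: "\<mu> i \<bullet> (D *\<^sub>R mobius e K b x) = h \<bullet> e - slope i x - K * (h \<bullet> h)"
    unfolding D_def mobius_scaled[OF assms(1) e assms(2)] \<mu>_def slope_def h_def
    using orth[OF assms(3) hdisc[OF b_ball]]
    by (simp add: inner_diff_left inner_diff_right inner_commute ee algebra_simps)
  have f2: "D = 1 - 2 * K * (h \<bullet> e) + K\<^sup>2 * (h \<bullet> h)"
    unfolding D_def h_def by (rule mobius_denom_eq[OF assms(1) e])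
  have f3: "h \<bullet> h = (h \<bullet> e)\<^sup>2 + horiz x"
    unfolding horiz_def h_def by (rule inner_self_hcoord[OF e])
  have "(1 + K * d i) * (h \<bullet> e - slope i x - K * (h \<bullet> h)) + D * d i = F K i x"
    unfolding F_def height_def h_def[symmetric] f2 f3 by (simp add: power2_eq_square algebra_simps)
  then show ?thesis
    unfolding D_def[symmetric] f0 f1 .
qed

text \<open>At the pole \<open>height i\<close> equals \<open>(1 + K * d i) / K\<close>, where the
  two terms of \<open>F\<close> balance; the factor \<open>1 + K * d i\<close> in \<open>F\<close>
  makes this happen for every i.\<close>

lemma F_pole:
  assumes "K \<noteq> 0" "i < k"
  shows "F K i (mobius_pole e K b) = 0"
proof -
  have "hcoord e ((1 / K) *\<^sub>R e) = 0"
    by (simp add: hcoord_def ee)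
  moreover have "Df i (hcoord e b) \<bullet> e = 0"
    using orth[OF assms(2) hdisc[OF b_ball]] .
  ultimately show ?thesis
    using assms
    by (simp add: F_def height_def slope_def horiz_def mobius_pole_def ee power2_eq_square field_simps)
qed

lemma mobius_domain_iff:
  assumes "K \<noteq> 0"
  shows "x \<in> Dom K \<longleftrightarrow> {i. i < k \<and> 0 < F K i x} \<in> \<I>"
proof (cases "x = mobius_pole e K b")
  case True
  \<comment> \<open>The pattern of the pole is empty, hence not admissible, in agreement with its
    exclusion from the domain.\<close>
  then have *: "{i. i < k \<and> 0 < F K i x} = {}"
    using F_pole[OF assms] by auto
  show ?thesis
    unfolding * using True empty_notin_\<I> by (simp add: mobius_domain_def)
next
  case False
  have "0 < F K i x \<longleftrightarrow> 0 < \<nu> i \<bullet> (A K (mobius e K b x) + T b - x0)" if "i < k" for i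
    unfolding F_mobius[OF assms False that, symmetric]
    using mobius_denom_pos[OF assms False] by (simp add: zero_less_mult_iff)
  then show ?thesis
    using False by (simp add: mobius_domain_def V_iff cong: conj_cong)
qed

text \<open>All \<open>F\<close> have the sign of -K far from \<open>b\<close>: the inner domain is
  thereby confined near \<open>b\<close>, and the outer one contains everything far away.\<close>

lemma F_far:
  assumes "i < k" "\<bar>K\<bar> = \<kappa>" and far: "R / 4 < norm (x - b)"
  shows "K * F K i x < 0"
proof -
  define h' where "h' = norm (hcoord e (x - b))"
  define s where "s = height i x"
  \<comment> \<open>Since \<open>\<sigma> > R / 8\<close>, the linear term is below 2 (1 + M)
    \<sigma>, hence below \<kappa> R \<sigma> / 16 and \<kappa> \<sigma>^2 / 2, which the quadratic
    term dominates. This is where the constant 32 of the locale comes from.\<close>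
  define \<sigma> where "\<sigma> = \<bar>s\<bar> + h'"
  have h': "0 \<le> h'" "horiz x = h'\<^sup>2"
    by (simp_all add: h'_def horiz_def dot_square_norm)
  have "x - b = ((x - b) \<bullet> e) *\<^sub>R e + hcoord e (x - b)"
    by (simp add: hcoord_def)
  then have "norm (x - b) \<le> \<bar>(x - b) \<bullet> e\<bar> + h'"
    using norm_triangle_ineq[of "((x - b) \<bullet> e) *\<^sub>R e" "hcoord e (x - b)"] e by (simp add: h'_def)
  also have "\<bar>(x - b) \<bullet> e\<bar> \<le> \<bar>s\<bar> + R / 8"
    using d_small[OF assms(1)] by (simp add: s_def height_def)
  finally have \<sigma>: "R / 8 < \<sigma>"
    using far by (simp add: \<sigma>_def)
  then have \<sigma>0: "0 < \<sigma>" using R by simp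
  have slope: "\<bar>slope i x\<bar> \<le> M * h'"
  proof -
    have "slope i x = Df i (hcoord e b) \<bullet> hcoord e (x - b)"
      unfolding slope_def using inner_hcoord orth[OF assms(1) hdisc[OF b_ball]] by metis
    then show ?thesis
      using Cauchy_Schwarz_ineq2[of "Df i (hcoord e b)" "hcoord e (x - b)"]
        mult_right_mono[OF Df_le[OF assms(1) hdisc[OF b_ball]] h'(1)] by (simp add: h'_def)
  qed
  have "\<bar>s - slope i x\<bar> \<le> \<bar>s\<bar> + M * h'"
    using slope by linarith
  also have "\<dots> \<le> (1 + M) * \<sigma>"
    using M_nonneg h'(1) by (simp add: \<sigma>_def algebra_simps)
  finally have 1: "\<bar>s - slope i x\<bar> \<le> (1 + M) * \<sigma>" .
  have "\<bar>1 + K * d i\<bar> \<le> 3 / 2"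
    using Kd_small[OF assms(1,2)] by linarith
  then have 2: "\<bar>(1 + K * d i) * (s - slope i x)\<bar> \<le> 3 / 2 * ((1 + M) * \<sigma>)"
    unfolding abs_mult using 1 by (intro mult_mono) auto
  have "3 / 2 * ((1 + M) * \<sigma>) < 2 * (1 + M) * \<sigma>"
    using M_nonneg \<sigma>0 by (simp add: algebra_simps add_pos_nonneg)
  also have "\<dots> \<le> (\<kappa> * R / 16) * \<sigma>"
    using \<kappa>(3) \<sigma>0 by (intro mult_right_mono) auto
  also have "\<dots> \<le> (\<kappa> * \<sigma> / 2) * \<sigma>"
    using \<sigma> \<sigma>0 \<kappa>(1) by (intro mult_right_mono) auto
  also have "\<dots> \<le> \<kappa> * (s\<^sup>2 + h'\<^sup>2)"
  proof -
    have "\<sigma> * \<sigma> \<le> 2 * (s\<^sup>2 + h'\<^sup>2)"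
      using zero_le_power2[of "\<bar>s\<bar> - h'"] by (simp add: \<sigma>_def power2_eq_square algebra_simps)
    from mult_left_mono[OF this, of \<kappa>] show ?thesis
      using \<kappa>(1) by simp
  qed
  finally have 3: "\<bar>(1 + K * d i) * (s - slope i x)\<bar> < \<kappa> * (s\<^sup>2 + h'\<^sup>2)"
    using 2 by linarith
  have "K * F K i x = K * ((1 + K * d i) * (s - slope i x)) - K\<^sup>2 * (s\<^sup>2 + h'\<^sup>2)"
    by (simp add: F_def s_def h'(2) power2_eq_square algebra_simps)
  also have "K\<^sup>2 = \<kappa> * \<kappa>"
    unfolding assms(2)[symmetric] abs_mult_self_eq by (simp add: power2_eq_square)
  also have "K * ((1 + K * d i) * (s - slope i x)) \<le> \<kappa> * \<bar>(1 + K * d i) * (s - slope i x)\<bar>"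
  proof -
    have "K * y \<le> \<bar>K\<bar> * \<bar>y\<bar>" for y
      using abs_ge_self[of "K * y"] by (simp add: abs_mult)
    then show ?thesis
      unfolding assms(2) .
  qed
  finally have "K * F K i x \<le> \<kappa> * \<bar>(1 + K * d i) * (s - slope i x)\<bar> - \<kappa> * \<kappa> * (s\<^sup>2 + h'\<^sup>2)"
    by simp
  moreover have "\<kappa> * \<bar>(1 + K * d i) * (s - slope i x)\<bar> < \<kappa> * (\<kappa> * (s\<^sup>2 + h'\<^sup>2))"
    using 3 \<kappa>(1) by simp
  ultimately show ?thesis
    by (simp add: mult.assoc)
qed

lemma ball_b_subset: "norm (x - b) \<le> R / 4 \<Longrightarrow> norm (x - x0) \<le> 3 * R / 8"
  using norm_triangle_ineq[of "x - b" "b - x0"] b_near by simp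

lemma \<eta>_height:
  assumes "i < k" "norm (x - b) \<le> R / 4"
  shows "\<bar>\<eta> i x - (height i x - slope i x)\<bar> \<le> M * horiz x"
proof -
  have x: "x \<in> ball x0 R"
    using ball_b_subset[OF assms(2)] R by (simp add: dist_norm norm_minus_commute)
  have "\<eta> i x - (height i x - slope i x) =
      - (f i (hcoord e x) - f i (hcoord e b) - Df i (hcoord e b) \<bullet> (x - b))"
    by (simp add: \<eta>_def height_def d_def slope_def inner_diff_left)
  then show ?thesis
    using \<eta>_taylor[OF assms(1) x b_ball] by (simp add: horiz_def)
qed

text \<open>\<open>F > 0\<close> forces \<open>\<kappa> * horiz x\<close> below twice the linearized
  height, and \<open>2 * M \<le> \<kappa>\<close> makes that height exceed the Taylor
  remainder.\<close>

lemma F_pos_imp_\<eta>_pos: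
  assumes "i < k" "norm (x - b) \<le> R / 4" "0 < F \<kappa> i x"
  shows "0 < \<eta> i x"
proof -
  have kd: "1 + \<kappa> * d i \<le> 2" "0 < 1 + \<kappa> * d i"
    using Kd_small[OF assms(1), of \<kappa>] \<kappa>(1) by (auto simp: abs_le_iff)
  define w where "w = height i x - slope i x"
  have "\<kappa> * horiz x \<le> \<kappa> * ((height i x)\<^sup>2 + horiz x)"
    using \<kappa>(1) by simp
  then have lt: "\<kappa> * horiz x < (1 + \<kappa> * d i) * w"
    using assms(3) by (simp add: F_def w_def)
  have "0 \<le> \<kappa> * horiz x"
    using \<kappa>(1) horiz_nonneg by simp
  with lt have "0 < (1 + \<kappa> * d i) * w"
    by (rule le_less_trans[rotated])
  then have "0 < w"
    using kd(2) by (simp add: zero_less_mult_iff)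
  then have "(1 + \<kappa> * d i) * w \<le> 2 * w"
    using kd(1) by (intro mult_right_mono) auto
  moreover have "2 * (M * horiz x) \<le> \<kappa> * horiz x"
    using mult_right_mono[OF \<kappa>(2) horiz_nonneg] by (simp add: mult.assoc)
  ultimately have "2 * (M * horiz x) < 2 * w"
    using lt by (meson le_less_trans less_le_trans)
  then have "M * horiz x < height i x - slope i x"
    by (simp add: w_def)
  then show ?thesis
    using \<eta>_height[OF assms(1,2)] by linarith
qed

lemma \<eta>_pos_imp_F_pos:
  assumes "i < k" "norm (x - b) \<le> R / 4" "0 < \<eta> i x"
  shows "0 < F (- \<kappa>) i x"
proof -
  define w where "w = height i x - slope i x"
  have kd: "1 + (- \<kappa>) * d i \<le> 2" "0 < 1 + (- \<kappa>) * d i"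
    using Kd_small[OF assms(1), of "- \<kappa>"] \<kappa>(1) by (auto simp: abs_le_iff)
  have w: "0 < w + M * horiz x"
    using \<eta>_height[OF assms(1,2)] assms(3) by (simp add: w_def abs_le_iff)
  have "0 < (1 + (- \<kappa>) * d i) * w + 2 * (M * horiz x)"
  \<comment> \<open>A nonpositive \<open>w\<close> is multiplied by at most 2, which the doubled
    remainder covers; for a positive one a positive factor suffices.\<close>
  proof (cases "w > 0")
    case True
    then show ?thesis
      using kd(2) M_nonneg horiz_nonneg by (simp add: add_pos_nonneg)
  next
    case False
    then have "2 * w \<le> (1 + (- \<kappa>) * d i) * w"
      using kd(1) by (intro mult_right_mono_neg) auto
    then show ?thesis
      using w by linarith
  qed
  moreover have "2 * (M * horiz x) \<le> \<kappa> * horiz x"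
    using mult_right_mono[OF \<kappa>(2) horiz_nonneg] by (simp add: mult.assoc)
  moreover have "\<kappa> * horiz x \<le> \<kappa> * ((height i x)\<^sup>2 + horiz x)"
    using \<kappa>(1) by simp
  ultimately show ?thesis
    unfolding F_def w_def[symmetric] by simp
qed

lemma inner_domain_near:
  assumes "x \<in> Dom \<kappa>"
  shows "norm (x - b) \<le> R / 4"
proof (rule ccontr)
  assume far: "\<not> ?thesis"
  have "\<not> 0 < F \<kappa> i x" if "i < k" for i
    using F_far[OF that, of \<kappa> x] far \<kappa>(1) by (auto simp: mult_less_0_iff)
  then have "{i. i < k \<and> 0 < F \<kappa> i x} = {}" by blast
  moreover have "{i. i < k \<and> 0 < F \<kappa> i x} \<in> \<I>"
    using assms mobius_domain_iff[of \<kappa> x] \<kappa>(1) by simp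
  ultimately show False
    using empty_notin_\<I> by metis
qed

lemma inner_domain_subset:
  assumes "x \<in> Dom \<kappa>"
  shows "x \<in> \<Omega>"
proof -
  note x = inner_domain_near[OF assms]
  have "x \<in> ball x0 R"
    using ball_b_subset[OF x] R by (simp add: dist_norm norm_minus_commute)
  moreover have "{i. i < k \<and> 0 < F \<kappa> i x} \<in> \<I>"
    using assms mobius_domain_iff[of \<kappa> x] \<kappa>(1) by simp
  then have "{i. i < k \<and> 0 < \<eta> i x} \<in> \<I>"
    by (rule \<I>_mono) (rule F_pos_imp_\<eta>_pos[OF _ x])
  ultimately show ?thesis
    using \<Omega>_iff' by blast
qed

text \<open>The hypothesis concerns only points within R/4 of \<open>b\<close>: farther away every
  sign is positive and the full pattern is admissible. So no information on \<Omega> at larger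
  distance enters.\<close>

lemma outer_domain_superset:
  assumes "norm (x - b) \<le> R / 4 \<Longrightarrow> x \<in> \<Omega>"
  shows "x \<in> Dom (- \<kappa>)"
proof (cases "norm (x - b) \<le> R / 4")
  case True
  then have "x \<in> ball x0 R"
    using ball_b_subset[OF True] R by (simp add: dist_norm norm_minus_commute)
  then have "{i. i < k \<and> 0 < \<eta> i x} \<in> \<I>"
    using assms[OF True] \<Omega>_iff' by blast
  then have "{i. i < k \<and> 0 < F (- \<kappa>) i x} \<in> \<I>"
    by (rule \<I>_mono) (rule \<eta>_pos_imp_F_pos[OF _ True])
  then show ?thesis
    using mobius_domain_iff[of "- \<kappa>" x] \<kappa>(1) by simp
next
  case False
  have "0 < F (- \<kappa>) i x" if "i < k" for i
    using F_far[OF that, of "- \<kappa>" x] False \<kappa>(1) by (auto simp: zero_less_mult_iff)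
  then have "{i. i < k \<and> 0 < F (- \<kappa>) i x} = {..<k}" by auto
  then show ?thesis
    using mobius_domain_iff[of "- \<kappa>" x] \<kappa>(1) full_in_\<I> by simp
qed

section \<open>The two one-sided comparisons at \<open>b\<close>\<close>

lemma mobius_at_b:
  assumes "K \<noteq> 0"
  shows "b \<noteq> mobius_pole e K b" "mobius_denom e K b b = 1" "mobius e K b b = 0"
proof -
  show *: "b \<noteq> mobius_pole e K b"
    using assms e by (auto simp: mobius_pole_def)
  show 1: "mobius_denom e K b b = 1"
    using mobius_denom_eq[OF assms e, of b b] by simp
  show "mobius e K b b = 0"
    using mobius_scaled[OF assms e *] 1 by simp
qed

lemma b_in_domain: "K \<noteq> 0 \<Longrightarrow> b \<in> Dom K"
  using mobius_at_b T_in_V_iff[OF b_ball] b linear_0[OF linear_A] by (simp add: mobius_domain_def)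

lemma mobius_barrier_at_b:
  "K \<noteq> 0 \<Longrightarrow> barrier \<tau> K u b =
    exp ((real DIM('a) - 2) / 2 * \<tau>) * u (T b)"
  using mobius_at_b linear_0[OF linear_A] by (simp add: mobius_barrier_def powr_def)

lemma continuous_A: "continuous_on UNIV (\<lambda>w. A K w + T b)"
  using linear_A by (intro continuous_intros linear_continuous_on) (simp add: linear_conv_bounded_linear)

lemma V_ne_UNIV: "V \<noteq> UNIV"
  using x0_notin_V by blast

lemma shift_tendsto:
  assumes "isCont w b"
  shows "((\<lambda>t. w (b + t *\<^sub>R e)) \<longlongrightarrow> w b) (at_right 0)"
proof -
  have "((\<lambda>t. b + t *\<^sub>R e) \<longlongrightarrow> b + 0 *\<^sub>R e) (at_right 0)"
    by (intro tendsto_intros)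
  then show ?thesis
    using isCont_tendsto_compose[OF assms] by simp
qed

text \<open>The closure of the inner domain may touch the frontier of \<Omega>, where
  \<open>u\<close> is infinite. Translated by \<open>t\<close> along \<open>e\<close>,
  \<open>u\<close> is continuous on that closure and lies below the barrier, which blows up; the
  limit in \<open>t\<close> is taken at \<open>b\<close> alone.\<close>

lemma upper_bound:
  assumes dim: "DIM('a) \<ge> 3"
    and u: "loewner_nirenberg_solution \<Omega> u" and uV: "loewner_nirenberg_solution V u\<^sub>V"
    and super: "\<And>x. x \<in> Dom \<kappa> \<Longrightarrow>
      \<exists>L. has_laplacian (barrier \<tau> \<kappa> u\<^sub>V) x L \<and>
        L \<le> ln_nonlinearity (real DIM('a)) (barrier \<tau> \<kappa> u\<^sub>V x)"
    and A1: "\<And>h. norm (A \<kappa> h - h) \<le> norm h"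
  shows "u b \<le> exp ((real DIM('a) - 2) / 2 * \<tau>) * u\<^sub>V (T b)"
proof -
  define G where "G = Dom \<kappa>"
  define W where "W = barrier \<tau> \<kappa> u\<^sub>V"
  have \<kappa>0: "\<kappa> \<noteq> 0" using \<kappa>(1) by simp
  obtain L where L: "\<And>x. x \<in> G \<Longrightarrow> has_laplacian W x (L x)"
    "\<And>x. x \<in> G \<Longrightarrow> L x \<le> ln_nonlinearity (real DIM('a)) (W x)"
    using super unfolding G_def W_def by metis
  have G: "G \<subseteq> \<Omega>" "G \<subseteq> cball b (R / 4)"
    using inner_domain_subset inner_domain_near by (auto simp: G_def dist_norm norm_minus_commute)
  have closure_near: "norm (x - b) \<le> R / 4" if "x \<in> closure G" for x
    using closure_minimal[OF G(2) closed_cball] that by (auto simp: dist_norm norm_minus_commute)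
  have shift: "x + t *\<^sub>R e \<in> \<Omega>" if "x \<in> closure G" "0 < t" "t < R / 4" for x t
  proof (rule closure_shift)
    show "x \<in> closure \<Omega>"
      using closure_mono[OF G(1)] that(1) by blast
    have "norm (x - x0) \<le> 3 * R / 8"
      using ball_b_subset closure_near that(1) by blast
    moreover have "norm (x + t *\<^sub>R e - x0) \<le> norm (x - x0) + t"
      using norm_triangle_ineq[of "x - x0" "t *\<^sub>R e"] e that(2) by (simp add: algebra_simps)
    ultimately show "x \<in> ball x0 R" "x + t *\<^sub>R e \<in> ball x0 R"
      using that(3) R by (simp_all add: dist_norm norm_minus_commute[of x0])
  qed fact
  have lapu: "has_laplacian u x (ln_nonlinearity (real DIM('a)) (u x))" if "x \<in> \<Omega>" for x
    using ln_solution_laplacian[OF u open_\<Omega> that] .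
  have le: "u (b + t *\<^sub>R e) \<le> W b" if t: "0 < t" "t < R / 4" for t
  proof (rule ln_comparison[OF dim, where v = "\<lambda>x. u (x + t *\<^sub>R e)"])
    show "open G"
      unfolding G_def by (rule open_mobius_domain[OF open_V continuous_A])
    show "bounded G"
      using G(2) bounded_cball bounded_subset by blast
    show "continuous_on (closure G) (\<lambda>x. u (x + t *\<^sub>R e))"
    proof (intro continuous_at_imp_continuous_on ballI)
      fix x assume "x \<in> closure G"
      then show "isCont (\<lambda>x. u (x + t *\<^sub>R e)) x"
        using has_laplacian_isCont[OF has_laplacian_translate[OF lapu[OF shift]]] t by blast
    qed
    show "has_laplacian (\<lambda>x. u (x + t *\<^sub>R e)) x (ln_nonlinearity (real DIM('a)) (u (x + t *\<^sub>R e)))"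
      if "x \<in> G" for x
      using has_laplacian_translate[OF lapu[OF shift]] closure_subset that t by blast
    show "filterlim W at_top (at p within G)" if "p \<in> frontier G" for p
      using that unfolding G_def W_def
      by (intro mobius_barrier_blowup[OF dim uV open_V V_ne_UNIV exterior_cone_V _ e \<kappa>0 linear_A A1])
        (use M_nonneg in auto)
    show "0 \<le> W x" if "x \<in> G" for x
      using that ln_solutionD(1)[OF uV] by (simp add: W_def mobius_barrier_def G_def mobius_domain_def)
    show "b \<in> G"
      unfolding G_def by (rule b_in_domain[OF \<kappa>0])
  qed (use L in auto)
  have "u b \<le> W b"
  proof (rule tendsto_upperbound[OF shift_tendsto])
    show "isCont u b"
      using has_laplacian_isCont[OF lapu[OF b]] .
    show "\<forall>\<^sub>F t in at_right 0. u (b + t *\<^sub>R e) \<le> W b"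
      using le R by (auto simp: eventually_at_right_field intro!: exI[of _ "R / 4"])
  qed simp
  then show ?thesis
    by (simp add: W_def mobius_barrier_at_b[OF \<kappa>0])
qed

text \<open>The roles are exchanged: the comparison takes place in \<Omega>, where \<open>u\<close>
  is the function that blows up, and the barrier is the one translated, so that it is evaluated
  inside its domain.\<close>

lemma lower_bound:
  assumes dim: "DIM('a) \<ge> 3"
    and u: "loewner_nirenberg_solution \<Omega> u" and uV: "loewner_nirenberg_solution V u\<^sub>V"
    and sub: "\<And>x. x \<in> Dom (- \<kappa>) \<Longrightarrow>
      \<exists>L. has_laplacian (barrier \<tau> (- \<kappa>) u\<^sub>V) x L \<and>
        ln_nonlinearity (real DIM('a)) (barrier \<tau> (- \<kappa>) u\<^sub>V x) \<le> L"
  shows "exp ((real DIM('a) - 2) / 2 * \<tau>) * u\<^sub>V (T b) \<le> u b"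
proof -
  define D where "D = Dom (- \<kappa>)"
  define W where "W = barrier \<tau> (- \<kappa>) u\<^sub>V"
  have \<kappa>0: "- \<kappa> \<noteq> 0" using \<kappa>(1) by simp
  obtain L where L: "\<And>x. x \<in> D \<Longrightarrow> has_laplacian W x (L x)"
    "\<And>x. x \<in> D \<Longrightarrow> ln_nonlinearity (real DIM('a)) (W x) \<le> L x"
    using sub unfolding D_def W_def by metis
  have shift: "x + t *\<^sub>R e \<in> D" if "x \<in> closure \<Omega>" "0 < t" "t < R / 4" for x t
    unfolding D_def
  proof (rule outer_domain_superset, rule closure_shift)
    assume near: "norm (x + t *\<^sub>R e - b) \<le> R / 4"
    then have *: "norm (x + t *\<^sub>R e - x0) \<le> 3 * R / 8"
      by (rule ball_b_subset)
    have "norm (x - x0) \<le> norm (x + t *\<^sub>R e - x0) + t"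
      using norm_triangle_ineq4[of "x + t *\<^sub>R e - x0" "t *\<^sub>R e"] e that(2) by (simp add: algebra_simps)
    with * show "x \<in> ball x0 R" "x + t *\<^sub>R e \<in> ball x0 R"
      using that(3) R by (simp_all add: dist_norm norm_minus_commute[of x0])
  qed (use that in auto)
  have le: "W (b + t *\<^sub>R e) \<le> u b" if t: "0 < t" "t < R / 4" for t
  proof (rule ln_comparison[OF dim open_\<Omega> bounded_\<Omega>, where v = "\<lambda>x. W (x + t *\<^sub>R e)"])
    show "continuous_on (closure \<Omega>) (\<lambda>x. W (x + t *\<^sub>R e))"
    proof (intro continuous_at_imp_continuous_on ballI)
      fix x assume "x \<in> closure \<Omega>"
      then show "isCont (\<lambda>x. W (x + t *\<^sub>R e)) x"
        using has_laplacian_isCont[OF has_laplacian_translate[OF L(1)[OF shift]]] t by blast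
    qed
    fix x assume "x \<in> \<Omega>"
    then have x: "x + t *\<^sub>R e \<in> D"
      using shift closure_subset t by blast
    show "has_laplacian (\<lambda>x. W (x + t *\<^sub>R e)) x (L (x + t *\<^sub>R e))"
      by (rule has_laplacian_translate[OF L(1)[OF x]])
    show "ln_nonlinearity (real DIM('a)) (W (x + t *\<^sub>R e)) \<le> L (x + t *\<^sub>R e)"
      by (rule L(2)[OF x])
    show "has_laplacian u x (ln_nonlinearity (real DIM('a)) (u x))"
      using ln_solution_laplacian[OF u open_\<Omega> \<open>x \<in> \<Omega>\<close>] .
  qed (use ln_solutionD[OF u] b in auto)
  have "W b \<le> u b"
  proof (rule tendsto_upperbound[OF shift_tendsto])
    show "isCont W b"
      using has_laplacian_isCont[OF L(1)] b_in_domain[OF \<kappa>0] by (simp add: D_def)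
    show "\<forall>\<^sub>F t in at_right 0. W (b + t *\<^sub>R e) \<le> u b"
      using le R by (auto simp: eventually_at_right_field intro!: exI[of _ "R / 4"])
  qed simp
  then show ?thesis
    using mobius_barrier_at_b[OF \<kappa>0, of \<tau> u\<^sub>V] by (simp add: W_def)
qed

end

lemma exp_minus_le:
  fixes x :: real
  assumes "0 \<le> x" "x \<le> 1 / 2"
  shows "exp (- 2 * x) \<le> 1 - x"
proof -
  have "1 \<le> (1 - x) * (1 + 2 * x)"
    using assms mult_nonneg_nonneg[of x "1 - 2 * x"] by (simp add: algebra_simps)
  also have "\<dots> \<le> (1 - x) * exp (2 * x)"
    using assms exp_ge_add_one_self[of "2 * x"] by (intro mult_left_mono) auto
  finally have "exp (- 2 * x) * 1 \<le> exp (- 2 * x) * ((1 - x) * exp (2 * x))"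
    by (intro mult_left_mono) auto
  also have "\<dots> = 1 - x"
    by (simp add: exp_minus)
  finally show ?thesis by simp
qed

text \<open>\<open>\<tau> = \<delta> / 2\<close> gives a supersolution by
  \<open>1 + \<delta> \<le> exp \<delta>\<close>, and \<open>\<tau> = - \<delta>\<close> a
  subsolution by \<open>exp (- 2 * \<delta>) \<le> 1 - \<delta>\<close>. At \<open>b\<close> the
  conformal factor is 1, so only the powers of \<open>exp \<tau>\<close> remain in the
  ratio.\<close>

lemma (in corner_point) solution_ratio:
  fixes u u\<^sub>V :: "'a \<Rightarrow> real"
  defines "m \<equiv> (real DIM('a) - 2) / 2"
  assumes dim: "DIM('a) \<ge> 3"
    and u: "loewner_nirenberg_solution \<Omega> u" and uV: "loewner_nirenberg_solution V u\<^sub>V"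
    and bar: "mobius_barrier_estimate C V u\<^sub>V e"
    and C: "0 < C" and E: "real k * N * (\<kappa> * (1 + M)\<^sup>2 + M) \<le> E"
    and small: "E * norm (b - x0) \<le> 1" "C * (E * norm (b - x0)) \<le> 1 / 2" "m * (C * (E * norm (b - x0))) \<le> 1"
  shows "\<bar>u b / u\<^sub>V (T b) - 1\<bar> \<le> m * C * E * norm (b - x0)"
proof -
  define \<epsilon> where "\<epsilon> = E * norm (b - x0)"
  define \<delta> where "\<delta> = C * \<epsilon>"
  have "0 \<le> real k * N * (\<kappa> * (1 + M)\<^sup>2 + M)"
    using N_nonneg M_nonneg \<kappa>(1) by simp
  then have "0 \<le> \<epsilon>" using E by (simp add: \<epsilon>_def)
  then have \<delta>: "0 \<le> \<delta>" "\<delta> \<le> 1 / 2" "m * \<delta> \<le> 1"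
    using C small by (simp_all add: \<delta>_def \<epsilon>_def)
  have m: "0 < m" using dim by (simp add: m_def)
  have A: "norm (A K h - h) \<le> \<epsilon> * norm h" if "\<bar>K\<bar> = \<kappa>" for K h
  proof -
    have "norm (A K h - h) \<le> (real k * N * (\<kappa> * (1 + M)\<^sup>2 + M)) * (norm (b - x0) * norm h)"
      using A_near_identity[OF that, of h] by (simp add: mult.assoc)
    also have "\<dots> \<le> E * (norm (b - x0) * norm h)"
      using E by (intro mult_right_mono) auto
    finally show ?thesis by (simp add: \<epsilon>_def mult.assoc)
  qed
  have bar_L: "\<exists>L. has_laplacian (barrier \<tau> K u\<^sub>V) x L \<and>
      (1 + \<delta> \<le> exp (2 * \<tau>) \<longrightarrow>
         L \<le> ln_nonlinearity (real DIM('a)) (barrier \<tau> K u\<^sub>V x)) \<and>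
      (exp (2 * \<tau>) \<le> 1 - \<delta> \<longrightarrow>
         ln_nonlinearity (real DIM('a)) (barrier \<tau> K u\<^sub>V x) \<le> L)"
    if "x \<in> Dom K" "\<bar>K\<bar> = \<kappa>" for K \<tau> x
    unfolding \<delta>_def
    by (rule bar[unfolded mobius_barrier_estimate_def, rule_format])
      (use that A \<open>0 \<le> \<epsilon>\<close> small(1) \<kappa>(1) linear_A in \<open>auto simp: \<epsilon>_def\<close>)
  have pos: "0 < u\<^sub>V (T b)"
    using ln_solution_pos[OF dim uV open_V exterior_cone_V _ e _ V_ne_UNIV] M_nonneg T_in_V_iff[OF b_ball] b
    by simp
  have up: "u b \<le> exp (m * (\<delta> / 2)) * u\<^sub>V (T b)"
    unfolding m_def
  proof (rule upper_bound[OF dim u uV])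
    fix x assume x: "x \<in> Dom \<kappa>"
    show "\<exists>L. has_laplacian (barrier (\<delta> / 2) \<kappa> u\<^sub>V) x L \<and>
        L \<le> ln_nonlinearity (real DIM('a)) (barrier (\<delta> / 2) \<kappa> u\<^sub>V x)"
      using bar_L[OF x, of "\<delta> / 2"] \<kappa>(1) exp_ge_add_one_self[of \<delta>] by auto
  next
    show "norm (A \<kappa> h - h) \<le> norm h" for h
      using A[of \<kappa> h] \<kappa>(1) small(1) mult_right_mono[of \<epsilon> 1 "norm h"] by (simp add: \<epsilon>_def)
  qed
  have low: "exp (m * (- \<delta>)) * u\<^sub>V (T b) \<le> u b"
    unfolding m_def
  proof (rule lower_bound[OF dim u uV])
    fix x assume x: "x \<in> Dom (- \<kappa>)"
    show "\<exists>L. has_laplacian (barrier (- \<delta>) (- \<kappa>) u\<^sub>V) x L \<and>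
        ln_nonlinearity (real DIM('a)) (barrier (- \<delta>) (- \<kappa>) u\<^sub>V x) \<le> L"
      using bar_L[OF x, of "- \<delta>"] \<kappa>(1) exp_minus_le[OF \<delta>(1,2)] by auto
  qed
  define t where "t = m * (\<delta> / 2)"
  have t: "0 \<le> t" "t \<le> 1" "m * \<delta> = 2 * t"
    using \<delta> m by (auto simp: t_def)
  have "exp t \<le> 1 + t + t\<^sup>2"
    using t by (intro exp_bound) auto
  also have "t\<^sup>2 \<le> t"
    using t mult_left_mono[of t 1 t] by (simp add: power2_eq_square)
  finally have "exp (m * (\<delta> / 2)) \<le> 1 + m * \<delta>"
    unfolding t_def[symmetric] t(3) by simp
  then have "exp (m * (\<delta> / 2)) * u\<^sub>V (T b) \<le> (1 + m * \<delta>) * u\<^sub>V (T b)"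
    using pos by (intro mult_right_mono) auto
  with up have "u b \<le> (1 + m * \<delta>) * u\<^sub>V (T b)"
    by (rule order_trans)
  then have "u b / u\<^sub>V (T b) \<le> 1 + m * \<delta>"
    using pos by (simp add: pos_divide_le_eq)
  moreover have "1 - m * \<delta> \<le> u b / u\<^sub>V (T b)"
  proof -
    have "1 - m * \<delta> \<le> exp (m * (- \<delta>))"
      using exp_ge_add_one_self[of "m * (- \<delta>)"] by simp
    then have "(1 - m * \<delta>) * u\<^sub>V (T b) \<le> exp (m * (- \<delta>)) * u\<^sub>V (T b)"
      using pos by (intro mult_right_mono) auto
    with low have "(1 - m * \<delta>) * u\<^sub>V (T b) \<le> u b"
      by (rule order_trans[rotated])
    then show ?thesis
      using pos by (simp add: pos_le_divide_eq)
  qed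
  ultimately have "\<bar>u b / u\<^sub>V (T b) - 1\<bar> \<le> m * \<delta>"
    by (simp add: abs_le_iff)
  then show ?thesis
    by (simp add: \<delta>_def \<epsilon>_def mult.assoc)
qed

section \<open>From the description of the boundary to the locale\<close>

definition inner_patterns ::
    "'a::euclidean_space set \<Rightarrow> 'a \<Rightarrow> real \<Rightarrow> 'a \<Rightarrow> nat \<Rightarrow> (nat \<Rightarrow> 'a \<Rightarrow> real) \<Rightarrow> nat set set" where
  "inner_patterns \<Omega> x0 R e k f =
     {I. I \<subseteq> {..<k} \<and> ball x0 R \<inter> {x. {i. i < k \<and> f i (hcoord e x) < x \<bullet> e} = I} \<subseteq> \<Omega>}"

lemma cell_iff_pattern:
  assumes "l \<in> {..<k} \<rightarrow>\<^sub>E {1, -1}"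
  shows "x \<in> cell e k \<phi> l \<longleftrightarrow> {i. i < k \<and> \<phi> i (hcoord e x) < x \<bullet> e} = {i. i < k \<and> l i = 1}"
proof -
  have "x \<in> cell e k \<phi> l \<longleftrightarrow> (\<forall>i<k. l i = 1 \<longleftrightarrow> \<phi> i (hcoord e x) < x \<bullet> e)"
    by (auto simp: cell_def graph_side_def not_less)
  then show ?thesis by auto
qed

text \<open>\<open>\<phi>\<close> is independent of the \<open>f\<close> that determines the
  admissible patterns: \<open>\<phi> = f\<close> describes \<Omega>, the tangent functions describe
  the cone.\<close>

lemma union_cells_iff_pattern:
  "(\<exists>l\<in>inner_signs \<Omega> x0 R e k f. x \<in> cell e k \<phi> l) \<longleftrightarrow>
     {i. i < k \<and> \<phi> i (hcoord e x) < x \<bullet> e} \<in> inner_patterns \<Omega> x0 R e k f"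
    (is "?L \<longleftrightarrow> ?I \<in> _")
proof
  assume ?L
  then obtain l where l: "l \<in> {..<k} \<rightarrow>\<^sub>E {1, -1}" "ball x0 R \<inter> cell e k f l \<subseteq> \<Omega>" "x \<in> cell e k \<phi> l"
    by (auto simp: inner_signs_def)
  have I: "?I = {i. i < k \<and> l i = 1}"
    using l(3) unfolding cell_iff_pattern[OF l(1)] .
  then show "?I \<in> inner_patterns \<Omega> x0 R e k f"
    using l(2) by (auto simp: inner_patterns_def I subset_iff cell_iff_pattern[OF l(1)])
next
  assume I: "?I \<in> inner_patterns \<Omega> x0 R e k f"
  define l :: "nat \<Rightarrow> int" where "l = restrict (\<lambda>i. if i \<in> ?I then 1 else - 1) {..<k}"
  have l: "l \<in> {..<k} \<rightarrow>\<^sub>E {1, -1}" by (auto simp: l_def)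
  have I_eq: "{i. i < k \<and> l i = 1} = ?I" by (auto simp: l_def)
  have "x \<in> cell e k \<phi> l"
    unfolding cell_iff_pattern[OF l] I_eq ..
  moreover have "ball x0 R \<inter> cell e k f l \<subseteq> \<Omega>"
    using I unfolding inner_patterns_def I_eq[symmetric]
    by (auto simp: subset_iff cell_iff_pattern[OF l])
  ultimately show ?L
    using l by (auto simp: inner_signs_def)
qed

text \<open>The rows of the inverse Gram matrix give the dual family of the unit normals, and
  division by \<open>norm (n i)\<close> passes to the unnormalized ones. Each entry is at most the
  Frobenius norm, whence the factor \<open>k\<close>.\<close>

lemma gram_inverse_dual:
  fixes n :: "nat \<Rightarrow> 'a::euclidean_space"
  assumes "gram_inverse_norm_le k (\<lambda>i. sgn (n i)) N" and n: "\<And>i. i < k \<Longrightarrow> 1 \<le> norm (n i)"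
  obtains n' where "\<And>i j. i < k \<Longrightarrow> j < k \<Longrightarrow> n' i \<bullet> n j = (if i = j then 1 else 0)"
    and "\<And>i. i < k \<Longrightarrow> norm (n' i) \<le> real k * N"
proof -
  obtain B :: "nat \<Rightarrow> nat \<Rightarrow> real" where
    B: "\<And>i j. i < k \<Longrightarrow> j < k \<Longrightarrow> (\<Sum>m<k. B i m * (sgn (n m) \<bullet> sgn (n j))) = (if i = j then 1 else 0)"
    and BN: "sqrt (\<Sum>i<k. \<Sum>j<k. (B i j)\<^sup>2) \<le> N"
    using assms(1) unfolding gram_inverse_norm_le_def by auto
  define n' where "n' i = (1 / norm (n i)) *\<^sub>R (\<Sum>m<k. B i m *\<^sub>R sgn (n m))" for i
  show thesis
  proof
    fix i j assume ij: "i < k" "j < k"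
    have "n j \<noteq> 0"
      using n[OF ij(2)] by auto
    then have "n j = norm (n j) *\<^sub>R sgn (n j)"
      by (simp add: sgn_div_norm)
    then have "n' i \<bullet> n j = n' i \<bullet> (norm (n j) *\<^sub>R sgn (n j))"
      by simp
    also have "\<dots> = norm (n j) / norm (n i) * (\<Sum>m<k. B i m * (sgn (n m) \<bullet> sgn (n j)))"
      by (simp add: n'_def inner_sum_left)
    also have "\<dots> = (if i = j then 1 else 0)"
      unfolding B[OF ij] using n[OF ij(1)] by auto
    finally show "n' i \<bullet> n j = (if i = j then 1 else 0)" .
  next
    fix i assume i: "i < k"
    have "norm (\<Sum>m<k. B i m *\<^sub>R sgn (n m)) \<le> (\<Sum>m<k. N)"
    proof (rule sum_norm_le)
      fix m assume m: "m \<in> {..<k}"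
      have "(B i m)\<^sup>2 \<le> (\<Sum>j<k. (B i j)\<^sup>2)"
        using m by (intro member_le_sum) auto
      also have "\<dots> \<le> (\<Sum>i<k. \<Sum>j<k. (B i j)\<^sup>2)"
        using i by (intro member_le_sum) (auto intro: sum_nonneg)
      finally have "\<bar>B i m\<bar> \<le> N"
        using BN real_le_rsqrt[of "\<bar>B i m\<bar>"] by fastforce
      moreover have "norm (sgn (n m)) \<le> 1"
        by (simp add: norm_sgn)
      ultimately show "norm (B i m *\<^sub>R sgn (n m)) \<le> N"
        using mult_mono[of "\<bar>B i m\<bar>" N "norm (sgn (n m))" 1] by (simp add: abs_ge_zero order_trans[OF abs_ge_zero])
    qed
    then have "norm (\<Sum>m<k. B i m *\<^sub>R sgn (n m)) \<le> real k * N" by simp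
    moreover have "norm (n' i) = norm (\<Sum>m<k. B i m *\<^sub>R sgn (n m)) / norm (n i)"
      by (simp add: n'_def)
    moreover have "\<dots> \<le> norm (\<Sum>m<k. B i m *\<^sub>R sgn (n m)) / 1"
      using n[OF i] by (intro divide_left_mono) auto
    ultimately show "norm (n' i) \<le> real k * N"
      by simp
  qed
qed

text \<open>Upward stability comes from the graph of \<open>g\<close>, the patterns from the
  decomposition into cells, the dual vectors from the Gram matrix. The bound
  \<open>DIM('a) * N\<close> instead of \<open>k * N\<close> keeps later constants independent of
  \<open>k\<close>.\<close>

lemma corner_of_boundary:
  fixes \<Omega> :: "'a::euclidean_space set"
  assumes dom: "bounded_lipschitz_domain \<Omega>" and x0: "x0 \<in> frontier \<Omega>" and k: "1 \<le> k" "k \<le> DIM('a)"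
    and bdry: "boundary_consists_of \<Omega> x0 R e k S f Df g L M"
    and gram: "gram_inverse_norm_le k (\<lambda>i. graph_normal e x0 (Df i)) N"
  obtains \<nu>' \<I> where
    "corner \<Omega> (tangent_cone \<Omega> x0 R e k f Df) x0 e R M (real DIM('a) * N) k f Df \<nu>' \<I>"
proof -
  have R: "R > 0" and e: "norm e = 1"
    and fg: "\<And>x. x \<in> \<Omega> \<inter> ball x0 R \<longleftrightarrow> x \<in> ball x0 R \<and> g (hcoord e x) < x \<bullet> e"
    and cells: "\<Omega> \<inter> ball x0 R = (\<Union>l\<in>inner_signs \<Omega> x0 R e k f. ball x0 R \<inter> cell e k f l)"
    and S: "\<And>i. i < k \<Longrightarrow> x0 \<in> S i \<and> S i \<inter> ball x0 R = ball x0 R \<inter> graph_of e (f i)"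
    and C11: "\<And>i. i < k \<Longrightarrow> C11_norm_le e (hdisc e x0 R) M (\<lambda>y. f i y - x0 \<bullet> e) (Df i)"
    using bdry unfolding boundary_consists_of_def graph_side_def by auto
  have ee: "e \<bullet> e = 1" using e by (simp add: norm_eq_1)
  have x0': "hcoord e x0 \<in> hdisc e x0 R"
    using hcoord_in_hdisc[OF e] R by simp
  have orth: "Df i y \<bullet> e = 0" if "i < k" "y \<in> hdisc e x0 R" for i y
    using C11[OF that(1)] that(2) by (simp add: C11_norm_le_def)
  have f_x0: "f i (hcoord e x0) = x0 \<bullet> e" if "i < k" for i
  proof -
    have "x0 \<in> ball x0 R \<inter> graph_of e (f i)"
      unfolding conjunct2[OF S[OF that], symmetric] using conjunct1[OF S[OF that]] R by simp
    then have "x0 \<in> graph_of e (f i)"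
      by blast
    then show ?thesis
      by (simp add: graph_of_def)
  qed
  define n where "n i = e - Df i (hcoord e x0)" for i
  \<comment> \<open>The component of \<open>n i\<close> along \<open>e\<close> is 1, since the
    gradient is orthogonal to \<open>e\<close>.\<close>
  have n: "1 \<le> norm (n i)" if "i < k" for i
    using Cauchy_Schwarz_ineq2[of "n i" e] orth[OF that x0'] e by (simp add: n_def inner_diff_left ee)
  have "gram_inverse_norm_le k (\<lambda>i. sgn (n i)) N"
    using gram by (simp add: n_def graph_normal_def)
  then obtain n' where n': "\<And>i j. i < k \<Longrightarrow> j < k \<Longrightarrow> n' i \<bullet> n j = (if i = j then 1 else 0)"
    "\<And>i. i < k \<Longrightarrow> norm (n' i) \<le> real k * N"
    using gram_inverse_dual n by blast
  have N: "0 \<le> N"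
  proof -
    have "0 \<le> real k * N"
      using n'(2)[of 0] k norm_ge_zero[of "n' 0"] by linarith
    then show ?thesis using k by (simp add: zero_le_mult_iff)
  qed
  show thesis
  proof
    show "corner \<Omega> (tangent_cone \<Omega> x0 R e k f Df) x0 e R M (real DIM('a) * N) k f Df n'
        (inner_patterns \<Omega> x0 R e k f)"
    proof
      fix i assume i: "i < k"
      show "(f i has_derivative (\<lambda>h. Df i y \<bullet> h)) (at y within hdisc e x0 R)" if "y \<in> hdisc e x0 R" for y
      proof -
        have "((\<lambda>y. f i y - x0 \<bullet> e) has_derivative (\<lambda>h. Df i y \<bullet> h)) (at y within hdisc e x0 R)"
          using C11[OF i] that by (simp add: C11_norm_le_def)
        from has_derivative_add_const[OF this, of "x0 \<bullet> e"] show ?thesis by simp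
      qed
      show "norm (Df i y) \<le> M" if "y \<in> hdisc e x0 R" for y
        using C11[OF i] that by (simp add: C11_norm_le_def)
      show "M-lipschitz_on (hdisc e x0 R) (Df i)"
        using C11[OF i] by (simp add: C11_norm_le_def)
      show "f i (hcoord e x0) = x0 \<bullet> e"
        using f_x0[OF i] .
      show "norm (n' i) \<le> real DIM('a) * N"
        using n'(2)[OF i] k(2) N mult_right_mono[of "real k" "real DIM('a)" N] by linarith
      show "n' i \<bullet> (e - Df j (hcoord e x0)) = (if i = j then 1 else 0)" if "j < k" for j
        using n'(1)[OF i that] by (simp add: n_def)
    next
      fix x assume x: "x \<in> ball x0 R"
      show "x \<in> \<Omega> \<longleftrightarrow> {i. i < k \<and> f i (hcoord e x) < x \<bullet> e} \<in> inner_patterns \<Omega> x0 R e k f"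
        unfolding union_cells_iff_pattern[symmetric] using cells x by blast
      fix t :: real
      assume "x \<in> \<Omega>" "0 < t" "x + t *\<^sub>R e \<in> ball x0 R"
      then show "x + t *\<^sub>R e \<in> \<Omega>"
        using fg[of x] fg[of "x + t *\<^sub>R e"] x by (simp add: hcoord_add_scale[OF e] inner_add_left ee)
    next
      have "tangent_fun e x0 (f i) (Df i) (hcoord e x) < x \<bullet> e \<longleftrightarrow> 0 < (e - Df i (hcoord e x0)) \<bullet> (x - x0)"
        if "i < k" for i x
      proof -
        have "tangent_fun e x0 (f i) (Df i) (hcoord e x) = x0 \<bullet> e + Df i (hcoord e x0) \<bullet> (x - x0)"
          using f_x0[OF that] inner_hcoord[OF orth[OF that x0']]
          by (simp add: tangent_fun_def hcoord_diff)
        then show ?thesis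
          by (simp add: inner_diff_left inner_diff_right inner_commute[of e]) linarith
      qed
      then have eq: "{i. i < k \<and> tangent_fun e x0 (f i) (Df i) (hcoord e x) < x \<bullet> e} =
          {i. i < k \<and> 0 < (e - Df i (hcoord e x0)) \<bullet> (x - x0)}" for x
        by blast
      show "tangent_cone \<Omega> x0 R e k f Df =
          {x. {i. i < k \<and> 0 < (e - Df i (hcoord e x0)) \<bullet> (x - x0)} \<in> inner_patterns \<Omega> x0 R e k f}"
        unfolding eq[symmetric] tangent_cone_def
        using union_cells_iff_pattern[where \<phi> = "\<lambda>i. tangent_fun e x0 (f i) (Df i)" and f = f]
        by (intro set_eqI) (simp only: UN_iff mem_Collect_eq)
    qed (use R e k orth dom x0 in \<open>auto simp: bounded_lipschitz_domain_def\<close>)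
  qed
qed

theorem theorem1p1:
  fixes L M R N :: real
  assumes "CARD('n::finite) \<ge> 3"
  shows "\<exists>C>0. \<forall>k (\<Omega> :: (real ^ 'n) set) x0 e S f Df g u u\<^sub>V.
     1 \<le> k \<and> k \<le> CARD('n) \<and>
     bounded_lipschitz_domain \<Omega> \<and> x0 \<in> frontier \<Omega> \<and>
     boundary_consists_of \<Omega> x0 R e k S f Df g L M \<and>
     linearly_independent_family k (\<lambda>i. graph_normal e x0 (Df i)) \<and>
     gram_inverse_norm_le k (\<lambda>i. graph_normal e x0 (Df i)) N \<and>
     loewner_nirenberg_solution \<Omega> u \<and>
     loewner_nirenberg_solution (tangent_cone \<Omega> x0 R e k f Df) u\<^sub>V
     \<longrightarrow>
     (\<exists>r>0. \<exists>T.
        C11_diffeo_on (ball x0 r) T \<and>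
        T ` (\<Omega> \<inter> ball x0 r) = tangent_cone \<Omega> x0 R e k f Df \<inter> T ` ball x0 r \<and>
        T ` (frontier \<Omega> \<inter> ball x0 r) =
          frontier (tangent_cone \<Omega> x0 R e k f Df) \<inter> T ` ball x0 r \<and>
        (\<forall>x\<in>\<Omega> \<inter> ball x0 (r / 2). \<bar>u x / u\<^sub>V (T x) - 1\<bar> \<le> C * norm (x - x0)))"
proof (cases "0 < R \<and> 0 \<le> M \<and> 0 \<le> N")
  \<comment> \<open>For such parameters the hypotheses contradict each other, so any constant will
    do.\<close>
  case False
  have no_data: "False"
    if "1 \<le> k" "boundary_consists_of \<Omega> x0 R e k S f Df g L M"
      "gram_inverse_norm_le k (\<lambda>i. graph_normal e x0 (Df i)) N"
      "bounded_lipschitz_domain \<Omega>" "x0 \<in> frontier \<Omega>" "k \<le> CARD('n)"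
    for k and \<Omega> :: "(real ^ 'n) set" and x0 e S f Df g
  proof -
    have "k \<le> DIM(real ^ 'n)"
      using that(6) by simp
    from corner_of_boundary[OF that(4,5,1) this that(2,3)] obtain \<nu>' \<I> where
      corner: "corner \<Omega> (tangent_cone \<Omega> x0 R e k f Df) x0 e R M (real DIM(real ^ 'n) * N) k f Df \<nu>' \<I>" .
    from corner.R[OF corner] corner.M_nonneg[OF corner] corner.N_nonneg[OF corner]
    show False
      using False by (auto simp: zero_le_mult_iff)
  qed
  show ?thesis
    by (intro exI[of _ "1 :: real"] conjI allI impI zero_less_one) (elim conjE, rule FalseE, rule no_data)
next
  case True
  then have R: "0 < R" and M: "0 \<le> M" and N: "0 \<le> N" by auto
  have dim: "DIM(real ^ 'n) \<ge> 3" using assms by simp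
  define n where "n = real CARD('n)"
  define m where "m = (n - 2) / 2"
  have m: "m > 0" using assms by (simp add: m_def n_def)
  \<comment> \<open>The sum of the two lower bounds that \<open>corner_point\<close> imposes on
    \<open>\<kappa>\<close>.\<close>
  define \<kappa> where "\<kappa> = 32 * (1 + M) / R + 2 * M"
  have "0 < 32 * (1 + M) / R"
    using R M by simp
  then have \<kappa>: "0 < \<kappa>" "2 * M \<le> \<kappa>"
    using M by (simp_all add: \<kappa>_def del: zero_less_divide_iff)
  have \<kappa>R: "32 * (1 + M) \<le> \<kappa> * R"
    using R M by (simp add: \<kappa>_def field_simps)
  \<comment> \<open>The dimension replaces \<open>k\<close>, and \<open>n * N\<close> bounds the
    dual vectors, so that \<open>E\<close> is fixed before \<open>k\<close> and \<Omega>.\<close>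
  define E where "E = n * (n * N) * (\<kappa> * (1 + M)\<^sup>2 + M)"
  have E: "0 \<le> E" using N M \<kappa>(1) by (simp add: E_def n_def)
  have "0 < 1 / (1 + M)" using M by simp
  from mobius_barrier_laplacian[OF dim this] obtain C where "C > 0" and
    C: "\<And>(V :: (real ^ 'n) set) u e. loewner_nirenberg_solution V u \<Longrightarrow> open V \<Longrightarrow> V \<noteq> UNIV \<Longrightarrow>
      exterior_cone V e (1 / (1 + M)) \<Longrightarrow> norm e = 1 \<Longrightarrow> mobius_barrier_estimate C V u e"
    by blast
  \<comment> \<open>Each summand is the coefficient of one smallness condition on \<open>r\<close>
    or |x - x0|; with \<open>r = 1 / Z\<close> all of them hold together.\<close>
  define Z where "Z = 1 / R + 2 * (n * (n * N) * M) + 2 * (\<kappa> * (1 + M)) + 8 * (1 + M) / R +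
    E + 2 * (C * E) + m * (C * E)"
  have terms: "0 < 1 / R" "0 \<le> 2 * (n * (n * N) * M)" "0 \<le> 2 * (\<kappa> * (1 + M))" "0 \<le> 8 * (1 + M) / R"
    "0 \<le> E" "0 \<le> 2 * (C * E)" "0 \<le> m * (C * E)"
    using R M N \<kappa>(1) E \<open>C > 0\<close> m by (auto simp: n_def)
  have Z: "0 < Z" using terms unfolding Z_def by linarith
  define r where "r = 1 / Z"
  have r: "0 < r" using Z by (simp add: r_def)
  have bound: "z * \<rho> \<le> 1" if "z \<le> Z" "0 \<le> z" "0 \<le> \<rho>" "\<rho> \<le> r" for z \<rho>
  proof -
    have "z * \<rho> \<le> Z * r"
      using that Z by (intro mult_mono) auto
    then show ?thesis using Z by (simp add: r_def)
  qed
  show ?thesis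
  \<comment> \<open>The summand 1 keeps the constant positive when \<open>E\<close> is 0.\<close>
  proof (rule exI[of _ "m * C * E + 1"], intro conjI allI impI)
    show "0 < m * C * E + 1"
      using terms(7) by (simp add: mult.assoc)
    fix k and \<Omega> :: "(real ^ 'n) set" and x0 e S f Df g u u\<^sub>V
    define V where V_eq: "V = tangent_cone \<Omega> x0 R e k f Df"
    assume "1 \<le> k \<and> k \<le> CARD('n) \<and>
     bounded_lipschitz_domain \<Omega> \<and> x0 \<in> frontier \<Omega> \<and>
     boundary_consists_of \<Omega> x0 R e k S f Df g L M \<and>
     linearly_independent_family k (\<lambda>i. graph_normal e x0 (Df i)) \<and>
     gram_inverse_norm_le k (\<lambda>i. graph_normal e x0 (Df i)) N \<and>
     loewner_nirenberg_solution \<Omega> u \<and>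
     loewner_nirenberg_solution (tangent_cone \<Omega> x0 R e k f Df) u\<^sub>V"
    then have k: "1 \<le> k" "k \<le> CARD('n)" and dom: "bounded_lipschitz_domain \<Omega>" "x0 \<in> frontier \<Omega>"
      and bdry: "boundary_consists_of \<Omega> x0 R e k S f Df g L M"
      and gram: "gram_inverse_norm_le k (\<lambda>i. graph_normal e x0 (Df i)) N"
      and u: "loewner_nirenberg_solution \<Omega> u" and uV: "loewner_nirenberg_solution V u\<^sub>V"
      by (auto simp: V_eq)
    obtain \<nu>' \<I> where corner: "corner \<Omega> V x0 e R M (n * N) k f Df \<nu>' \<I>"
      using corner_of_boundary[OF dom k(1) _ bdry gram] k(2) unfolding V_eq n_def by auto
    have kn: "real k \<le> n" using k(2) by (simp add: n_def)
    interpret corner \<Omega> V x0 e R M "n * N" k f Df \<nu>' \<I> by (rule corner)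
    have "1 / R \<le> Z"
      using terms unfolding Z_def by linarith
    then have rR: "r \<le> R"
      using bound[of "1 / R" r] R r by (simp add: pos_divide_le_eq)
    have kNM: "real k * (n * N) * M * r \<le> 1 / 2"
    proof -
      have "2 * (n * (n * N) * M) * r \<le> 1"
        using bound[of "2 * (n * (n * N) * M)" r] terms r unfolding Z_def by linarith
      moreover have "real k * (n * N) * M * r \<le> n * (n * N) * M * r"
        using kn N M r by (intro mult_right_mono) (auto simp: n_def)
      ultimately show ?thesis by linarith
    qed
    have diffeo: "C11_diffeo_on (ball x0 r) T"
      by (rule T_diffeo[OF r rR kNM])
    have image: "T ` (\<Omega> \<inter> ball x0 r) = V \<inter> T ` ball x0 r"
      by (rule T_image[OF rR])
    have frontier: "T ` (frontier \<Omega> \<inter> ball x0 r) = frontier V \<inter> T ` ball x0 r"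
      by (rule C11_diffeo_image_frontier[OF diffeo open_\<Omega> open_V image])
    have "\<bar>u x / u\<^sub>V (T x) - 1\<bar> \<le> (m * C * E + 1) * norm (x - x0)"
      if x: "x \<in> \<Omega> \<inter> ball x0 (r / 2)" for x
    proof -
      define \<rho> where "\<rho> = norm (x - x0)"
      have \<rho>: "0 \<le> \<rho>" "\<rho> \<le> r"
        using x r by (auto simp: \<rho>_def dist_norm norm_minus_commute)
      have small: "2 * (\<kappa> * (1 + M)) * \<rho> \<le> 1" "8 * (1 + M) / R * \<rho> \<le> 1" "E * \<rho> \<le> 1" "2 * (C * E) * \<rho> \<le> 1"
        "m * (C * E) * \<rho> \<le> 1"
        using terms by (intro bound \<rho>; simp add: Z_def)+
      interpret corner_point \<Omega> V x0 e R M "n * N" k f Df \<nu>' \<I> x \<kappa>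
      proof
        show "x \<in> \<Omega>" using x by blast
        show "\<kappa> * ((1 + M) * norm (x - x0)) \<le> 1 / 2"
          using small(1) by (simp add: \<rho>_def mult.assoc)
        show "(1 + M) * norm (x - x0) \<le> R / 8"
          using small(2) R by (simp add: \<rho>_def field_simps)
      qed (use \<kappa> \<kappa>R in auto)
      have "\<bar>u x / u\<^sub>V (T x) - 1\<bar> \<le> (real DIM(real ^ 'n) - 2) / 2 * C * E * norm (x - x0)"
      proof (rule solution_ratio[OF dim u uV C[OF uV open_V V_ne_UNIV exterior_cone_V e] \<open>C > 0\<close>])
        show "real k * (n * N) * (\<kappa> * (1 + M)\<^sup>2 + M) \<le> E"
          unfolding E_def using kn N M \<kappa>(1) by (intro mult_right_mono) (auto simp: n_def)
        show "(real DIM(real ^ 'n) - 2) / 2 * (C * (E * norm (x - x0))) \<le> 1"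
          using small(5) by (simp add: \<rho>_def m_def n_def mult.assoc)
        show "C * (E * norm (x - x0)) \<le> 1 / 2"
          using small(4) by (simp add: \<rho>_def mult.assoc)
        show "E * norm (x - x0) \<le> 1"
          using small(3) by (simp add: \<rho>_def)
      qed
      also have "\<dots> \<le> (m * C * E + 1) * norm (x - x0)"
        by (simp add: m_def n_def distrib_right)
      finally show ?thesis .
    qed
    then show "\<exists>r>0. \<exists>T. C11_diffeo_on (ball x0 r) T \<and>
        T ` (\<Omega> \<inter> ball x0 r) = tangent_cone \<Omega> x0 R e k f Df \<inter> T ` ball x0 r \<and>
        T ` (frontier \<Omega> \<inter> ball x0 r) =
          frontier (tangent_cone \<Omega> x0 R e k f Df) \<inter> T ` ball x0 r \<and>
        (\<forall>x\<in>\<Omega> \<inter> ball x0 (r / 2). \<bar>u x / u\<^sub>V (T x) - 1\<bar> \<le> (m * C * E + 1) * norm (x - x0))"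
      unfolding V_eq[symmetric]
      by (intro exI[of _ r] exI[of _ T] conjI ballI r diffeo image frontier)
  qed
qed

end
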